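(* Let $s\in(0,1)$ and let $(\bar u,\bar z)$ be the optimal pair of the fractional optimal control problem with data $\Omega$, $A$, $u_d$, $\vartheta>0$, $a<b$ (see context), and let $\bar p$ be the corresponding optimal adjoint state. Suppose that $\Omega$ is convex, $A\in C^{0,1}(\bar\Omega)$, $a<0<b$ and $u_d\in\mathbb H^{1-s}(\Omega)$. Then $\bar u\in\mathbb H^{\kappa}(\Omega)$ with $\kappa=\min\{1+2s,2\}$. If, in addition, $u_d\in H^1_0(\Omega)$, then $\bar p\in\mathbb H^{\kappa}(\Omega)$ with $\kappa=\min\{1+2s,2\}$.
   Context: $\Omega\subset\mathbb R^n$ ($n\ge1$) is open, bounded, connected, with Lipschitz boundary. $\mathcal L w=-\mathrm{div}(A\nabla w)$ with homogeneous Dirichlet boundary conditions, where $A$ is a symmetric, bounded, measurable, uniformly elliptic matrix field on $\Omega$. Let $\{(\lambda_k,\varphi_k)\}_{k\ge1}$ be its eigenpairs ($\mathcal L\varphi_k=\lambda_k\varphi_k$ in $\Omega$, $\varphi_k=0$ on $\partial\Omega$), with $\{\varphi_k\}$ an orthonormal basis of $L^2(\Omega)$. For $r\ge0$, $\mathbb H^r(\Omega)=\{w=\sum_k w_k\varphi_k:\ \sum_k\lambda_k^{r}w_k^2<\infty\}$, with norm $\|w\|_{\mathbb H^r(\Omega)}=(\sum_k\lambda_k^r w_k^2)^{1/2}$; for $r\in(1,2]$ and $\Omega$ convex (with $A$ Lipschitz) this space is $H^r(\Omega)\cap H^1_0(\Omega)$. The dual of $\mathbb H^s(\Omega)$ is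 $\mathbb H^{-s}(\Omega)$. For $s\in(0,1)$, $\mathcal L^s w=\sum_k\lambda_k^s w_k\varphi_k$, and $\mathbf S:\mathbb H^{-s}(\Omega)\to\mathbb H^s(\Omega)$ is the solution operator $z\mapsto u$ of $\mathcal L^s u=z$ in $\Omega$, $u=0$ on $\partial\Omega$. Fractional optimal control problem: given $\vartheta>0$, $u_d\in L^2(\Omega)$ and real numbers $a<b$, minimize $J(u,z)=\tfrac12\|u-u_d\|_{L^2(\Omega)}^2+\tfrac{\vartheta}{2}\|z\|_{L^2(\Omega)}^2$ subject to $u=\mathbf S z$ and $z\in Z_{ad}=\{w\in L^2(\Omega): a\le w\le b \text{ a.e. in }\Omega\}$. It has a unique solution $(\bar u,\bar z)$, and the optimal adjoint state is $\bar p=\mathbf S(\bar u-u_d)$. *)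

theory Defs
  imports "HOL-Analysis.Analysis"
begin

text \<open>Functions on \<open>\<Omega>\<close> are represented by total functions on the ambient space of which only the
  values on \<open>\<Omega>\<close> matter, up to null sets; no quotient by almost-everywhere equality is taken.\<close>

section \<open>Domains and coefficients\<close>

text \<open>Near each boundary point, \<open>\<Omega>\<close> is the strict subgraph, in some direction \<open>\<nu>\<close>, of a Lipschitz
  function on the hyperplane orthogonal to \<open>\<nu>\<close> (a single point if \<open>n = 1\<close>);
  \<open>x - (x \<bullet> \<nu>) *\<^sub>R \<nu>\<close> is the orthogonal projection of \<open>x\<close> onto that hyperplane.\<close>

definition lipschitz_boundary :: "(real ^ 'n) set \<Rightarrow> bool" where
  "lipschitz_boundary \<Omega> \<longleftrightarrow>
    (\<forall>x0 \<in> frontier \<Omega>. \<exists>\<nu> r \<gamma> L. norm \<nu> = 1 \<and> 0 < r \<and> L-lipschitz_on {y. y \<bullet> \<nu> = 0} (\<gamma> :: real ^ 'n \<Rightarrow> real) \<and>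
      \<Omega> \<inter> ball x0 r = {x \<in> ball x0 r. x \<bullet> \<nu> < \<gamma> (x - (x \<bullet> \<nu>) *\<^sub>R \<nu>)})"

definition lipschitz_domain :: "(real ^ 'n) set \<Rightarrow> bool" where
  "lipschitz_domain \<Omega> \<longleftrightarrow> open \<Omega> \<and> bounded \<Omega> \<and> connected \<Omega> \<and> lipschitz_boundary \<Omega>"

definition elliptic_coefficient :: "(real ^ 'n) set \<Rightarrow> (real ^ 'n \<Rightarrow> real ^ 'n ^ 'n) \<Rightarrow> bool" where
  "elliptic_coefficient \<Omega> A \<longleftrightarrow>
    A \<in> borel_measurable (lebesgue_on \<Omega>) \<and>
    (AE x in lebesgue_on \<Omega>. transpose (A x) = A x) \<and>
    (\<exists>M. AE x in lebesgue_on \<Omega>. norm (A x) \<le> M) \<and>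
    (\<exists>\<alpha>>0. AE x in lebesgue_on \<Omega>. \<forall>\<xi>. \<alpha> * (norm \<xi>)\<^sup>2 \<le> \<xi> \<bullet> (A x *v \<xi>))"

section \<open>\<open>L\<^sup>2\<close> and \<open>H\<^sup>1\<^sub>0\<close>\<close>

definition L2_fun :: "(real ^ 'n) set \<Rightarrow> (real ^ 'n \<Rightarrow> real) set" where
  "L2_fun \<Omega> = {w \<in> borel_measurable (lebesgue_on \<Omega>). integrable (lebesgue_on \<Omega>) (\<lambda>x. (w x)\<^sup>2)}"

definition L2_inner :: "(real ^ 'n) set \<Rightarrow> (real ^ 'n \<Rightarrow> real) \<Rightarrow> (real ^ 'n \<Rightarrow> real) \<Rightarrow> real" where
  "L2_inner \<Omega> v w = integral\<^sup>L (lebesgue_on \<Omega>) (\<lambda>x. v x * w x)"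

definition L2_norm :: "(real ^ 'n) set \<Rightarrow> (real ^ 'n \<Rightarrow> real) \<Rightarrow> real" where
  "L2_norm \<Omega> w = sqrt (L2_inner \<Omega> w w)"

definition partial_deriv :: "'n \<Rightarrow> (real ^ 'n \<Rightarrow> real) \<Rightarrow> real ^ 'n \<Rightarrow> real" where
  "partial_deriv i f x = frechet_derivative f (at x) (axis i 1)"

primrec Ck_fun :: "nat \<Rightarrow> (real ^ 'n \<Rightarrow> real) \<Rightarrow> bool" where
  "Ck_fun 0 f \<longleftrightarrow> continuous_on UNIV f"
| "Ck_fun (Suc k) f \<longleftrightarrow> (\<forall>x. f differentiable (at x)) \<and> (\<forall>i. Ck_fun k (partial_deriv i f))"

definition test_fun :: "(real ^ 'n) set \<Rightarrow> (real ^ 'n \<Rightarrow> real) set" where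
  "test_fun \<Omega> = {\<psi>. (\<forall>k. Ck_fun k \<psi>) \<and> compact (closure {x. \<psi> x \<noteq> 0}) \<and> closure {x. \<psi> x \<noteq> 0} \<subseteq> \<Omega>}"

text \<open>\<open>w \<in> H\<^sup>1(\<Omega>)\<close> with distributional gradient \<open>G\<close>.\<close>

definition has_weak_gradient :: "(real ^ 'n) set \<Rightarrow> (real ^ 'n \<Rightarrow> real) \<Rightarrow> (real ^ 'n \<Rightarrow> real ^ 'n) \<Rightarrow> bool" where
  "has_weak_gradient \<Omega> w G \<longleftrightarrow>
    w \<in> L2_fun \<Omega> \<and> (\<forall>i. (\<lambda>x. G x $ i) \<in> L2_fun \<Omega>) \<and>
    (\<forall>i. \<forall>\<psi> \<in> test_fun \<Omega>. L2_inner \<Omega> w (partial_deriv i \<psi>) = - L2_inner \<Omega> (\<lambda>x. G x $ i) \<psi>)"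

text \<open>Closure of the test functions in \<open>H\<^sup>1(\<Omega>)\<close>.\<close>

definition H10 :: "(real ^ 'n) set \<Rightarrow> (real ^ 'n \<Rightarrow> real) set" where
  "H10 \<Omega> = {w. \<exists>G. has_weak_gradient \<Omega> w G \<and>
    (\<forall>\<epsilon>>0. \<exists>\<psi> \<in> test_fun \<Omega>.
      (L2_norm \<Omega> (\<lambda>x. w x - \<psi> x))\<^sup>2 +
      (\<Sum>i\<in>UNIV. (L2_norm \<Omega> (\<lambda>x. G x $ i - partial_deriv i \<psi> x))\<^sup>2) < \<epsilon>)}"

section \<open>Eigenpairs, spectral spaces and the fractional operator\<close>

text \<open>Weak form of \<open>-div (A \<nabla>\<phi>) = \<mu> \<phi>\<close> in \<open>\<Omega>\<close>, \<open>\<phi> = 0\<close> on the boundary.\<close>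

definition dirichlet_eigen :: "(real ^ 'n) set \<Rightarrow> (real ^ 'n \<Rightarrow> real ^ 'n ^ 'n) \<Rightarrow> real \<Rightarrow> (real ^ 'n \<Rightarrow> real) \<Rightarrow> bool" where
  "dirichlet_eigen \<Omega> A \<mu> \<phi> \<longleftrightarrow> \<phi> \<in> H10 \<Omega> \<and>
    (\<exists>G. has_weak_gradient \<Omega> \<phi> G \<and>
      (\<forall>v \<in> H10 \<Omega>. \<forall>V. has_weak_gradient \<Omega> v V \<longrightarrow>
        integral\<^sup>L (lebesgue_on \<Omega>) (\<lambda>x. (A x *v G x) \<bullet> V x) = \<mu> * L2_inner \<Omega> \<phi> v))"

definition L2_orthonormal_basis :: "(real ^ 'n) set \<Rightarrow> (nat \<Rightarrow> real ^ 'n \<Rightarrow> real) \<Rightarrow> bool" where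
  "L2_orthonormal_basis \<Omega> \<phi> \<longleftrightarrow>
    (\<forall>k. \<phi> k \<in> L2_fun \<Omega>) \<and>
    (\<forall>j k. L2_inner \<Omega> (\<phi> j) (\<phi> k) = (if j = k then 1 else 0)) \<and>
    (\<forall>w \<in> L2_fun \<Omega>.
      (\<lambda>N. L2_norm \<Omega> (\<lambda>x. w x - (\<Sum>k<N. L2_inner \<Omega> w (\<phi> k) * \<phi> k x))) \<longlonglongrightarrow> 0)"

text \<open>The eigenvalues \<open>\<mu> k\<close> are indexed from \<open>0\<close> and in no particular order; they are positive by ellipticity.\<close>

definition eigenbasis :: "(real ^ 'n) set \<Rightarrow> (real ^ 'n \<Rightarrow> real ^ 'n ^ 'n) \<Rightarrow> (nat \<Rightarrow> real) \<Rightarrow> (nat \<Rightarrow> real ^ 'n \<Rightarrow> real) \<Rightarrow> bool" where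
  "eigenbasis \<Omega> A \<mu> \<phi> \<longleftrightarrow> (\<forall>k. dirichlet_eigen \<Omega> A (\<mu> k) (\<phi> k)) \<and> L2_orthonormal_basis \<Omega> \<phi>"

text \<open>In the following, the coefficient \<open>w\<^sub>k\<close> of \<open>w = \<Sum>\<^sub>k w\<^sub>k \<phi>\<^sub>k\<close> is \<open>L2_inner \<Omega> w (\<phi> k)\<close>.\<close>

definition spectral_space :: "(real ^ 'n) set \<Rightarrow> (nat \<Rightarrow> real) \<Rightarrow> (nat \<Rightarrow> real ^ 'n \<Rightarrow> real) \<Rightarrow> real \<Rightarrow> (real ^ 'n \<Rightarrow> real) set" where
  "spectral_space \<Omega> \<mu> \<phi> r =
    {w \<in> L2_fun \<Omega>. summable (\<lambda>k. \<mu> k powr r * (L2_inner \<Omega> w (\<phi> k))\<^sup>2)}"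

definition spectral_norm :: "(real ^ 'n) set \<Rightarrow> (nat \<Rightarrow> real) \<Rightarrow> (nat \<Rightarrow> real ^ 'n \<Rightarrow> real) \<Rightarrow> real \<Rightarrow> (real ^ 'n \<Rightarrow> real) \<Rightarrow> real" where
  "spectral_norm \<Omega> \<mu> \<phi> r w = sqrt (\<Sum>k. \<mu> k powr r * (L2_inner \<Omega> w (\<phi> k))\<^sup>2)"

text \<open>The space of negative order \<open>-s\<close>: bounded linear functionals on the space of order \<open>s\<close>.\<close>

definition spectral_dual :: "(real ^ 'n) set \<Rightarrow> (nat \<Rightarrow> real) \<Rightarrow> (nat \<Rightarrow> real ^ 'n \<Rightarrow> real) \<Rightarrow> real \<Rightarrow> ((real ^ 'n \<Rightarrow> real) \<Rightarrow> real) set" where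
  "spectral_dual \<Omega> \<mu> \<phi> s = {F.
    (\<forall>v \<in> spectral_space \<Omega> \<mu> \<phi> s. \<forall>w \<in> spectral_space \<Omega> \<mu> \<phi> s. F (\<lambda>x. v x + w x) = F v + F w) \<and>
    (\<forall>c. \<forall>v \<in> spectral_space \<Omega> \<mu> \<phi> s. F (\<lambda>x. c * v x) = c * F v) \<and>
    (\<exists>C. \<forall>v \<in> spectral_space \<Omega> \<mu> \<phi> s. \<bar>F v\<bar> \<le> C * spectral_norm \<Omega> \<mu> \<phi> s v)}"

text \<open>\<open>\<L>\<^sup>s u = \<Sum>\<^sub>k \<mu>\<^sub>k\<^sup>s u\<^sub>k \<phi>\<^sub>k\<close> as an element of the dual space, a function \<open>\<phi>\<^sub>k\<close> acting on \<open>v\<close> by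
  the \<open>L\<^sup>2\<close> inner product. The series need not converge in \<open>L\<^sup>2\<close> for \<open>u\<close> of order \<open>s\<close> only.\<close>

definition frac_op :: "(real ^ 'n) set \<Rightarrow> (nat \<Rightarrow> real) \<Rightarrow> (nat \<Rightarrow> real ^ 'n \<Rightarrow> real) \<Rightarrow> real \<Rightarrow> (real ^ 'n \<Rightarrow> real) \<Rightarrow> (real ^ 'n \<Rightarrow> real) \<Rightarrow> real" where
  "frac_op \<Omega> \<mu> \<phi> s u v = (\<Sum>k. \<mu> k powr s * L2_inner \<Omega> u (\<phi> k) * L2_inner \<Omega> v (\<phi> k))"

text \<open>The graph of the solution operator \<open>\<^bold>S\<close>: \<open>u = \<^bold>S F\<close> up to null sets. The boundary condition is
  part of the membership of \<open>u\<close> in the spectral space.\<close>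

definition frac_solution :: "(real ^ 'n) set \<Rightarrow> (nat \<Rightarrow> real) \<Rightarrow> (nat \<Rightarrow> real ^ 'n \<Rightarrow> real) \<Rightarrow> real \<Rightarrow> ((real ^ 'n \<Rightarrow> real) \<Rightarrow> real) \<Rightarrow> (real ^ 'n \<Rightarrow> real) \<Rightarrow> bool" where
  "frac_solution \<Omega> \<mu> \<phi> s F u \<longleftrightarrow>
    F \<in> spectral_dual \<Omega> \<mu> \<phi> s \<and> u \<in> spectral_space \<Omega> \<mu> \<phi> s \<and>
    (\<forall>v \<in> spectral_space \<Omega> \<mu> \<phi> s. frac_op \<Omega> \<mu> \<phi> s u v = F v)"

section \<open>The optimal control problem\<close>

definition cost :: "(real ^ 'n) set \<Rightarrow> real \<Rightarrow> (real ^ 'n \<Rightarrow> real) \<Rightarrow> (real ^ 'n \<Rightarrow> real) \<Rightarrow> (real ^ 'n \<Rightarrow> real) \<Rightarrow> real" where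
  "cost \<Omega> \<theta> ud u z = 1 / 2 * (L2_norm \<Omega> (\<lambda>x. u x - ud x))\<^sup>2 + \<theta> / 2 * (L2_norm \<Omega> z)\<^sup>2"

definition admissible :: "(real ^ 'n) set \<Rightarrow> real \<Rightarrow> real \<Rightarrow> (real ^ 'n \<Rightarrow> real) set" where
  "admissible \<Omega> a b = {w \<in> L2_fun \<Omega>. AE x in lebesgue_on \<Omega>. a \<le> w x \<and> w x \<le> b}"

text \<open>An \<open>L\<^sup>2\<close> function \<open>z\<close> is identified with the functional \<open>L2_inner \<Omega> z\<close>.\<close>

definition optimal_pair :: "(real ^ 'n) set \<Rightarrow> (nat \<Rightarrow> real) \<Rightarrow> (nat \<Rightarrow> real ^ 'n \<Rightarrow> real) \<Rightarrow> real \<Rightarrow> real \<Rightarrow>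
    (real ^ 'n \<Rightarrow> real) \<Rightarrow> real \<Rightarrow> real \<Rightarrow> (real ^ 'n \<Rightarrow> real) \<Rightarrow> (real ^ 'n \<Rightarrow> real) \<Rightarrow> bool" where
  "optimal_pair \<Omega> \<mu> \<phi> s \<theta> ud a b u z \<longleftrightarrow>
    z \<in> admissible \<Omega> a b \<and> frac_solution \<Omega> \<mu> \<phi> s (L2_inner \<Omega> z) u \<and>
    (\<forall>z' \<in> admissible \<Omega> a b. \<forall>u'. frac_solution \<Omega> \<mu> \<phi> s (L2_inner \<Omega> z') u' \<longrightarrow>
      cost \<Omega> \<theta> ud u z \<le> cost \<Omega> \<theta> ud u' z')"

definition adjoint_state :: "(real ^ 'n) set \<Rightarrow> (nat \<Rightarrow> real) \<Rightarrow> (nat \<Rightarrow> real ^ 'n \<Rightarrow> real) \<Rightarrow> real \<Rightarrow>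
    (real ^ 'n \<Rightarrow> real) \<Rightarrow> (real ^ 'n \<Rightarrow> real) \<Rightarrow> (real ^ 'n \<Rightarrow> real) \<Rightarrow> bool" where
  "adjoint_state \<Omega> \<mu> \<phi> s ud u p \<longleftrightarrow> frac_solution \<Omega> \<mu> \<phi> s (L2_inner \<Omega> (\<lambda>x. u x - ud x)) p"

end

theory Submission
  imports Defs
begin

text \<open>The optimal control satisfies the projection formula: \<open>z\<close> is the truncation of \<open>- p / \<theta>\<close> to
  \<open>[a, b]\<close>. If \<open>z\<close> has order \<open>r\<close> in the spectral scale, then \<open>p\<close> has order \<open>min (r + 4 s) (1 + s)\<close>, and the
  truncation, which fixes \<open>0\<close>, preserves each spectral space of order in \<open>(0, 1]\<close>; so finitely many
  iterations bring \<open>z\<close> to order \<open>1\<close>, hence \<open>u\<close> to order \<open>1 + 2 s\<close>, and with \<open>u\<^sub>d\<close> in \<open>H\<^sup>1\<^sub>0\<close> also \<open>p\<close>.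

  Stability under truncation is a nonlinear interpolation argument: truncation is a contraction of \<open>L\<^sup>2\<close>
  and its smooth versions do not increase the gradients of test functions, so the weights \<open>min (\<mu> k) \<Lambda>\<close> satisfy a
  stability estimate with a constant independent of \<open>\<Lambda>\<close>, and integration against \<open>\<Lambda> powr (r - 2)\<close> turns them
  into \<open>\<mu> k powr r\<close>.\<close>

section \<open>The space \<open>L\<^sup>2\<close>\<close>

text \<open>Truncation T has corners and is nonlinear, so neither a smooth chain rule nor linear
  interpolation applies to it directly. The work is done on finite sums of eigenfunctions: such a
  sum is an L2 limit of test functions with controlled gradients, the smooth truncation of a test
  function is again a test function, and its coefficients obey Bessel's inequality in the energy
  form. Each estimate concerns finitely many coefficients, with a constant independent of their
  number, so L2 convergence alone carries it to the limit; no weak gradient of a function truncated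
  by T itself is ever constructed. In the interpolation w is split linearly at the frequency
  \<Lambda> into v and w - v, but T enters as T w = T v + (T w - T v), where the Lipschitz bound
  replaces linearity. Up to equivalence, the sum with weights \<open>min (\<mu> k) \<Lambda>\<close>
  is \<Lambda> times the squared K-functional of the pair L2, H1. The projection formula comes from
  comparing costs along z + t h. Only controls with a state can be compared, so the state equation
  must be solved for h; this is the purpose of the Riesz-Fischer theorem. The formula is kept at the
  level of coefficients, which is all that spectral spaces see.\<close>

lemma L2_fun_measurable [measurable_dest]: "f \<in> L2_fun \<Omega> \<Longrightarrow> f \<in> borel_measurable (lebesgue_on \<Omega>)"
  by (simp add: L2_fun_def)

lemma L2_fun_sq_integrable: "f \<in> L2_fun \<Omega> \<Longrightarrow> integrable (lebesgue_on \<Omega>) (\<lambda>x. (f x)\<^sup>2)"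
  by (simp add: L2_fun_def)

lemma L2_fun_bound:
  assumes "f \<in> borel_measurable (lebesgue_on \<Omega>)" and "integrable (lebesgue_on \<Omega>) g"
    and "\<And>x. (f x)\<^sup>2 \<le> g x"
  shows "f \<in> L2_fun \<Omega>"
proof -
  have "integrable (lebesgue_on \<Omega>) (\<lambda>x. (f x)\<^sup>2)"
    using assms by (intro Bochner_Integration.integrable_bound[OF assms(2)] AE_I2)
      (auto intro: order_trans[OF _ abs_ge_self])
  then show ?thesis using assms(1) by (simp add: L2_fun_def)
qed

lemma L2_fun_prod_integrable:
  assumes "f \<in> L2_fun \<Omega>" "g \<in> L2_fun \<Omega>"
  shows "integrable (lebesgue_on \<Omega>) (\<lambda>x. f x * g x)"
proof (rule Bochner_Integration.integrable_bound)
  show "integrable (lebesgue_on \<Omega>) (\<lambda>x. (f x)\<^sup>2 + (g x)\<^sup>2)"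
    using assms by (auto simp: L2_fun_def)
  show "(\<lambda>x. f x * g x) \<in> borel_measurable (lebesgue_on \<Omega>)"
    using assms by (auto simp: L2_fun_def)
  show "AE x in lebesgue_on \<Omega>. norm (f x * g x) \<le> norm ((f x)\<^sup>2 + (g x)\<^sup>2)"
  proof (rule AE_I2)
    fix x
    have "2 * \<bar>f x\<bar> * \<bar>g x\<bar> \<le> (f x)\<^sup>2 + (g x)\<^sup>2"
      using sum_squares_bound[of "\<bar>f x\<bar>" "\<bar>g x\<bar>"] by simp
    moreover have "0 \<le> \<bar>f x\<bar> * \<bar>g x\<bar>" by simp
    ultimately show "norm (f x * g x) \<le> norm ((f x)\<^sup>2 + (g x)\<^sup>2)"
      unfolding real_norm_def abs_mult by linarith
  qed
qed

lemma L2_fun_add [intro]: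
  assumes "f \<in> L2_fun \<Omega>" "g \<in> L2_fun \<Omega>"
  shows "(\<lambda>x. f x + g x) \<in> L2_fun \<Omega>"
proof -
  have "integrable (lebesgue_on \<Omega>) (\<lambda>x. (f x)\<^sup>2 + (g x)\<^sup>2 + 2 * (f x * g x))"
    using assms L2_fun_prod_integrable[OF assms] by (auto simp: L2_fun_def)
  then have "integrable (lebesgue_on \<Omega>) (\<lambda>x. (f x + g x)\<^sup>2)"
    by (simp add: power2_sum algebra_simps)
  then show ?thesis
    using assms by (auto simp: L2_fun_def)
qed

lemma L2_fun_scale [intro]: "f \<in> L2_fun \<Omega> \<Longrightarrow> (\<lambda>x. c * f x) \<in> L2_fun \<Omega>"
  by (auto simp: L2_fun_def power_mult_distrib)

lemma L2_fun_zero [simp, intro]: "(\<lambda>x. 0) \<in> L2_fun \<Omega>"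
  by (auto simp: L2_fun_def)

lemma L2_fun_diff [intro]:
  assumes "f \<in> L2_fun \<Omega>" "g \<in> L2_fun \<Omega>"
  shows "(\<lambda>x. f x - g x) \<in> L2_fun \<Omega>"
  using L2_fun_add[OF assms(1) L2_fun_scale[OF assms(2), of "-1"]] by simp

lemma L2_fun_sum [intro]: "(\<And>k. k \<in> I \<Longrightarrow> f k \<in> L2_fun \<Omega>) \<Longrightarrow> (\<lambda>x. \<Sum>k\<in>I. f k x) \<in> L2_fun \<Omega>"
  by (induction I rule: infinite_finite_induct) auto

lemma L2_fun_lincomb [intro]:
  "(\<And>k. k \<in> I \<Longrightarrow> f k \<in> L2_fun \<Omega>) \<Longrightarrow> (\<lambda>x. \<Sum>k\<in>I. c k * f k x) \<in> L2_fun \<Omega>"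
  by (intro L2_fun_sum L2_fun_scale)

lemma L2_inner_commute: "L2_inner \<Omega> f g = L2_inner \<Omega> g f"
  by (simp add: L2_inner_def mult.commute)

lemma L2_inner_add_left:
  "f \<in> L2_fun \<Omega> \<Longrightarrow> g \<in> L2_fun \<Omega> \<Longrightarrow> h \<in> L2_fun \<Omega> \<Longrightarrow>
    L2_inner \<Omega> (\<lambda>x. f x + g x) h = L2_inner \<Omega> f h + L2_inner \<Omega> g h"
  by (simp add: L2_inner_def algebra_simps L2_fun_prod_integrable)

lemma L2_inner_scale_left [simp]: "L2_inner \<Omega> (\<lambda>x. c * f x) h = c * L2_inner \<Omega> f h"
  by (simp add: L2_inner_def mult.assoc)

lemma L2_inner_diff_left:
  "f \<in> L2_fun \<Omega> \<Longrightarrow> g \<in> L2_fun \<Omega> \<Longrightarrow> h \<in> L2_fun \<Omega> \<Longrightarrow>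
    L2_inner \<Omega> (\<lambda>x. f x - g x) h = L2_inner \<Omega> f h - L2_inner \<Omega> g h"
  by (simp add: L2_inner_def algebra_simps L2_fun_prod_integrable)

lemma L2_inner_zero_left [simp]: "L2_inner \<Omega> (\<lambda>x. 0) h = 0"
  by (simp add: L2_inner_def)

lemma L2_inner_lincomb_left:
  assumes "\<And>k. k \<in> I \<Longrightarrow> f k \<in> L2_fun \<Omega>" "h \<in> L2_fun \<Omega>"
  shows "L2_inner \<Omega> (\<lambda>x. \<Sum>k\<in>I. c k * f k x) h = (\<Sum>k\<in>I. c k * L2_inner \<Omega> (f k) h)"
  using assms(1)
  by (induction I rule: infinite_finite_induct)
    (simp_all add: L2_inner_add_left assms(2) L2_fun_lincomb L2_fun_scale)

lemma L2_inner_add_right: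
  "f \<in> L2_fun \<Omega> \<Longrightarrow> g \<in> L2_fun \<Omega> \<Longrightarrow> h \<in> L2_fun \<Omega> \<Longrightarrow>
    L2_inner \<Omega> h (\<lambda>x. f x + g x) = L2_inner \<Omega> h f + L2_inner \<Omega> h g"
  using L2_inner_add_left[of f \<Omega> g h] by (simp add: L2_inner_commute[of \<Omega> h])

lemma L2_inner_diff_right:
  "f \<in> L2_fun \<Omega> \<Longrightarrow> g \<in> L2_fun \<Omega> \<Longrightarrow> h \<in> L2_fun \<Omega> \<Longrightarrow>
    L2_inner \<Omega> h (\<lambda>x. f x - g x) = L2_inner \<Omega> h f - L2_inner \<Omega> h g"
  using L2_inner_diff_left[of f \<Omega> g h] by (simp add: L2_inner_commute[of \<Omega> h])

lemma L2_inner_scale_right [simp]: "L2_inner \<Omega> h (\<lambda>x. c * f x) = c * L2_inner \<Omega> h f"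
  by (simp add: L2_inner_commute[of \<Omega> h])

lemma L2_inner_lincomb_right:
  assumes "\<And>k. k \<in> I \<Longrightarrow> f k \<in> L2_fun \<Omega>" "h \<in> L2_fun \<Omega>"
  shows "L2_inner \<Omega> h (\<lambda>x. \<Sum>k\<in>I. c k * f k x) = (\<Sum>k\<in>I. c k * L2_inner \<Omega> h (f k))"
  using L2_inner_lincomb_left[OF assms] by (simp add: L2_inner_commute)

section \<open>Norm, Cauchy-Schwarz inequality and convergence in L2\<close>

lemma L2_inner_self_nonneg: "0 \<le> L2_inner \<Omega> f f"
  by (simp add: L2_inner_def)

lemma L2_norm_nonneg: "0 \<le> L2_norm \<Omega> f"
  by (simp add: L2_norm_def L2_inner_self_nonneg)

lemma L2_norm_sq: "(L2_norm \<Omega> f)\<^sup>2 = L2_inner \<Omega> f f"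
  by (simp add: L2_norm_def L2_inner_self_nonneg)

lemma L2_norm_mono:
  assumes "g \<in> L2_fun \<Omega>" "f \<in> borel_measurable (lebesgue_on \<Omega>)" "\<And>x. x \<in> \<Omega> \<Longrightarrow> \<bar>f x\<bar> \<le> \<bar>g x\<bar>"
  shows "L2_norm \<Omega> f \<le> L2_norm \<Omega> g"
  unfolding L2_norm_def L2_inner_def
proof (intro real_sqrt_le_mono Bochner_Integration.integral_mono')
  show "integrable (lebesgue_on \<Omega>) (\<lambda>x. g x * g x)"
    by (rule L2_fun_prod_integrable[OF assms(1) assms(1)])
  show "f x * f x \<le> g x * g x" if "x \<in> space (lebesgue_on \<Omega>)" for x
    using assms(3)[of x] that abs_le_square_iff[of "f x" "g x"] by (simp add: power2_eq_square)
qed auto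

text \<open>The quadratic polynomial t -> ||f - t g||^2 is nonnegative. Functions are not identified
  almost everywhere, so the form is only semidefinite and a vanishing leading coefficient is a
  separate case.\<close>

lemma L2_Cauchy_Schwarz:
  assumes "f \<in> L2_fun \<Omega>" "g \<in> L2_fun \<Omega>"
  shows "\<bar>L2_inner \<Omega> f g\<bar> \<le> L2_norm \<Omega> f * L2_norm \<Omega> g"
proof -
  define a b c where "a = L2_inner \<Omega> g g" and "b = L2_inner \<Omega> f g" and "c = L2_inner \<Omega> f f"
  have quad: "0 \<le> c - 2 * t * b + t\<^sup>2 * a" for t
  proof -
    have "0 \<le> L2_inner \<Omega> (\<lambda>x. f x - t * g x) (\<lambda>x. f x - t * g x)"
      by (rule L2_inner_self_nonneg)
    also have "\<dots> = c - 2 * t * b + t\<^sup>2 * a"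
      using assms L2_fun_scale[OF assms(2)] L2_fun_diff[OF assms(1) L2_fun_scale[OF assms(2)]]
      by (simp add: a_def b_def c_def L2_inner_diff_left L2_inner_diff_right power2_eq_square
          L2_inner_commute[of \<Omega> g f] algebra_simps)
    finally show ?thesis .
  qed
  have "b\<^sup>2 \<le> c * a"
  proof (cases "a = 0")
    case True
    have "b = 0"
    proof (rule ccontr)
      assume "b \<noteq> 0"
      \<comment> \<open>With \<open>a = 0\<close> the polynomial is affine in t, and this t would
        give it the value -1.\<close>
      then have "c - 2 * ((c + 1) / (2 * b)) * b = -1" by (simp add: field_simps)
      with quad[of "(c + 1) / (2 * b)"] True show False by simp
    qed
    then show ?thesis by (simp add: True)
  next
    case False
    then have "a > 0" using L2_inner_self_nonneg[of \<Omega> g] by (simp add: a_def)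
    have "c - 2 * (b / a) * b + (b / a)\<^sup>2 * a = c - b\<^sup>2 / a"
      using False by (simp add: field_simps power2_eq_square)
    with quad[of "b / a"] have "b\<^sup>2 / a \<le> c" by simp
    with \<open>a > 0\<close> show ?thesis by (simp add: pos_divide_le_eq)
  qed
  then have "sqrt (b\<^sup>2) \<le> sqrt (c * a)" by (rule real_sqrt_le_mono)
  then show ?thesis by (simp add: a_def b_def c_def L2_norm_def real_sqrt_mult)
qed

lemma L2_norm_scale: "L2_norm \<Omega> (\<lambda>x. c * f x) = \<bar>c\<bar> * L2_norm \<Omega> f"
proof -
  have "L2_norm \<Omega> (\<lambda>x. c * f x) = sqrt (c\<^sup>2 * L2_inner \<Omega> f f)"
    by (simp add: L2_norm_def power2_eq_square mult.assoc)
  then show ?thesis by (simp add: L2_norm_def real_sqrt_mult)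
qed

lemma L2_norm_triangle:
  assumes "f \<in> L2_fun \<Omega>" "g \<in> L2_fun \<Omega>"
  shows "L2_norm \<Omega> (\<lambda>x. f x + g x) \<le> L2_norm \<Omega> f + L2_norm \<Omega> g"
proof (rule power2_le_imp_le)
  have "(L2_norm \<Omega> (\<lambda>x. f x + g x))\<^sup>2 = (L2_norm \<Omega> f)\<^sup>2 + 2 * L2_inner \<Omega> f g + (L2_norm \<Omega> g)\<^sup>2"
    using assms L2_fun_add[OF assms]
    by (simp add: L2_norm_sq L2_inner_add_left L2_inner_add_right L2_inner_commute[of \<Omega> g f])
  also have "\<dots> \<le> (L2_norm \<Omega> f + L2_norm \<Omega> g)\<^sup>2"
    using L2_Cauchy_Schwarz[OF assms] by (simp add: power2_sum)
  finally show "(L2_norm \<Omega> (\<lambda>x. f x + g x))\<^sup>2 \<le> (L2_norm \<Omega> f + L2_norm \<Omega> g)\<^sup>2" .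
qed (simp add: L2_norm_nonneg)

lemma L2_norm_minus_commute: "L2_norm \<Omega> (\<lambda>x. f x - g x) = L2_norm \<Omega> (\<lambda>x. g x - f x)"
proof -
  have "(\<lambda>x. (f x - g x) * (f x - g x)) = (\<lambda>x. (g x - f x) * (g x - f x))"
    by (auto simp: algebra_simps)
  then show ?thesis by (simp add: L2_norm_def L2_inner_def)
qed

lemma L2_norm_triangle_sub:
  assumes "f \<in> L2_fun \<Omega>" "g \<in> L2_fun \<Omega>" "h \<in> L2_fun \<Omega>"
  shows "L2_norm \<Omega> (\<lambda>x. f x - h x) \<le> L2_norm \<Omega> (\<lambda>x. f x - g x) + L2_norm \<Omega> (\<lambda>x. g x - h x)"
  using L2_norm_triangle[OF L2_fun_diff[OF assms(1,2)] L2_fun_diff[OF assms(2,3)]] by simp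

lemma L2_norm_zero [simp]: "L2_norm \<Omega> (\<lambda>x. 0) = 0"
  by (simp add: L2_norm_def)

lemma L2_inner_tendsto:
  assumes "\<And>n. f n \<in> L2_fun \<Omega>" "g \<in> L2_fun \<Omega>" "h \<in> L2_fun \<Omega>"
    and "(\<lambda>n. L2_norm \<Omega> (\<lambda>x. g x - f n x)) \<longlonglongrightarrow> 0"
  shows "(\<lambda>n. L2_inner \<Omega> (f n) h) \<longlonglongrightarrow> L2_inner \<Omega> g h"
proof (rule LIM_zero_cancel, rule Lim_null_comparison)
  show "(\<lambda>n. L2_norm \<Omega> (\<lambda>x. g x - f n x) * L2_norm \<Omega> h) \<longlonglongrightarrow> 0"
    using tendsto_mult[OF assms(4) tendsto_const] by simp
  show "\<forall>\<^sub>F n in sequentially. norm (L2_inner \<Omega> (f n) h - L2_inner \<Omega> g h)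
      \<le> L2_norm \<Omega> (\<lambda>x. g x - f n x) * L2_norm \<Omega> h"
    using L2_Cauchy_Schwarz[OF L2_fun_diff[OF assms(2) assms(1)] assms(3)]
    by (simp add: L2_inner_diff_left assms abs_minus_commute)
qed

lemma L2_norm_tendsto:
  assumes "\<And>n. f n \<in> L2_fun \<Omega>" "g \<in> L2_fun \<Omega>"
    and "(\<lambda>n. L2_norm \<Omega> (\<lambda>x. g x - f n x)) \<longlonglongrightarrow> 0"
  shows "(\<lambda>n. L2_norm \<Omega> (f n)) \<longlonglongrightarrow> L2_norm \<Omega> g"
proof (rule LIM_zero_cancel, rule Lim_null_comparison[OF _ assms(3)])
  have "norm (L2_norm \<Omega> (f n) - L2_norm \<Omega> g) \<le> L2_norm \<Omega> (\<lambda>x. g x - f n x)" for n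
    using L2_norm_triangle[OF L2_fun_diff[OF assms(2) assms(1)[of n]] assms(1)[of n]]
      L2_norm_triangle[OF L2_fun_diff[OF assms(1)[of n] assms(2)] assms(2)]
      L2_norm_minus_commute[of \<Omega> g "f n"] by simp
  then show "\<forall>\<^sub>F n in sequentially. norm (L2_norm \<Omega> (f n) - L2_norm \<Omega> g) \<le> L2_norm \<Omega> (\<lambda>x. g x - f n x)"
    by simp
qed

lemma L2_tendsto_lincomb:
  assumes "finite I" "\<And>k n. k \<in> I \<Longrightarrow> f k n \<in> L2_fun \<Omega>" "\<And>k. k \<in> I \<Longrightarrow> g k \<in> L2_fun \<Omega>"
    and "\<And>k. k \<in> I \<Longrightarrow> (\<lambda>n. L2_norm \<Omega> (\<lambda>x. g k x - f k n x)) \<longlonglongrightarrow> 0"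
  shows "(\<lambda>n. L2_norm \<Omega> (\<lambda>x. (\<Sum>k\<in>I. c k * g k x) - (\<Sum>k\<in>I. c k * f k n x))) \<longlonglongrightarrow> 0"
  using assms
proof (induction I rule: finite_induct)
  case (insert j I)
  have L: "(\<lambda>x. c j * (g j x - f j n x)) \<in> L2_fun \<Omega>"
      "(\<lambda>x. (\<Sum>k\<in>I. c k * g k x) - (\<Sum>k\<in>I. c k * f k n x)) \<in> L2_fun \<Omega>" for n
    using insert.prems by (auto intro!: L2_fun_scale L2_fun_diff L2_fun_lincomb)
  let ?h = "\<lambda>n. L2_norm \<Omega> (\<lambda>x. (\<Sum>k\<in>I. c k * g k x) - (\<Sum>k\<in>I. c k * f k n x))"
  have le: "L2_norm \<Omega> (\<lambda>x. (\<Sum>k\<in>insert j I. c k * g k x) - (\<Sum>k\<in>insert j I. c k * f k n x))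
      \<le> \<bar>c j\<bar> * L2_norm \<Omega> (\<lambda>x. g j x - f j n x) + ?h n" for n
    using L2_norm_triangle[OF L[of n]] insert.hyps L2_norm_scale[of \<Omega> "c j" "\<lambda>x. g j x - f j n x"]
    by (simp add: algebra_simps)
  have h: "?h \<longlonglongrightarrow> 0"
    by (rule insert.IH) (use insert.prems in auto)
  have "(\<lambda>n. L2_norm \<Omega> (\<lambda>x. g j x - f j n x)) \<longlonglongrightarrow> 0"
    using insert.prems by auto
  from tendsto_add[OF tendsto_mult_left[OF this] h]
  have lim: "(\<lambda>n. \<bar>c j\<bar> * L2_norm \<Omega> (\<lambda>x. g j x - f j n x) + ?h n) \<longlonglongrightarrow> 0"
    by (simp only: mult_zero_right add_0_right)
  show ?case
    by (rule Lim_null_comparison[OF _ lim]) (simp add: L2_norm_nonneg le del: sum.insert)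
next
  case empty
  show ?case by simp
qed

section \<open>Test functions\<close>

lemma partial_deriv_eq: "(f has_derivative D) (at x) \<Longrightarrow> partial_deriv i f x = D (axis i 1)"
  by (simp add: partial_deriv_def frechet_derivative_at[symmetric])

lemma partial_deriv_add:
  assumes "f differentiable (at x)" "g differentiable (at x)"
  shows "partial_deriv i (\<lambda>x. f x + g x) x = partial_deriv i f x + partial_deriv i g x"
  by (subst partial_deriv_eq[OF has_derivative_add[OF assms[unfolded frechet_derivative_works]]])
    (simp add: partial_deriv_def)

lemma partial_deriv_mult:
  assumes "f differentiable (at x)" "g differentiable (at x)"
  shows "partial_deriv i (\<lambda>x. f x * g x) x = f x * partial_deriv i g x + partial_deriv i f x * g x"
  by (subst partial_deriv_eq[OF has_derivative_mult[OF assms[unfolded frechet_derivative_works]]])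
    (simp add: partial_deriv_def)

lemma partial_deriv_const [simp]: "partial_deriv i (\<lambda>x. c) = (\<lambda>x. 0)"
  by (rule ext) (subst partial_deriv_eq[OF has_derivative_const], simp)

lemma partial_deriv_compose:
  assumes "f differentiable (at x)" "(F has_real_derivative d) (at (f x))"
  shows "partial_deriv i (\<lambda>x. F (f x)) x = d * partial_deriv i f x"
    and "(\<lambda>x. F (f x)) differentiable (at x)"
proof -
  have D: "((\<lambda>x. F (f x)) has_derivative (\<lambda>h. d * frechet_derivative f (at x) h)) (at x)"
    using has_derivative_compose[OF assms(1)[unfolded frechet_derivative_works]
        assms(2)[unfolded has_field_derivative_def]] .
  show "partial_deriv i (\<lambda>x. F (f x)) x = d * partial_deriv i f x"
    by (subst partial_deriv_eq[OF D]) (simp add: partial_deriv_def)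
  show "(\<lambda>x. F (f x)) differentiable (at x)"
    using D by (rule differentiableI)
qed

section \<open>Closure properties of smooth functions\<close>

lemma Ck_fun_SucD: "Ck_fun (Suc k) f \<Longrightarrow> Ck_fun k f"
proof (induction k arbitrary: f)
  case 0
  then show ?case
    by (auto simp: continuous_on_eq_continuous_at intro: differentiable_imp_continuous_within)
qed auto

lemma Ck_fun_const [simp]: "Ck_fun k (\<lambda>x. c)"
  by (induction k arbitrary: c) auto

lemma Ck_fun_add:
  "Ck_fun k f \<Longrightarrow> Ck_fun k g \<Longrightarrow> Ck_fun k (\<lambda>x. f x + g x)"
proof (induction k arbitrary: f g)
  case 0
  then show ?case by (auto intro: continuous_intros)
next
  case (Suc k)
  have "partial_deriv i (\<lambda>x. f x + g x) = (\<lambda>x. partial_deriv i f x + partial_deriv i g x)" for i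
    using Suc.prems by (auto simp: partial_deriv_add)
  with Suc show ?case by auto
qed

lemma Ck_fun_mult:
  "Ck_fun k f \<Longrightarrow> Ck_fun k g \<Longrightarrow> Ck_fun k (\<lambda>x. f x * g x)"
proof (induction k arbitrary: f g)
  case 0
  then show ?case by (auto intro: continuous_intros)
next
  case (Suc k)
  have "partial_deriv i (\<lambda>x. f x * g x) = (\<lambda>x. f x * partial_deriv i g x + partial_deriv i f x * g x)" for i
    using Suc.prems by (auto simp: partial_deriv_mult)
  moreover have "Ck_fun k f" "Ck_fun k g"
    using Suc.prems Ck_fun_SucD by blast+
  ultimately show ?case
    using Suc by (auto intro!: Ck_fun_add derivative_intros)
qed

text \<open>Supplies the smoothness of the square roots in the smoothed truncation. Differentiation
  lowers the exponent by one, so the induction runs over all exponents at once; positivity of q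
  avoids the singularity at 0.\<close>

lemma Ck_fun_powr:
  assumes "\<And>x. q x > 0"
  shows "Ck_fun k q \<Longrightarrow> Ck_fun k (\<lambda>x. q x powr \<alpha>)"
proof (induction k arbitrary: \<alpha>)
  case 0
  then show ?case
    using assms by (auto intro!: continuous_intros simp: less_imp_neq[THEN not_sym])
next
  case (Suc k)
  note D = has_real_derivative_powr[OF assms]
  have "partial_deriv i (\<lambda>x. q x powr \<alpha>) = (\<lambda>x. (\<alpha> * q x powr (\<alpha> - 1)) * partial_deriv i q x)" for i
    using Suc.prems D by (intro ext) (simp add: partial_deriv_compose(1)[where F = "\<lambda>z. z powr \<alpha>"])
  moreover have "(\<lambda>x. q x powr \<alpha>) differentiable (at x)" for x
    using Suc.prems D by (intro partial_deriv_compose(2)[where F = "\<lambda>z. z powr \<alpha>"]) auto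
  moreover have "Ck_fun k (\<lambda>x. (\<alpha> * q x powr (\<alpha> - 1)) * partial_deriv i q x)" for i
    using Suc.prems Suc.IH[of "\<alpha> - 1"] Ck_fun_SucD[OF Suc.prems] by (intro Ck_fun_mult) auto
  ultimately show ?case by simp
qed

lemma Ck_fun_coord: "Ck_fun k (\<lambda>x :: real ^ 'n. x $ i)"
proof (cases k)
  case (Suc m)
  have D: "((\<lambda>x. x $ i) has_derivative (\<lambda>h. h $ i)) (at x)" for x :: "real ^ 'n"
    by (intro bounded_linear_imp_has_derivative bounded_linear_vec_nth)
  have "partial_deriv j (\<lambda>x. x $ i) = (\<lambda>x. axis j 1 $ i)" for j :: 'n
    using partial_deriv_eq[OF D] by (intro ext) simp
  with D Suc show ?thesis by (auto intro: differentiableI)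
qed (simp add: continuous_intros)

lemma partial_deriv_outside_support:
  assumes "x \<notin> closure {x. \<psi> x \<noteq> 0}"
  shows "partial_deriv i \<psi> x = 0"
proof -
  have "(\<psi> has_derivative (\<lambda>h. 0)) (at x)"
  proof (rule has_derivative_transform_within_open[where f = "\<lambda>x. 0" and s = "- closure {x. \<psi> x \<noteq> 0}"])
    show "0 = \<psi> y" if "y \<in> - closure {x. \<psi> x \<noteq> 0}" for y
      using that closure_subset[of "{x. \<psi> x \<noteq> 0}"] by auto
  qed (use assms in auto)
  then show ?thesis by (simp add: partial_deriv_eq)
qed

lemma test_fun_zero_outside: "\<psi> \<in> test_fun \<Omega> \<Longrightarrow> x \<notin> \<Omega> \<Longrightarrow> \<psi> x = 0"
  unfolding test_fun_def using closure_subset[of "{x. \<psi> x \<noteq> 0}"] by auto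

text \<open>Reduces the support condition to pointwise vanishing, the form in which it is available
  for derivatives, products and compositions with a function that fixes 0.\<close>

lemma test_fun_support_subset:
  assumes "\<psi> \<in> test_fun \<Omega>" "\<And>k. Ck_fun k f" "\<And>x. x \<notin> closure {x. \<psi> x \<noteq> 0} \<Longrightarrow> f x = 0"
  shows "f \<in> test_fun \<Omega>"
proof -
  have sub: "closure {x. f x \<noteq> 0} \<subseteq> closure {x. \<psi> x \<noteq> 0}"
    using assms(3) by (intro closure_minimal) auto
  moreover have "compact (closure {x. f x \<noteq> 0})"
    using assms(1) sub bounded_subset[OF bounded_closure, of "{x. \<psi> x \<noteq> 0}" "{x. f x \<noteq> 0}"]
      order_trans[OF closure_subset sub] by (simp add: test_fun_def)
  ultimately show ?thesis
    using assms(1,2) by (auto simp: test_fun_def)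
qed

lemma test_fun_partial: "\<psi> \<in> test_fun \<Omega> \<Longrightarrow> partial_deriv i \<psi> \<in> test_fun \<Omega>"
proof (rule test_fun_support_subset)
  assume "\<psi> \<in> test_fun \<Omega>"
  then have "Ck_fun (Suc k) \<psi>" for k by (auto simp: test_fun_def)
  then show "Ck_fun k (partial_deriv i \<psi>)" for k by simp
qed (auto intro: partial_deriv_outside_support)

lemma test_fun_add:
  assumes "f \<in> test_fun \<Omega>" "g \<in> test_fun \<Omega>"
  shows "(\<lambda>x. f x + g x) \<in> test_fun \<Omega>"
proof -
  have "closure {x. f x + g x \<noteq> 0} \<subseteq> closure ({x. f x \<noteq> 0} \<union> {x. g x \<noteq> 0})"
    by (intro closure_mono) auto
  then have sub: "closure {x. f x + g x \<noteq> 0} \<subseteq> closure {x. f x \<noteq> 0} \<union> closure {x. g x \<noteq> 0}"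
    by (simp add: closure_Un)
  have "compact (closure {x. f x \<noteq> 0} \<union> closure {x. g x \<noteq> 0})"
    using assms by (auto simp: test_fun_def)
  then have "bounded {x. f x + g x \<noteq> 0}"
    using bounded_subset[OF compact_imp_bounded order_trans[OF closure_subset sub]] by simp
  with sub assms show ?thesis
    by (auto simp: test_fun_def Ck_fun_add)
qed

lemma test_fun_mult:
  assumes "\<psi> \<in> test_fun \<Omega>" "\<And>k. Ck_fun k f"
  shows "(\<lambda>x. f x * \<psi> x) \<in> test_fun \<Omega>"
  using closure_subset[of "{x. \<psi> x \<noteq> 0}"] assms
  by (intro test_fun_support_subset[OF assms(1)] Ck_fun_mult) (auto simp: test_fun_def)

lemma test_fun_zero: "(\<lambda>x. 0) \<in> test_fun \<Omega>"
  by (simp add: test_fun_def)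

lemma test_fun_lincomb:
  "(\<And>k. k \<in> I \<Longrightarrow> f k \<in> test_fun \<Omega>) \<Longrightarrow> (\<lambda>x. \<Sum>k\<in>I. c k * f k x) \<in> test_fun \<Omega>"
  by (induction I rule: infinite_finite_induct)
    (simp_all add: test_fun_zero test_fun_add test_fun_mult)

lemma test_fun_differentiable: "\<psi> \<in> test_fun \<Omega> \<Longrightarrow> \<psi> differentiable (at x)"
  unfolding test_fun_def using Ck_fun.simps(2)[of 0 \<psi>] by blast

lemma test_fun_continuous: "\<psi> \<in> test_fun \<Omega> \<Longrightarrow> continuous_on UNIV \<psi>"
  unfolding test_fun_def using Ck_fun.simps(1)[of \<psi>] by blast

lemma partial_deriv_lincomb:
  assumes "\<And>k. k \<in> I \<Longrightarrow> f k \<in> test_fun \<Omega>"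
  shows "partial_deriv i (\<lambda>x. \<Sum>k\<in>I. c k * f k x) = (\<lambda>x. \<Sum>k\<in>I. c k * partial_deriv i (f k) x)"
proof
  fix x
  have "((\<lambda>x. \<Sum>k\<in>I. c k * f k x) has_derivative (\<lambda>h. \<Sum>k\<in>I. c k * frechet_derivative (f k) (at x) h)) (at x)"
    using assms test_fun_differentiable frechet_derivative_works
    by (intro has_derivative_sum has_derivative_mult_right) blast
  then show "partial_deriv i (\<lambda>x. \<Sum>k\<in>I. c k * f k x) x = (\<Sum>k\<in>I. c k * partial_deriv i (f k) x)"
    by (subst partial_deriv_eq) (auto simp: partial_deriv_def)
qed

section \<open>Integrals of test functions, integration by parts, Poincare inequality\<close>

lemma test_fun_bounded:
  assumes "\<psi> \<in> test_fun \<Omega>"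
  obtains C where "\<And>x. \<bar>\<psi> x\<bar> \<le> C"
proof -
  let ?K = "closure {x. \<psi> x \<noteq> 0}"
  have "bounded (\<psi> ` ?K)"
    using assms test_fun_continuous[OF assms]
    by (intro compact_imp_bounded compact_continuous_image) (auto simp: test_fun_def intro: continuous_on_subset)
  then obtain C where C: "\<And>x. x \<in> ?K \<Longrightarrow> \<bar>\<psi> x\<bar> \<le> C"
    by (auto simp: bounded_iff)
  have "\<bar>\<psi> x\<bar> \<le> max C 0" for x
    using C[of x] closure_subset[of "{x. \<psi> x \<noteq> 0}"] by (cases "\<psi> x = 0") auto
  then show thesis by (rule that)
qed

lemma test_fun_integrable:
  assumes "\<psi> \<in> test_fun \<Omega>"
  shows "integrable lborel \<psi>"
proof -
  let ?K = "closure {x. \<psi> x \<noteq> 0}"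
  have "integrable lborel (\<lambda>x. indicator ?K x *\<^sub>R \<psi> x)"
    using assms test_fun_continuous[OF assms]
    by (intro borel_integrable_compact) (auto simp: test_fun_def intro: continuous_on_subset)
  moreover have "(\<lambda>x. indicator ?K x *\<^sub>R \<psi> x) = \<psi>"
  proof
    show "indicator ?K x *\<^sub>R \<psi> x = \<psi> x" for x
      using closure_subset[of "{x. \<psi> x \<noteq> 0}"] by (cases "\<psi> x = 0") auto
  qed
  ultimately show ?thesis by (simp only:)
qed

text \<open>Extension by zero costs nothing for a test function. This moves integrals over \<Omega>
  to the whole space, where translation invariance is available.\<close>

lemma test_fun_integral_eq:
  assumes "open \<Omega>" "\<psi> \<in> test_fun \<Omega>"
  shows "integral\<^sup>L (lebesgue_on \<Omega>) \<psi> = integral\<^sup>L lborel \<psi>" "integrable (lebesgue_on \<Omega>) \<psi>"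
proof -
  have [simp]: "\<Omega> \<inter> space lebesgue \<in> sets lebesgue" using assms(1) by auto
  have m: "\<psi> \<in> borel_measurable lborel"
    using test_fun_continuous[OF assms(2)] by (simp add: borel_measurable_continuous_onI)
  have e: "(\<lambda>x. indicator \<Omega> x *\<^sub>R \<psi> x) = \<psi>"
  proof
    show "indicator \<Omega> x *\<^sub>R \<psi> x = \<psi> x" for x
      using test_fun_zero_outside[OF assms(2), of x] by (cases "x \<in> \<Omega>") auto
  qed
  show "integral\<^sup>L (lebesgue_on \<Omega>) \<psi> = integral\<^sup>L lborel \<psi>"
    by (simp only: integral_restrict_space e integral_completion[OF m] \<open>\<Omega> \<inter> space lebesgue \<in> sets lebesgue\<close>)
  show "integrable (lebesgue_on \<Omega>) \<psi>"
    using test_fun_integrable[OF assms(2)]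
    by (simp only: integrable_restrict_space e integrable_completion[OF m] \<open>\<Omega> \<inter> space lebesgue \<in> sets lebesgue\<close>)
qed

lemma test_fun_L2:
  assumes "open \<Omega>" "\<psi> \<in> test_fun \<Omega>"
  shows "\<psi> \<in> L2_fun \<Omega>"
proof -
  have "(\<lambda>x. \<psi> x * \<psi> x) \<in> test_fun \<Omega>"
    using assms(2) by (intro test_fun_mult) (auto simp: test_fun_def)
  then show ?thesis
    using test_fun_integral_eq(2)[OF assms(1)] borel_measurable_integrable[OF test_fun_integral_eq(2)[OF assms]]
    by (simp add: L2_fun_def power2_eq_square)
qed

text \<open>Mean value inequality along a coordinate line; it bounds the difference quotients
  uniformly, as dominated convergence demands.\<close>

lemma test_fun_increment_bound:
  assumes "\<psi> \<in> test_fun \<Omega>" "\<And>y. \<bar>partial_deriv i \<psi> y\<bar> \<le> C"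
  shows "\<bar>\<psi> (x + t *\<^sub>R axis i 1) - \<psi> x\<bar> \<le> C * \<bar>t\<bar>"
proof -
  have D: "((\<lambda>t. \<psi> (x + t *\<^sub>R axis i 1)) has_real_derivative partial_deriv i \<psi> (x + u *\<^sub>R axis i 1)) (at u)" for u
  proof -
    have "((\<lambda>t. \<psi> (x + t *\<^sub>R axis i 1)) has_derivative
        (\<lambda>h. frechet_derivative \<psi> (at (x + u *\<^sub>R axis i 1)) (h *\<^sub>R axis i 1))) (at u)"
      using test_fun_differentiable[OF assms(1), of "x + u *\<^sub>R axis i 1"]
      by (intro has_derivative_compose[of "\<lambda>t. x + t *\<^sub>R axis i 1" _ _ _ \<psi>])
        (auto simp: frechet_derivative_works[symmetric] intro!: derivative_eq_intros)
    moreover have "frechet_derivative \<psi> (at (x + u *\<^sub>R axis i 1)) (h *\<^sub>R axis i 1) =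
        h * partial_deriv i \<psi> (x + u *\<^sub>R axis i 1)" for h
      using linear_frechet_derivative[OF test_fun_differentiable[OF assms(1)]]
      by (simp add: partial_deriv_def linear_scale)
    ultimately show ?thesis
      by (simp add: has_field_derivative_def mult.commute[of _ "partial_deriv i \<psi> _"])
  qed
  have "norm (\<psi> (x + t *\<^sub>R axis i 1) - \<psi> (x + 0 *\<^sub>R axis i 1)) \<le> C * norm (t - 0)"
    by (rule field_differentiable_bound[where S = UNIV and f' = "\<lambda>u. partial_deriv i \<psi> (x + u *\<^sub>R axis i 1)"])
      (use D assms(2) in auto)
  then show ?thesis by simp
qed

text \<open>By translation invariance the integral of each difference quotient vanishes.\<close>

lemma test_fun_integral_partial:
  fixes \<psi> :: "real ^ 'n \<Rightarrow> real"
  assumes "\<psi> \<in> test_fun \<Omega>"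
  shows "integral\<^sup>L lborel (partial_deriv i \<psi>) = 0"
proof -
  let ?e = "axis i 1 :: real ^ 'n"
  let ?K = "closure {x. \<psi> x \<noteq> 0}"
  have [measurable]: "\<psi> \<in> borel_measurable borel"
    using test_fun_continuous[OF assms] by (simp add: borel_measurable_continuous_onI)
  have [measurable]: "partial_deriv i \<psi> \<in> borel_measurable borel"
    using test_fun_continuous[OF test_fun_partial[OF assms]] by (simp add: borel_measurable_continuous_onI)
  obtain C where C: "\<And>y. \<bar>partial_deriv i \<psi> y\<bar> \<le> C"
    using test_fun_bounded[OF test_fun_partial[OF assms]] by blast
  define h where "h = (\<lambda>n. 1 / real (Suc n))"
  have h: "0 < h n" "h n \<le> 1" for n by (auto simp: h_def)
  define q where "q = (\<lambda>n x. (\<psi> (x + h n *\<^sub>R ?e) - \<psi> x) / h n)"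
  obtain R where R: "\<And>x. x \<in> ?K \<Longrightarrow> norm x \<le> R"
    using assms compact_imp_bounded[of ?K] by (auto simp: test_fun_def bounded_iff)
  have zero: "\<psi> x = 0" if "norm x > R" for x
    using that R[of x] closure_subset[of "{x. \<psi> x \<noteq> 0}"] by fastforce
  have "(\<lambda>n. integral\<^sup>L lborel (q n)) \<longlonglongrightarrow> integral\<^sup>L lborel (partial_deriv i \<psi>)"
  proof (rule integral_dominated_convergence)
    \<comment> \<open>The shifts have length \<open>h n \<le> 1\<close>, so every quotient vanishes
      outside the ball of radius \<open>R + 1\<close> once \<psi> vanishes outside radius
      \<open>R\<close>.\<close>
    show "integrable lborel (\<lambda>x. C * indicator (cball (0 :: real ^ 'n) (R + 1)) x)"
      using emeasure_bounded_finite[of "cball (0 :: real ^ 'n) (R + 1)"] by simp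
    show "AE x in lborel. (\<lambda>n. q n x) \<longlonglongrightarrow> partial_deriv i \<psi> x"
    proof (rule AE_I2)
      fix x
      have "((\<lambda>t. \<psi> (x + t *\<^sub>R ?e)) has_derivative
          (\<lambda>h. frechet_derivative \<psi> (at (x + 0 *\<^sub>R ?e)) (h *\<^sub>R ?e))) (at 0)"
        using test_fun_differentiable[OF assms, of x]
        by (intro has_derivative_compose[of "\<lambda>t. x + t *\<^sub>R axis i 1" _ _ _ \<psi>])
          (auto simp: frechet_derivative_works[symmetric] intro!: derivative_eq_intros)
      moreover have "frechet_derivative \<psi> (at x) (h *\<^sub>R ?e) = h * partial_deriv i \<psi> x" for h
        using linear_frechet_derivative[OF test_fun_differentiable[OF assms]]
        by (simp add: partial_deriv_def linear_scale)
      ultimately have "((\<lambda>t. \<psi> (x + t *\<^sub>R ?e)) has_real_derivative partial_deriv i \<psi> x) (at 0)"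
        by (simp add: has_field_derivative_def mult.commute[of _ "partial_deriv i \<psi> _"])
      then have "((\<lambda>t. (\<psi> (x + t *\<^sub>R ?e) - \<psi> x) / t) \<longlongrightarrow> partial_deriv i \<psi> x) (at 0)"
        by (simp add: has_field_derivative_iff)
      moreover have "filterlim h (at 0) sequentially"
        using LIMSEQ_inverse_real_of_nat by (auto simp: filterlim_at h_def field_simps)
      ultimately show "(\<lambda>n. q n x) \<longlonglongrightarrow> partial_deriv i \<psi> x"
        unfolding q_def by (rule filterlim_compose)
    qed
    show "AE x in lborel. norm (q n x) \<le> C * indicator (cball 0 (R + 1)) x" for n
    proof (rule AE_I2)
      fix x
      have bd: "norm (q n x) \<le> C"
        using test_fun_increment_bound[OF assms C, of x "h n"] h(1)[of n]
        by (simp add: q_def abs_divide pos_divide_le_eq)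
      show "norm (q n x) \<le> C * indicator (cball 0 (R + 1)) x"
      proof (cases "norm x \<le> R + 1")
        case False
        have "norm x \<le> norm (x + h n *\<^sub>R ?e) + norm (h n *\<^sub>R ?e)"
          using norm_triangle_ineq4[of "x + h n *\<^sub>R ?e" "h n *\<^sub>R ?e"] by simp
        then have "norm (x + h n *\<^sub>R ?e) > R" using False h[of n] by simp
        with False show ?thesis by (simp add: q_def zero)
      qed (use bd in simp)
    qed
  qed (unfold q_def, measurable)
  moreover have "integral\<^sup>L lborel (q n) = 0" for n
  proof -
    have int: "integrable lborel \<psi>" by (rule test_fun_integrable[OF assms])
    have "integral\<^sup>L (distr lborel borel ((+) (h n *\<^sub>R ?e))) \<psi> = integral\<^sup>L lborel (\<lambda>x. \<psi> (h n *\<^sub>R ?e + x))"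
      by (rule integral_distr) auto
    then have eq: "integral\<^sup>L lborel (\<lambda>x. \<psi> (x + h n *\<^sub>R ?e)) = integral\<^sup>L lborel \<psi>"
      by (simp add: lborel_distr_plus add.commute)
    have "integrable (distr lborel borel ((+) (h n *\<^sub>R ?e))) \<psi>"
      using int by (simp add: lborel_distr_plus)
    then have "integrable lborel (\<lambda>x. \<psi> (x + h n *\<^sub>R ?e))"
      by (subst (asm) integrable_distr_eq) (auto simp: add.commute)
    with int eq show ?thesis by (simp add: q_def)
  qed
  ultimately show ?thesis by (simp add: LIMSEQ_const_iff)
qed

text \<open>The product f \<psi> is a test function, so the integral of its derivative vanishes.
  Since f itself may lack compact support, coordinate functions are allowed, as the Poincare
  inequality requires.\<close>

lemma integral_by_parts:
  assumes "open \<Omega>" "\<psi> \<in> test_fun \<Omega>" "\<And>k. Ck_fun k f"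
  shows "L2_inner \<Omega> f (partial_deriv i \<psi>) = - L2_inner \<Omega> (partial_deriv i f) \<psi>"
proof -
  have f': "Ck_fun k (partial_deriv i f)" for k using assms(3)[of "Suc k"] by simp
  have fd: "f differentiable (at x)" for x using assms(3)[of "Suc 0"] by simp
  have t: "(\<lambda>x. f x * partial_deriv i \<psi> x) \<in> test_fun \<Omega>" "(\<lambda>x. partial_deriv i f x * \<psi> x) \<in> test_fun \<Omega>"
    using assms f' by (auto intro: test_fun_mult test_fun_partial)
  have pd: "partial_deriv i (\<lambda>x. f x * \<psi> x) = (\<lambda>x. f x * partial_deriv i \<psi> x + partial_deriv i f x * \<psi> x)"
    using fd test_fun_differentiable[OF assms(2)] by (intro ext partial_deriv_mult)
  have "integral\<^sup>L lborel (partial_deriv i (\<lambda>x. f x * \<psi> x)) = 0"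
    using test_fun_integral_partial[OF test_fun_mult[OF assms(2,3)]] .
  then show ?thesis
    unfolding pd L2_inner_def test_fun_integral_eq(1)[OF assms(1) t(1)] test_fun_integral_eq(1)[OF assms(1) t(2)]
    using test_fun_integrable[OF t(1)] test_fun_integrable[OF t(2)] by simp
qed

lemma test_fun_weak_gradient:
  assumes "open \<Omega>" "\<psi> \<in> test_fun \<Omega>"
  shows "has_weak_gradient \<Omega> \<psi> (\<lambda>x. \<chi> i. partial_deriv i \<psi> x)"
  unfolding has_weak_gradient_def
proof (intro conjI allI ballI)
  show "\<psi> \<in> L2_fun \<Omega>" using assms by (rule test_fun_L2)
  show "(\<lambda>x. (\<chi> i. partial_deriv i \<psi> x) $ i) \<in> L2_fun \<Omega>" for i
    using test_fun_L2[OF assms(1) test_fun_partial[OF assms(2)]] by simp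
  show "L2_inner \<Omega> \<psi> (partial_deriv i \<eta>) = - L2_inner \<Omega> (\<lambda>x. (\<chi> i. partial_deriv i \<psi> x) $ i) \<eta>"
    if "\<eta> \<in> test_fun \<Omega>" for i \<eta>
    using integral_by_parts[OF assms(1) that] assms(2) by (simp add: test_fun_def)
qed

lemma test_fun_H10:
  assumes "open \<Omega>" "\<psi> \<in> test_fun \<Omega>"
  shows "\<psi> \<in> H10 \<Omega>"
  unfolding H10_def using assms test_fun_weak_gradient[OF assms]
  by (auto intro!: exI[of _ "\<lambda>x. \<chi> i. partial_deriv i \<psi> x"] bexI[of _ \<psi>])

text \<open>Integrating \<open>\<psi>\<^sup>2 \<partial>\<^sub>i x\<^sub>i\<close> by parts.\<close>

lemma Poincare_inequality:
  fixes \<psi> :: "real ^ 'n \<Rightarrow> real"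
  assumes "open \<Omega>" "\<psi> \<in> test_fun \<Omega>" and R: "\<And>x. x \<in> \<Omega> \<Longrightarrow> norm x \<le> R" "0 \<le> R"
  shows "L2_norm \<Omega> \<psi> \<le> 2 * R * L2_norm \<Omega> (partial_deriv i \<psi>)"
proof -
  have ck: "Ck_fun k \<psi>" for k using assms(2) by (simp add: test_fun_def)
  let ?c = "\<lambda>x :: real ^ 'n. x $ i"
  have tp: "(\<lambda>x. \<psi> x * \<psi> x) \<in> test_fun \<Omega>" using assms(2) ck by (rule test_fun_mult)
  have t: "(\<lambda>x. x $ i * \<psi> x) \<in> test_fun \<Omega>" using assms(2) Ck_fun_coord by (rule test_fun_mult)
  have pc: "partial_deriv i ?c = (\<lambda>x. 1)"
    using partial_deriv_eq[OF bounded_linear_imp_has_derivative[OF bounded_linear_vec_nth], of i i] by auto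
  have pp: "partial_deriv i (\<lambda>x. \<psi> x * \<psi> x) = (\<lambda>x. 2 * (\<psi> x * partial_deriv i \<psi> x))"
    using test_fun_differentiable[OF assms(2)] by (intro ext) (simp add: partial_deriv_mult)
  have "L2_inner \<Omega> ?c (partial_deriv i (\<lambda>x. \<psi> x * \<psi> x)) = - L2_inner \<Omega> (partial_deriv i ?c) (\<lambda>x. \<psi> x * \<psi> x)"
    by (rule integral_by_parts[OF assms(1) tp Ck_fun_coord])
  then have "2 * L2_inner \<Omega> (\<lambda>x. x $ i * \<psi> x) (partial_deriv i \<psi>) = - (L2_norm \<Omega> \<psi>)\<^sup>2"
    unfolding pp pc L2_inner_scale_right by (simp add: L2_norm_sq L2_inner_def mult.assoc)
  then have "(L2_norm \<Omega> \<psi>)\<^sup>2 \<le> 2 * (L2_norm \<Omega> (\<lambda>x. x $ i * \<psi> x) * L2_norm \<Omega> (partial_deriv i \<psi>))"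
    using L2_Cauchy_Schwarz[OF test_fun_L2[OF assms(1) t] test_fun_L2[OF assms(1) test_fun_partial[OF assms(2)]], of i]
    by simp
  also have "L2_norm \<Omega> (\<lambda>x. x $ i * \<psi> x) \<le> L2_norm \<Omega> (\<lambda>x. R * \<psi> x)"
  proof (rule L2_norm_mono)
    show "(\<lambda>x. R * \<psi> x) \<in> L2_fun \<Omega>" using test_fun_L2[OF assms(1,2)] by (rule L2_fun_scale)
    show "(\<lambda>x. x $ i * \<psi> x) \<in> borel_measurable (lebesgue_on \<Omega>)"
      using test_fun_L2[OF assms(1) t] by (rule L2_fun_measurable)
    show "\<bar>x $ i * \<psi> x\<bar> \<le> \<bar>R * \<psi> x\<bar>" if "x \<in> \<Omega>" for x
      using component_le_norm_cart[of x i] R(1)[OF that] R(2) by (simp add: abs_mult mult_right_mono)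
  qed
  finally have "L2_norm \<Omega> \<psi> * L2_norm \<Omega> \<psi> \<le> L2_norm \<Omega> \<psi> * (2 * R * L2_norm \<Omega> (partial_deriv i \<psi>))"
    using R(2) by (simp add: L2_norm_scale power2_eq_square mult_right_mono mult_left_mono L2_norm_nonneg algebra_simps)
  then show ?thesis
    using R(2) L2_norm_nonneg[of \<Omega> \<psi>] L2_norm_nonneg[of \<Omega> "partial_deriv i \<psi>"]
    by (cases "L2_norm \<Omega> \<psi> = 0") auto
qed

section \<open>The energy form\<close>

definition L2_vec :: "(real ^ 'n) set \<Rightarrow> (real ^ 'n \<Rightarrow> real ^ 'n) set" where
  "L2_vec \<Omega> = {G. \<forall>i. (\<lambda>x. G x $ i) \<in> L2_fun \<Omega>}"

definition L2_vec_sq :: "(real ^ 'n) set \<Rightarrow> (real ^ 'n \<Rightarrow> real ^ 'n) \<Rightarrow> real" where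
  "L2_vec_sq \<Omega> G = (\<Sum>i\<in>UNIV. (L2_norm \<Omega> (\<lambda>x. G x $ i))\<^sup>2)"

text \<open>The arguments are vector fields and not functions: a weak gradient is attached to a
  function by the relation \<open>has_weak_gradient\<close> only, so the form cannot be written as a
  function of w.\<close>

definition energy :: "(real ^ 'n) set \<Rightarrow> (real ^ 'n \<Rightarrow> real ^ 'n ^ 'n) \<Rightarrow> (real ^ 'n \<Rightarrow> real ^ 'n) \<Rightarrow> (real ^ 'n \<Rightarrow> real ^ 'n) \<Rightarrow> real" where
  "energy \<Omega> A G V = integral\<^sup>L (lebesgue_on \<Omega>) (\<lambda>x. (A x *v G x) \<bullet> V x)"

lemma L2_vec_diff: "G \<in> L2_vec \<Omega> \<Longrightarrow> V \<in> L2_vec \<Omega> \<Longrightarrow> (\<lambda>x. G x - V x) \<in> L2_vec \<Omega>"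
  by (auto simp: L2_vec_def)

lemma L2_vec_lincomb:
  "(\<And>k. k \<in> I \<Longrightarrow> G k \<in> L2_vec \<Omega>) \<Longrightarrow> (\<lambda>x. \<Sum>k\<in>I. c k *\<^sub>R G k x) \<in> L2_vec \<Omega>"
  by (auto simp: L2_vec_def intro!: L2_fun_lincomb)

lemma has_weak_gradient_L2_vec: "has_weak_gradient \<Omega> w G \<Longrightarrow> G \<in> L2_vec \<Omega>"
  by (auto simp: L2_vec_def has_weak_gradient_def)

lemma H10_L2: "w \<in> H10 \<Omega> \<Longrightarrow> w \<in> L2_fun \<Omega>"
  by (auto simp: H10_def has_weak_gradient_def)

lemma has_weak_gradient_lincomb:
  assumes "open \<Omega>" "\<And>k. k \<in> I \<Longrightarrow> has_weak_gradient \<Omega> (f k) (G k)"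
  shows "has_weak_gradient \<Omega> (\<lambda>x. \<Sum>k\<in>I. c k * f k x) (\<lambda>x. \<Sum>k\<in>I. c k *\<^sub>R G k x)"
proof -
  have L: "f k \<in> L2_fun \<Omega>" "(\<lambda>x. G k x $ i) \<in> L2_fun \<Omega>" if "k \<in> I" for k i
    using assms(2)[OF that] by (auto simp: has_weak_gradient_def)
  have "L2_inner \<Omega> (\<lambda>x. \<Sum>k\<in>I. c k * f k x) (partial_deriv i \<psi>) =
      - L2_inner \<Omega> (\<lambda>x. \<Sum>k\<in>I. c k * G k x $ i) \<psi>" if "\<psi> \<in> test_fun \<Omega>" for i \<psi>
  proof -
    have "\<psi> \<in> L2_fun \<Omega>" "partial_deriv i \<psi> \<in> L2_fun \<Omega>"
      using test_fun_L2[OF assms(1)] that test_fun_partial by blast+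
    moreover have "L2_inner \<Omega> (f k) (partial_deriv i \<psi>) = - L2_inner \<Omega> (\<lambda>x. G k x $ i) \<psi>" if "k \<in> I" for k
      using assms(2)[OF that] \<open>\<psi> \<in> test_fun \<Omega>\<close> by (simp add: has_weak_gradient_def)
    ultimately show ?thesis
      by (simp add: L2_inner_lincomb_left L sum_negf)
  qed
  then show ?thesis
    using L by (auto simp: has_weak_gradient_def intro!: L2_fun_lincomb)
qed

lemma energy_integrable:
  fixes A :: "real ^ 'n \<Rightarrow> real ^ 'n ^ 'n"
  assumes "elliptic_coefficient \<Omega> A" "G \<in> L2_vec \<Omega>" "V \<in> L2_vec \<Omega>"
  shows "integrable (lebesgue_on \<Omega>) (\<lambda>x. (A x *v G x) \<bullet> V x)"
proof -
  obtain M where M: "AE x in lebesgue_on \<Omega>. norm (A x) \<le> M"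
    using assms(1) by (auto simp: elliptic_coefficient_def)
  have meas: "(\<lambda>x. A x $ i $ j) \<in> borel_measurable (lebesgue_on \<Omega>)" for i j
  proof (rule measurable_compose[of A _ borel])
    show "A \<in> borel_measurable (lebesgue_on \<Omega>)"
      using assms(1) by (simp add: elliptic_coefficient_def)
    show "(\<lambda>B. B $ i $ j) \<in> borel_measurable (borel :: (real ^ 'n ^ 'n) measure)"
      by (intro borel_measurable_continuous_onI continuous_intros)
  qed
  have "integrable (lebesgue_on \<Omega>) (\<lambda>x. A x $ i $ j * G x $ j * V x $ i)" for i j
  proof (rule Bochner_Integration.integrable_bound)
    have L: "(\<lambda>x. G x $ j) \<in> L2_fun \<Omega>" "(\<lambda>x. V x $ i) \<in> L2_fun \<Omega>"
      using assms by (auto simp: L2_vec_def)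
    then show "integrable (lebesgue_on \<Omega>) (\<lambda>x. M * (G x $ j * V x $ i))"
      using L2_fun_prod_integrable by auto
    show "(\<lambda>x. A x $ i $ j * G x $ j * V x $ i) \<in> borel_measurable (lebesgue_on \<Omega>)"
      using meas L[THEN L2_fun_measurable] by measurable
    show "AE x in lebesgue_on \<Omega>. norm (A x $ i $ j * G x $ j * V x $ i) \<le> norm (M * (G x $ j * V x $ i))"
      using M
    proof eventually_elim
      case (elim x)
      have "\<bar>A x $ i $ j\<bar> \<le> \<bar>M\<bar>"
        using component_le_norm_cart[of "A x $ i" j] Finite_Cartesian_Product.norm_nth_le[of "A x" i] elim by linarith
      then show ?case by (simp add: abs_mult mult.assoc mult_right_mono)
    qed
  qed
  then have "integrable (lebesgue_on \<Omega>) (\<lambda>x. \<Sum>i\<in>UNIV. \<Sum>j\<in>UNIV. A x $ i $ j * G x $ j * V x $ i)"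
    by (intro Bochner_Integration.integrable_sum)
  then show ?thesis
    by (simp add: inner_vec_def matrix_vector_mult_def sum_distrib_right)
qed

lemma energy_commute:
  assumes "elliptic_coefficient \<Omega> A" "G \<in> L2_vec \<Omega>" "V \<in> L2_vec \<Omega>"
  shows "energy \<Omega> A G V = energy \<Omega> A V G"
  unfolding energy_def
proof (rule integral_cong_AE)
  have "AE x in lebesgue_on \<Omega>. transpose (A x) = A x"
    using assms(1) by (simp add: elliptic_coefficient_def)
  then show "AE x in lebesgue_on \<Omega>. (A x *v G x) \<bullet> V x = (A x *v V x) \<bullet> G x"
  proof eventually_elim
    case (elim x)
    then show ?case
      using dot_lmul_matrix[of "V x" "A x" "G x"] vector_transpose_matrix[of "V x" "A x"]
      by (simp add: inner_commute)
  qed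
qed (use energy_integrable assms in \<open>auto intro!: borel_measurable_integrable\<close>)

lemma energy_diff_left:
  assumes "elliptic_coefficient \<Omega> A" "G \<in> L2_vec \<Omega>" "V \<in> L2_vec \<Omega>" "W \<in> L2_vec \<Omega>"
  shows "energy \<Omega> A (\<lambda>x. G x - V x) W = energy \<Omega> A G W - energy \<Omega> A V W"
  using energy_integrable[OF assms(1)] assms
  by (simp add: energy_def matrix_vector_mult_diff_distrib inner_diff_left)

lemma energy_lincomb_left:
  assumes "elliptic_coefficient \<Omega> A" "\<And>k. k \<in> I \<Longrightarrow> G k \<in> L2_vec \<Omega>" "W \<in> L2_vec \<Omega>"
  shows "energy \<Omega> A (\<lambda>x. \<Sum>k\<in>I. c k *\<^sub>R G k x) W = (\<Sum>k\<in>I. c k * energy \<Omega> A (G k) W)"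
proof -
  have "(A x *v (\<Sum>k\<in>I. c k *\<^sub>R G k x)) \<bullet> W x = (\<Sum>k\<in>I. c k * ((A x *v G k x) \<bullet> W x))" for x
    by (simp add: linear_sum[OF matrix_vector_mul_linear] matrix_vector_mult_scaleR inner_sum_left)
  then show ?thesis
    using energy_integrable[OF assms(1)] assms by (simp add: energy_def)
qed

text \<open>Ellipticity and boundedness make the energy equivalent to the unweighted squared norm.
  Eigenvalues live in the energy, while truncation is compared in the unweighted norm, so the
  passage is needed in both directions.\<close>

lemma energy_bounds:
  fixes A :: "real ^ 'n \<Rightarrow> real ^ 'n ^ 'n"
  assumes "elliptic_coefficient \<Omega> A"
  obtains \<alpha> B where "0 < \<alpha>" "0 \<le> B"
    "\<And>V. V \<in> L2_vec \<Omega> \<Longrightarrow> \<alpha> * L2_vec_sq \<Omega> V \<le> energy \<Omega> A V V"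
    "\<And>V. V \<in> L2_vec \<Omega> \<Longrightarrow> energy \<Omega> A V V \<le> B * L2_vec_sq \<Omega> V"
proof -
  obtain M where M: "AE x in lebesgue_on \<Omega>. norm (A x) \<le> M"
    using assms(1) by (auto simp: elliptic_coefficient_def)
  obtain \<alpha> where \<alpha>: "0 < \<alpha>" "AE x in lebesgue_on \<Omega>. \<forall>\<xi>. \<alpha> * (norm \<xi>)\<^sup>2 \<le> \<xi> \<bullet> (A x *v \<xi>)"
    using assms(1) by (auto simp: elliptic_coefficient_def)
  have sq: "integrable (lebesgue_on \<Omega>) (\<lambda>x. (norm (V x))\<^sup>2)"
      "integral\<^sup>L (lebesgue_on \<Omega>) (\<lambda>x. (norm (V x))\<^sup>2) = L2_vec_sq \<Omega> V" if "V \<in> L2_vec \<Omega>" for V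
  proof -
    have e: "(norm (V x))\<^sup>2 = (\<Sum>i\<in>UNIV. V x $ i * V x $ i)" for x
      by (simp add: power2_norm_eq_inner inner_vec_def)
    have "integrable (lebesgue_on \<Omega>) (\<lambda>x. V x $ i * V x $ i)" for i
      using that by (intro L2_fun_prod_integrable) (auto simp: L2_vec_def)
    then show "integrable (lebesgue_on \<Omega>) (\<lambda>x. (norm (V x))\<^sup>2)"
      "integral\<^sup>L (lebesgue_on \<Omega>) (\<lambda>x. (norm (V x))\<^sup>2) = L2_vec_sq \<Omega> V"
      unfolding e L2_vec_sq_def L2_norm_sq by (auto simp: L2_inner_def)
  qed
  \<comment> \<open>The entries of the matrix are at most |M|, which yields |M| times the squared l1
    norm of the vector; passing to the Euclidean norm costs the dimension.\<close>
  define B where "B = \<bar>M\<bar> * real CARD('n)"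
  have bound: "\<bar>(C *v v) \<bullet> v\<bar> \<le> B * (norm v)\<^sup>2" if "norm C \<le> M" for C :: "real ^ 'n ^ 'n" and v
  proof -
    have "\<bar>(C *v v) \<bullet> v\<bar> = \<bar>\<Sum>i\<in>UNIV. \<Sum>j\<in>UNIV. C $ i $ j * v $ j * v $ i\<bar>"
      by (simp add: inner_vec_def matrix_vector_mult_def sum_distrib_right)
    also have "\<dots> \<le> (\<Sum>i\<in>UNIV. \<Sum>j\<in>UNIV. \<bar>M\<bar> * \<bar>v $ j\<bar> * \<bar>v $ i\<bar>)"
    proof (intro order_trans[OF sum_abs] sum_mono)
      fix i j
      have "\<bar>C $ i $ j\<bar> \<le> \<bar>M\<bar>"
        using component_le_norm_cart[of "C $ i" j] Finite_Cartesian_Product.norm_nth_le[of C i] that by linarith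
      then show "\<bar>C $ i $ j * v $ j * v $ i\<bar> \<le> \<bar>M\<bar> * \<bar>v $ j\<bar> * \<bar>v $ i\<bar>"
        by (simp add: abs_mult mult_right_mono)
    qed
    also have "\<dots> = \<bar>M\<bar> * (\<Sum>i\<in>UNIV. \<bar>v $ i\<bar>)\<^sup>2"
      by (simp add: power2_eq_square sum_product sum_distrib_left algebra_simps)
    also have "\<dots> \<le> \<bar>M\<bar> * (real CARD('n) * (\<Sum>i\<in>UNIV. \<bar>v $ i\<bar>\<^sup>2))"
      using sum_squared_le_sum_of_squares[of "\<lambda>i. \<bar>v $ i\<bar>" UNIV]
      by (intro mult_left_mono) (auto simp: mult.commute)
    also have "\<dots> = B * (norm v)\<^sup>2"
      unfolding B_def power2_norm_eq_inner inner_vec_def by (simp add: power2_eq_square)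
    finally show ?thesis .
  qed
  show thesis
  proof (rule that[of \<alpha> B])
    show "0 \<le> B" by (simp add: B_def)
    fix V assume V: "V \<in> L2_vec \<Omega>"
    note I = energy_integrable[OF assms V V] sq[OF V]
    have "integral\<^sup>L (lebesgue_on \<Omega>) (\<lambda>x. \<alpha> * (norm (V x))\<^sup>2) \<le> energy \<Omega> A V V"
      unfolding energy_def
    proof (rule integral_mono_AE)
      show "AE x in lebesgue_on \<Omega>. \<alpha> * (norm (V x))\<^sup>2 \<le> (A x *v V x) \<bullet> V x"
        using \<alpha>(2) by eventually_elim (auto simp: inner_commute)
    qed (use I in auto)
    then show "\<alpha> * L2_vec_sq \<Omega> V \<le> energy \<Omega> A V V" using I by simp
    have "energy \<Omega> A V V \<le> integral\<^sup>L (lebesgue_on \<Omega>) (\<lambda>x. B * (norm (V x))\<^sup>2)"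
      unfolding energy_def
    proof (rule integral_mono_AE)
      show "AE x in lebesgue_on \<Omega>. (A x *v V x) \<bullet> V x \<le> B * (norm (V x))\<^sup>2"
        using M by eventually_elim (use bound in \<open>auto dest: abs_le_D1\<close>)
    qed (use I in auto)
    then show "energy \<Omega> A V V \<le> B * L2_vec_sq \<Omega> V" using I by simp
  qed (rule \<alpha>(1))
qed

section \<open>Approximation by test functions\<close>

definition H1_tendsto :: "(real ^ 'n) set \<Rightarrow> (nat \<Rightarrow> real ^ 'n \<Rightarrow> real) \<Rightarrow> (real ^ 'n \<Rightarrow> real) \<Rightarrow> (real ^ 'n \<Rightarrow> real ^ 'n) \<Rightarrow> bool" where
  "H1_tendsto \<Omega> \<psi> w G \<longleftrightarrow> (\<forall>n. \<psi> n \<in> test_fun \<Omega>) \<and>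
    (\<lambda>n. L2_norm \<Omega> (\<lambda>x. w x - \<psi> n x)) \<longlonglongrightarrow> 0 \<and>
    (\<forall>i. (\<lambda>n. L2_norm \<Omega> (\<lambda>x. G x $ i - partial_deriv i (\<psi> n) x)) \<longlonglongrightarrow> 0)"

lemma H10_approx:
  assumes "w \<in> H10 \<Omega>"
  obtains G \<psi> where "has_weak_gradient \<Omega> w G" "H1_tendsto \<Omega> \<psi> w G"
proof -
  obtain G where G: "has_weak_gradient \<Omega> w G"
    and ap: "\<And>\<epsilon>. \<epsilon> > 0 \<Longrightarrow> \<exists>\<psi> \<in> test_fun \<Omega>. (L2_norm \<Omega> (\<lambda>x. w x - \<psi> x))\<^sup>2 +
      (\<Sum>i\<in>UNIV. (L2_norm \<Omega> (\<lambda>x. G x $ i - partial_deriv i \<psi> x))\<^sup>2) < \<epsilon>"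
    using assms unfolding H10_def by auto
  define h where "h = (\<lambda>n. inverse (real (Suc n)))"
  have h: "h n > 0" for n by (simp add: h_def)
  have h0: "h \<longlonglongrightarrow> 0" unfolding h_def by (rule LIMSEQ_inverse_real_of_nat)
  \<comment> \<open>The tolerance is squared because \<open>H10\<close> measures a sum of squared
    norms.\<close>
  have "\<forall>n. \<exists>\<psi>. \<psi> \<in> test_fun \<Omega> \<and> (L2_norm \<Omega> (\<lambda>x. w x - \<psi> x))\<^sup>2 +
      (\<Sum>i\<in>UNIV. (L2_norm \<Omega> (\<lambda>x. G x $ i - partial_deriv i \<psi> x))\<^sup>2) < (h n)\<^sup>2"
    using ap h by (meson zero_less_power)
  from choice[OF this] obtain \<psi> where \<psi>: "\<And>n. \<psi> n \<in> test_fun \<Omega>"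
    and lt: "\<And>n. (L2_norm \<Omega> (\<lambda>x. w x - \<psi> n x))\<^sup>2 +
      (\<Sum>i\<in>UNIV. (L2_norm \<Omega> (\<lambda>x. G x $ i - partial_deriv i (\<psi> n) x))\<^sup>2) < (h n)\<^sup>2"
    by blast
  have le: "L2_norm \<Omega> (\<lambda>x. w x - \<psi> n x) \<le> h n"
      "L2_norm \<Omega> (\<lambda>x. G x $ i - partial_deriv i (\<psi> n) x) \<le> h n" for n i
  proof -
    let ?g = "\<lambda>i. (L2_norm \<Omega> (\<lambda>x. G x $ i - partial_deriv i (\<psi> n) x))\<^sup>2"
    have "0 \<le> (\<Sum>i\<in>UNIV. ?g i)" by (simp add: sum_nonneg)
    moreover have "?g i \<le> (\<Sum>i\<in>UNIV. ?g i)" by (rule member_le_sum) auto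
    ultimately have "(L2_norm \<Omega> (\<lambda>x. w x - \<psi> n x))\<^sup>2 \<le> (h n)\<^sup>2" "?g i \<le> (h n)\<^sup>2"
      using lt[of n] zero_le_power2[of "L2_norm \<Omega> (\<lambda>x. w x - \<psi> n x)"] by linarith+
    then show "L2_norm \<Omega> (\<lambda>x. w x - \<psi> n x) \<le> h n"
      "L2_norm \<Omega> (\<lambda>x. G x $ i - partial_deriv i (\<psi> n) x) \<le> h n"
      using h[of n] by (auto intro: power2_le_imp_le)
  qed
  have "H1_tendsto \<Omega> \<psi> w G"
    unfolding H1_tendsto_def using \<psi> le h0
    by (auto intro!: Lim_null_comparison[OF _ h0] always_eventually simp: L2_norm_nonneg)
  with G show thesis by (rule that)
qed

lemma H1_tendsto_lincomb:
  assumes "open \<Omega>" "finite I" "\<And>k. k \<in> I \<Longrightarrow> has_weak_gradient \<Omega> (f k) (G k)"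
    and "\<And>k. k \<in> I \<Longrightarrow> H1_tendsto \<Omega> (\<psi> k) (f k) (G k)"
  shows "H1_tendsto \<Omega> (\<lambda>n x. \<Sum>k\<in>I. c k * \<psi> k n x) (\<lambda>x. \<Sum>k\<in>I. c k * f k x) (\<lambda>x. \<Sum>k\<in>I. c k *\<^sub>R G k x)"
  unfolding H1_tendsto_def
proof (intro conjI allI)
  have t: "\<psi> k n \<in> test_fun \<Omega>" if "k \<in> I" for k n
    using assms(4)[OF that] by (simp add: H1_tendsto_def)
  then show "(\<lambda>x. \<Sum>k\<in>I. c k * \<psi> k n x) \<in> test_fun \<Omega>" for n
    by (rule test_fun_lincomb)
  show "(\<lambda>n. L2_norm \<Omega> (\<lambda>x. (\<Sum>k\<in>I. c k * f k x) - (\<Sum>k\<in>I. c k * \<psi> k n x))) \<longlonglongrightarrow> 0"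
    using assms t by (intro L2_tendsto_lincomb) (auto simp: H1_tendsto_def has_weak_gradient_def test_fun_L2)
  have "(\<lambda>n. L2_norm \<Omega> (\<lambda>x. (\<Sum>k\<in>I. c k * G k x $ i) - (\<Sum>k\<in>I. c k * partial_deriv i (\<psi> k n) x))) \<longlonglongrightarrow> 0" for i
    using assms t by (intro L2_tendsto_lincomb)
      (auto simp: H1_tendsto_def has_weak_gradient_def test_fun_L2 test_fun_partial)
  then show "(\<lambda>n. L2_norm \<Omega> (\<lambda>x. (\<Sum>k\<in>I. c k *\<^sub>R G k x) $ i
      - partial_deriv i (\<lambda>x. \<Sum>k\<in>I. c k * \<psi> k n x) x)) \<longlonglongrightarrow> 0" for i
    using partial_deriv_lincomb[OF t, where i = i and c = c] by simp
qed

lemma L2_vec_sq_tendsto: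
  assumes "open \<Omega>" "H1_tendsto \<Omega> \<psi> w G" "G \<in> L2_vec \<Omega>"
  shows "(\<lambda>n. L2_vec_sq \<Omega> (\<lambda>x. \<chi> i. partial_deriv i (\<psi> n) x)) \<longlonglongrightarrow> L2_vec_sq \<Omega> G"
proof -
  have "partial_deriv i (\<psi> n) \<in> L2_fun \<Omega>" for n i
    using assms(1,2) by (simp add: H1_tendsto_def test_fun_L2 test_fun_partial)
  then have "(\<lambda>n. L2_norm \<Omega> (partial_deriv i (\<psi> n))) \<longlonglongrightarrow> L2_norm \<Omega> (\<lambda>x. G x $ i)" for i
    using assms(2,3) by (intro L2_norm_tendsto) (auto simp: H1_tendsto_def L2_vec_def)
  then show ?thesis
    unfolding L2_vec_sq_def by (auto intro!: tendsto_intros)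
qed

text \<open>The difference of two weak gradients of the same function is orthogonal to all test functions, in
  particular to the derivatives \<open>\<partial>\<^sub>i \<psi>\<^sub>n\<close>, and hence to their limit. This makes up for not knowing
  that weak gradients are unique.\<close>

lemma L2_vec_sq_minimal:
  assumes "open \<Omega>" "has_weak_gradient \<Omega> w G" "has_weak_gradient \<Omega> w G'" "H1_tendsto \<Omega> \<psi> w G'"
  shows "L2_vec_sq \<Omega> G' \<le> L2_vec_sq \<Omega> G"
  unfolding L2_vec_sq_def
proof (rule sum_mono)
  fix i
  let ?D = "\<lambda>x. G x $ i - G' x $ i"
  have L: "(\<lambda>x. G x $ i) \<in> L2_fun \<Omega>" "(\<lambda>x. G' x $ i) \<in> L2_fun \<Omega>"
    using assms(2,3) by (auto simp: has_weak_gradient_def)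
  have D: "?D \<in> L2_fun \<Omega>" using L by (rule L2_fun_diff)
  have t: "\<psi> n \<in> test_fun \<Omega>" "partial_deriv i (\<psi> n) \<in> test_fun \<Omega>" for n
    using assms(4) by (auto simp: H1_tendsto_def test_fun_partial)
  have "L2_inner \<Omega> ?D \<eta> = 0" if "\<eta> \<in> test_fun \<Omega>" for \<eta>
    using assms(2,3) that test_fun_L2[OF assms(1) that] L
    by (simp add: has_weak_gradient_def L2_inner_diff_left)
  then have z: "L2_inner \<Omega> (partial_deriv i (\<psi> n)) ?D = 0" for n
    using t(2) by (simp add: L2_inner_commute)
  have "(\<lambda>n. L2_inner \<Omega> (partial_deriv i (\<psi> n)) ?D) \<longlonglongrightarrow> L2_inner \<Omega> (\<lambda>x. G' x $ i) ?D"
    using assms(4) t L D test_fun_L2[OF assms(1)] by (intro L2_inner_tendsto) (auto simp: H1_tendsto_def)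
  then have "L2_inner \<Omega> (\<lambda>x. G' x $ i) ?D = 0" by (simp add: z LIMSEQ_const_iff)
  \<comment> \<open>Orthogonality of \<open>?D\<close> to the component of G' gives Pythagoras: the
    squared norm for G is that for G' plus that of \<open>?D\<close>.\<close>
  then have "L2_inner \<Omega> (\<lambda>x. G' x $ i) (\<lambda>x. G x $ i) = L2_inner \<Omega> (\<lambda>x. G' x $ i) (\<lambda>x. G' x $ i)"
    using L by (simp add: L2_inner_diff_right)
  moreover have "0 \<le> L2_inner \<Omega> ?D ?D" by (rule L2_inner_self_nonneg)
  ultimately show "(L2_norm \<Omega> (\<lambda>x. G' x $ i))\<^sup>2 \<le> (L2_norm \<Omega> (\<lambda>x. G x $ i))\<^sup>2"
    using L D by (simp add: L2_norm_sq L2_inner_diff_left L2_inner_diff_right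
        L2_inner_commute[of \<Omega> "\<lambda>x. G x $ i" "\<lambda>x. G' x $ i"])
qed

text \<open>Membership of each \<open>f k\<close> in \<open>H10\<close> comes with its own gradient,
  and the combination of these gradients may differ from the prescribed G. It is the limit of test
  function gradients, hence minimal, which gives an inequality for the limit e.\<close>

lemma H10_lincomb_approx:
  assumes "open \<Omega>" "finite I" "\<And>k. k \<in> I \<Longrightarrow> f k \<in> H10 \<Omega>"
    and "has_weak_gradient \<Omega> (\<lambda>x. \<Sum>k\<in>I. c k * f k x) G"
  obtains \<psi> e where "\<And>n. \<psi> n \<in> test_fun \<Omega>"
    "(\<lambda>n. L2_norm \<Omega> (\<lambda>x. (\<Sum>k\<in>I. c k * f k x) - \<psi> n x)) \<longlonglongrightarrow> 0"
    "(\<lambda>n. L2_vec_sq \<Omega> (\<lambda>x. \<chi> i. partial_deriv i (\<psi> n) x)) \<longlonglongrightarrow> e" "e \<le> L2_vec_sq \<Omega> G"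
proof -
  have "\<forall>k\<in>I. \<exists>p. has_weak_gradient \<Omega> (f k) (fst p) \<and> H1_tendsto \<Omega> (snd p) (f k) (fst p)"
  proof
    fix k assume "k \<in> I"
    from H10_approx[OF assms(3)[OF this]] obtain G \<psi>
      where "has_weak_gradient \<Omega> (f k) G" "H1_tendsto \<Omega> \<psi> (f k) G" .
    then show "\<exists>p. has_weak_gradient \<Omega> (f k) (fst p) \<and> H1_tendsto \<Omega> (snd p) (f k) (fst p)"
      by (intro exI[of _ "(G, \<psi>)"]) simp
  qed
  from bchoice[OF this] obtain p where
    p: "\<forall>k\<in>I. has_weak_gradient \<Omega> (f k) (fst (p k)) \<and> H1_tendsto \<Omega> (snd (p k)) (f k) (fst (p k))" ..
  define G' \<psi> where "G' = (\<lambda>k. fst (p k))" and "\<psi> = (\<lambda>k. snd (p k))"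
  have *: "has_weak_gradient \<Omega> (f k) (G' k)" "H1_tendsto \<Omega> (\<psi> k) (f k) (G' k)" if "k \<in> I" for k
    using p that by (simp_all add: G'_def \<psi>_def)
  note wg = has_weak_gradient_lincomb[OF assms(1) *(1), where I = I and c = c]
  note ht = H1_tendsto_lincomb[OF assms(1,2) *, where c = c]
  show thesis
  proof (rule that)
    show "(\<lambda>x. \<Sum>k\<in>I. c k * \<psi> k n x) \<in> test_fun \<Omega>" for n
      using ht by (simp add: H1_tendsto_def)
    show "(\<lambda>n. L2_norm \<Omega> (\<lambda>x. (\<Sum>k\<in>I. c k * f k x) - (\<Sum>k\<in>I. c k * \<psi> k n x))) \<longlonglongrightarrow> 0"
      using ht by (simp add: H1_tendsto_def)
    show "(\<lambda>n. L2_vec_sq \<Omega> (\<lambda>x. \<chi> i. partial_deriv i (\<lambda>x. \<Sum>k\<in>I. c k * \<psi> k n x) x))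
        \<longlonglongrightarrow> L2_vec_sq \<Omega> (\<lambda>x. \<Sum>k\<in>I. c k *\<^sub>R G' k x)"
      by (rule L2_vec_sq_tendsto[OF assms(1) ht has_weak_gradient_L2_vec[OF wg]])
    show "L2_vec_sq \<Omega> (\<lambda>x. \<Sum>k\<in>I. c k *\<^sub>R G' k x) \<le> L2_vec_sq \<Omega> G"
      by (rule L2_vec_sq_minimal[OF assms(1,4) wg ht])
  qed
qed

section \<open>Truncation\<close>

definition truncate :: "real \<Rightarrow> real \<Rightarrow> real \<Rightarrow> real" where
  "truncate a b t = max a (min b t)"

lemma truncate_lipschitz: "\<bar>truncate a b t - truncate a b t'\<bar> \<le> \<bar>t - t'\<bar>"
  by (auto simp: truncate_def max_def min_def)

lemma truncate_zero: "a \<le> 0 \<Longrightarrow> 0 \<le> b \<Longrightarrow> truncate a b 0 = 0"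
  by (auto simp: truncate_def)

lemma truncate_L2:
  assumes "a \<le> 0" "0 \<le> b" "w \<in> L2_fun \<Omega>"
  shows "(\<lambda>x. truncate a b (w x)) \<in> L2_fun \<Omega>"
proof (rule L2_fun_bound)
  show "(\<lambda>x. truncate a b (w x)) \<in> borel_measurable (lebesgue_on \<Omega>)"
    using L2_fun_measurable[OF assms(3)] unfolding truncate_def by measurable
  show "integrable (lebesgue_on \<Omega>) (\<lambda>x. (w x)\<^sup>2)" using assms(3) by (rule L2_fun_sq_integrable)
  show "(truncate a b (w x))\<^sup>2 \<le> (w x)\<^sup>2" for x
    using truncate_lipschitz[of a b "w x" 0] truncate_zero[OF assms(1,2)]
    by (simp add: abs_le_square_iff)
qed

lemma truncate_L2_contraction:
  assumes "a \<le> 0" "0 \<le> b" "v \<in> L2_fun \<Omega>" "w \<in> L2_fun \<Omega>"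
  shows "L2_norm \<Omega> (\<lambda>x. truncate a b (v x) - truncate a b (w x)) \<le> L2_norm \<Omega> (\<lambda>x. v x - w x)"
  using assms truncate_lipschitz
  by (intro L2_norm_mono L2_fun_measurable L2_fun_diff truncate_L2) auto

text \<open>Obtained from \<open>truncate a b t = (\<bar>t - a\<bar> - \<bar>t - b\<bar> + a + b) / 2\<close> by smoothing the absolute values.\<close>

definition smooth_truncate :: "real \<Rightarrow> real \<Rightarrow> real \<Rightarrow> real \<Rightarrow> real" where
  "smooth_truncate a b \<epsilon> t =
    (((t - a)\<^sup>2 + \<epsilon>\<^sup>2) powr (1/2) - ((t - b)\<^sup>2 + \<epsilon>\<^sup>2) powr (1/2)) / 2 -
    ((a\<^sup>2 + \<epsilon>\<^sup>2) powr (1/2) - (b\<^sup>2 + \<epsilon>\<^sup>2) powr (1/2)) / 2"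

lemma smooth_truncate_zero: "smooth_truncate a b \<epsilon> 0 = 0"
  by (simp add: smooth_truncate_def)

lemma smooth_abs_bounds:
  fixes y \<epsilon> :: real
  assumes "0 < \<epsilon>"
  shows "\<bar>y\<bar> \<le> (y\<^sup>2 + \<epsilon>\<^sup>2) powr (1/2)" "(y\<^sup>2 + \<epsilon>\<^sup>2) powr (1/2) \<le> \<bar>y\<bar> + \<epsilon>"
proof -
  have "0 < y\<^sup>2 + \<epsilon>\<^sup>2" using assms by (simp add: sum_power2_gt_zero_iff)
  then have e: "(y\<^sup>2 + \<epsilon>\<^sup>2) powr (1/2) = sqrt (y\<^sup>2 + \<epsilon>\<^sup>2)" by (simp add: powr_half_sqrt)
  show "\<bar>y\<bar> \<le> (y\<^sup>2 + \<epsilon>\<^sup>2) powr (1/2)" unfolding e by (simp add: real_le_rsqrt)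
  show "(y\<^sup>2 + \<epsilon>\<^sup>2) powr (1/2) \<le> \<bar>y\<bar> + \<epsilon>"
    unfolding e using assms by (intro real_le_lsqrt) (auto simp: power2_sum)
qed

lemma smooth_truncate_dist:
  assumes "0 < \<epsilon>" "a \<le> 0" "0 \<le> b"
  shows "\<bar>smooth_truncate a b \<epsilon> t - truncate a b t\<bar> \<le> \<epsilon>"
proof -
  \<comment> \<open>For \<open>a \<le> 0 \<le> b\<close> the constant (a + b) / 2 is written with
    |a| and |b|; smoothing these as well is what makes the smooth truncation vanish at 0.\<close>
  have "truncate a b t = (\<bar>t - a\<bar> - \<bar>t - b\<bar>) / 2 - (\<bar>a\<bar> - \<bar>b\<bar>) / 2"
    using assms by (auto simp: truncate_def max_def min_def field_simps)
  \<comment> \<open>Each smoothed absolute value errs upwards by at most \<epsilon>. Two errors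
    enter with weight 1/2 and two with weight -1/2, so the total stays within \<epsilon>.\<close>
  moreover have "\<bar>(P - Q) / 2 - (R - U) / 2 - ((p - q) / 2 - (r - u) / 2)\<bar> \<le> \<epsilon>"
    if "p \<le> P" "P \<le> p + \<epsilon>" "q \<le> Q" "Q \<le> q + \<epsilon>" "r \<le> R" "R \<le> r + \<epsilon>" "u \<le> U" "U \<le> u + \<epsilon>"
    for P Q R U p q r u :: real
    using that unfolding abs_le_iff by (auto simp: field_simps)
  ultimately show ?thesis
    unfolding smooth_truncate_def using smooth_abs_bounds[OF assms(1)] by presburger
qed

text \<open>A smoothed absolute value has slope (t - c) / sqrt ((t - c)^2 + \<epsilon>^2), of
  modulus at most 1, and half the difference of two such slopes again has modulus at most 1.\<close>

lemma smooth_truncate_deriv: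
  assumes "0 < \<epsilon>"
  obtains d where "(smooth_truncate a b \<epsilon> has_real_derivative d) (at t)" "\<bar>d\<bar> \<le> 1"
proof -
  define R where "R = (\<lambda>c. (t - c)\<^sup>2 + \<epsilon>\<^sup>2)"
  have R: "0 < R c" for c using assms by (simp add: R_def sum_power2_gt_zero_iff)
  define D where "D = (\<lambda>c. (1/2) * R c powr (1/2 - 1) * (2 * (t - c)))"
  have D: "((\<lambda>t. ((t - c)\<^sup>2 + \<epsilon>\<^sup>2) powr (1/2)) has_real_derivative D c) (at t)" for c
    unfolding D_def
    by (rule DERIV_chain2[where f = "\<lambda>z. z powr (1/2)" and g = "\<lambda>t. (t - c)\<^sup>2 + \<epsilon>\<^sup>2"])
      (use R[of c] in \<open>auto simp: R_def intro!: has_real_derivative_powr derivative_eq_intros\<close>)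
  have bd: "\<bar>D c\<bar> \<le> 1" for c
  proof -
    have "R c powr (1/2 - 1) = inverse (R c powr (1/2))"
      using powr_minus[of "R c" "1/2"] by simp
    then have "D c = (1/2) * inverse (R c powr (1/2)) * (2 * (t - c))"
      by (simp only: D_def)
    then have "D c = (t - c) / R c powr (1/2)"
      using R[of c] by (simp add: field_simps)
    moreover have "\<bar>t - c\<bar> \<le> R c powr (1/2)" "0 < R c powr (1/2)"
      using smooth_abs_bounds(1)[OF assms, of "t - c"] R[of c] by (auto simp: R_def)
    ultimately show ?thesis by (simp only: abs_divide abs_of_pos divide_le_eq_1_pos)
  qed
  show thesis
  proof (rule that)
    show "(smooth_truncate a b \<epsilon> has_real_derivative (D a - D b) / 2) (at t)"
      unfolding smooth_truncate_def[abs_def]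
      using DERIV_diff[OF DERIV_cdivide[OF DERIV_diff[OF D D]] DERIV_const] by simp
    show "\<bar>(D a - D b) / 2\<bar> \<le> 1" using bd[of a] bd[of b] abs_triangle_ineq4[of "D a" "D b"] by simp
  qed
qed

text \<open>Vanishing at 0 preserves the compact support, and \<epsilon> > 0 preserves smoothness;
  the second fails for the unsmoothed truncation.\<close>

lemma smooth_truncate_test_fun:
  assumes "0 < \<epsilon>" "\<psi> \<in> test_fun \<Omega>"
  shows "(\<lambda>x. smooth_truncate a b \<epsilon> (\<psi> x)) \<in> test_fun \<Omega>"
proof (rule test_fun_support_subset[OF assms(2)])
  show "smooth_truncate a b \<epsilon> (\<psi> x) = 0" if "x \<notin> closure {x. \<psi> x \<noteq> 0}" for x
  proof -
    have "\<psi> x = 0" using that closure_subset[of "{x. \<psi> x \<noteq> 0}"] by blast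
    then show ?thesis by (simp add: smooth_truncate_zero)
  qed
  fix k
  have ck: "Ck_fun k \<psi>" using assms(2) by (simp add: test_fun_def)
  have P: "Ck_fun k (\<lambda>x. ((\<psi> x - c)\<^sup>2 + \<epsilon>\<^sup>2) powr (1/2))" for c
  proof (rule Ck_fun_powr)
    show "0 < (\<psi> x - c)\<^sup>2 + \<epsilon>\<^sup>2" for x using assms(1) by (simp add: sum_power2_gt_zero_iff)
    have "Ck_fun k (\<lambda>x. (\<psi> x + - c) * (\<psi> x + - c) + \<epsilon>\<^sup>2)"
      by (intro Ck_fun_add Ck_fun_mult Ck_fun_const ck)
    then show "Ck_fun k (\<lambda>x. (\<psi> x - c)\<^sup>2 + \<epsilon>\<^sup>2)" by (simp add: power2_eq_square)
  qed
  have "Ck_fun k (\<lambda>x. 1/2 * (((\<psi> x - a)\<^sup>2 + \<epsilon>\<^sup>2) powr (1/2) + (-1) * ((\<psi> x - b)\<^sup>2 + \<epsilon>\<^sup>2) powr (1/2)) +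
    - (((a\<^sup>2 + \<epsilon>\<^sup>2) powr (1/2) - (b\<^sup>2 + \<epsilon>\<^sup>2) powr (1/2)) / 2))"
    by (intro Ck_fun_add Ck_fun_mult P) auto
  then show "Ck_fun k (\<lambda>x. smooth_truncate a b \<epsilon> (\<psi> x))"
    by (simp add: smooth_truncate_def)
qed

lemma smooth_truncate_L2_vec_sq:
  assumes "open \<Omega>" "0 < \<epsilon>" "\<psi> \<in> test_fun \<Omega>"
  shows "L2_vec_sq \<Omega> (\<lambda>x. \<chi> i. partial_deriv i (\<lambda>x. smooth_truncate a b \<epsilon> (\<psi> x)) x)
    \<le> L2_vec_sq \<Omega> (\<lambda>x. \<chi> i. partial_deriv i \<psi> x)"
  unfolding L2_vec_sq_def
proof (intro sum_mono power_mono L2_norm_nonneg)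
  fix i
  have t: "partial_deriv i (\<lambda>x. smooth_truncate a b \<epsilon> (\<psi> x)) \<in> L2_fun \<Omega>" "partial_deriv i \<psi> \<in> L2_fun \<Omega>"
    using assms smooth_truncate_test_fun by (auto intro!: test_fun_L2 test_fun_partial)
  have "\<bar>partial_deriv i (\<lambda>x. smooth_truncate a b \<epsilon> (\<psi> x)) x\<bar> \<le> \<bar>partial_deriv i \<psi> x\<bar>" for x
  proof -
    obtain d where d: "(smooth_truncate a b \<epsilon> has_real_derivative d) (at (\<psi> x))" "\<bar>d\<bar> \<le> 1"
      using smooth_truncate_deriv[OF assms(2)] by blast
    then show ?thesis
      using partial_deriv_compose(1)[OF test_fun_differentiable[OF assms(3)] d(1)]
      by (simp add: abs_mult mult_left_le_one_le)
  qed
  with t show "L2_norm \<Omega> (\<lambda>x. (\<chi> i. partial_deriv i (\<lambda>x. smooth_truncate a b \<epsilon> (\<psi> x)) x) $ i)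
      \<le> L2_norm \<Omega> (\<lambda>x. (\<chi> i. partial_deriv i \<psi> x) $ i)"
    by (auto intro!: L2_norm_mono L2_fun_measurable)
qed

section \<open>Eigenfunction expansions\<close>

locale elliptic_eigenbasis =
  fixes \<Omega> :: "(real ^ 'n) set" and A :: "real ^ 'n \<Rightarrow> real ^ 'n ^ 'n"
    and \<mu> :: "nat \<Rightarrow> real" and \<phi> :: "nat \<Rightarrow> real ^ 'n \<Rightarrow> real"
  assumes open_dom: "open \<Omega>" and bounded_dom: "bounded \<Omega>"
    and elliptic: "elliptic_coefficient \<Omega> A" and eigenbasis: "eigenbasis \<Omega> A \<mu> \<phi>"
begin

abbreviation coef :: "(real ^ 'n \<Rightarrow> real) \<Rightarrow> nat \<Rightarrow> real" where
  "coef w k \<equiv> L2_inner \<Omega> w (\<phi> k)"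

lemma phi_L2: "\<phi> k \<in> L2_fun \<Omega>"
  using eigenbasis by (simp add: eigenbasis_def L2_orthonormal_basis_def)

lemma phi_H10: "\<phi> k \<in> H10 \<Omega>"
  using eigenbasis by (simp add: eigenbasis_def dirichlet_eigen_def)

lemma coef_phi: "coef (\<phi> j) k = (if j = k then 1 else 0)"
  using eigenbasis by (simp add: eigenbasis_def L2_orthonormal_basis_def)

lemma lincomb_L2: "(\<lambda>x. \<Sum>k\<in>I. c k * \<phi> k x) \<in> L2_fun \<Omega>"
  by (intro L2_fun_lincomb phi_L2)

lemma coef_lincomb: "finite I \<Longrightarrow> coef (\<lambda>x. \<Sum>k\<in>I. c k * \<phi> k x) j = (if j \<in> I then c j else 0)"
  by (simp add: L2_inner_lincomb_left phi_L2 coef_phi if_distrib sum.delta' cong: if_cong)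

lemma norm_lincomb: "finite I \<Longrightarrow> (L2_norm \<Omega> (\<lambda>x. \<Sum>k\<in>I. c k * \<phi> k x))\<^sup>2 = (\<Sum>k\<in>I. (c k)\<^sup>2)"
  unfolding L2_norm_sq
  by (subst L2_inner_lincomb_right) (auto simp: phi_L2 lincomb_L2 coef_lincomb power2_eq_square)

lemma partial_sums_tendsto:
  "w \<in> L2_fun \<Omega> \<Longrightarrow> (\<lambda>N. L2_norm \<Omega> (\<lambda>x. w x - (\<Sum>k<N. coef w k * \<phi> k x))) \<longlonglongrightarrow> 0"
  using eigenbasis by (simp add: eigenbasis_def L2_orthonormal_basis_def)

lemma Parseval:
  assumes "v \<in> L2_fun \<Omega>" "w \<in> L2_fun \<Omega>"
  shows "(\<lambda>k. coef v k * coef w k) sums L2_inner \<Omega> v w"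
proof -
  have "(\<lambda>N. L2_inner \<Omega> (\<lambda>x. \<Sum>k<N. coef v k * \<phi> k x) w) \<longlonglongrightarrow> L2_inner \<Omega> v w"
    using assms partial_sums_tendsto by (intro L2_inner_tendsto lincomb_L2) auto
  then show ?thesis
    using assms by (simp add: sums_def L2_inner_lincomb_left phi_L2 L2_inner_commute[of \<Omega> "\<phi> _" w])
qed

lemma coef_sq_summable: "w \<in> L2_fun \<Omega> \<Longrightarrow> summable (\<lambda>k. (coef w k)\<^sup>2)"
  using Parseval[of w w] by (auto simp: power2_eq_square sums_iff)

lemma coef_sq_sum_le:
  assumes "w \<in> L2_fun \<Omega>"
  shows "(\<Sum>k<K. (coef w k)\<^sup>2) \<le> (L2_norm \<Omega> w)\<^sup>2"
  using sum_le_suminf[OF coef_sq_summable[OF assms], of "{..<K}"] Parseval[OF assms assms]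
  by (simp add: power2_eq_square[symmetric] sums_iff L2_norm_sq)

lemma coef_tendsto:
  assumes "\<And>n. f n \<in> L2_fun \<Omega>" "w \<in> L2_fun \<Omega>" "(\<lambda>n. L2_norm \<Omega> (\<lambda>x. w x - f n x)) \<longlonglongrightarrow> 0"
  shows "(\<lambda>n. coef (f n) k) \<longlonglongrightarrow> coef w k"
  by (rule L2_inner_tendsto[OF assms(1,2) phi_L2 assms(3)])

text \<open>One weak gradient per eigenfunction is fixed by choice; the eigenvalue equation then
  holds against every weak gradient V of every v in \<open>H10\<close>.\<close>

lemma eigen_gradients:
  obtains G where "\<And>k. has_weak_gradient \<Omega> (\<phi> k) (G k)"
    "\<And>k v V. v \<in> H10 \<Omega> \<Longrightarrow> has_weak_gradient \<Omega> v V \<Longrightarrow> energy \<Omega> A (G k) V = \<mu> k * coef v k"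
proof -
  have "\<forall>k. \<exists>G. has_weak_gradient \<Omega> (\<phi> k) G \<and>
      (\<forall>v \<in> H10 \<Omega>. \<forall>V. has_weak_gradient \<Omega> v V \<longrightarrow> energy \<Omega> A G V = \<mu> k * L2_inner \<Omega> (\<phi> k) v)"
    using eigenbasis by (simp add: eigenbasis_def dirichlet_eigen_def energy_def)
  from choice[OF this] obtain G where "\<forall>k. has_weak_gradient \<Omega> (\<phi> k) (G k) \<and>
      (\<forall>v \<in> H10 \<Omega>. \<forall>V. has_weak_gradient \<Omega> v V \<longrightarrow> energy \<Omega> A (G k) V = \<mu> k * L2_inner \<Omega> (\<phi> k) v)" ..
  then show thesis by (intro that[of G]) (auto simp: L2_inner_commute[of \<Omega> _ "\<phi> _"])
qed

text \<open>The gradients of the eigenfunctions are orthogonal for the energy form, with squares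
  \<mu> k, so this is Bessel's inequality there. The constant is the upper bound of the energy in
  terms of the unweighted norm.\<close>

lemma energy_Bessel:
  obtains B where "0 \<le> B"
    "\<And>v V K. v \<in> H10 \<Omega> \<Longrightarrow> has_weak_gradient \<Omega> v V \<Longrightarrow> (\<Sum>k<K. \<mu> k * (coef v k)\<^sup>2) \<le> B * L2_vec_sq \<Omega> V"
proof -
  obtain G where G: "\<And>k. has_weak_gradient \<Omega> (\<phi> k) (G k)"
    and e: "\<And>k v V. v \<in> H10 \<Omega> \<Longrightarrow> has_weak_gradient \<Omega> v V \<Longrightarrow> energy \<Omega> A (G k) V = \<mu> k * coef v k"
    by (rule eigen_gradients) blast
  obtain \<alpha> B where B: "0 < \<alpha>" "0 \<le> B"
    "\<And>V. V \<in> L2_vec \<Omega> \<Longrightarrow> \<alpha> * L2_vec_sq \<Omega> V \<le> energy \<Omega> A V V"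
    "\<And>V. V \<in> L2_vec \<Omega> \<Longrightarrow> energy \<Omega> A V V \<le> B * L2_vec_sq \<Omega> V"
    by (rule energy_bounds[OF elliptic]) blast
  have GL: "G k \<in> L2_vec \<Omega>" for k by (rule has_weak_gradient_L2_vec[OF G])
  have ee: "energy \<Omega> A (G k) (G j) = (if k = j then \<mu> k else 0)" for k j
    using e[OF phi_H10 G, of k j] by (simp add: coef_phi)
  show thesis
  proof (rule that[OF B(2)])
    fix v V K assume v: "v \<in> H10 \<Omega>" and hV: "has_weak_gradient \<Omega> v V"
    have V: "V \<in> L2_vec \<Omega>" by (rule has_weak_gradient_L2_vec[OF hV])
    \<comment> \<open>The energy-orthogonal projection of V onto the span of the first K gradients:
      both \<open>energy (G k) V\<close> and \<open>coef v k\<close> times the energy of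
      \<open>G k\<close> equal \<open>\<mu> k * coef v k\<close>.\<close>
    define S where "S = (\<lambda>x. \<Sum>k<K. coef v k *\<^sub>R G k x)"
    have S: "S \<in> L2_vec \<Omega>" unfolding S_def by (intro L2_vec_lincomb GL)
    have D: "(\<lambda>x. V x - S x) \<in> L2_vec \<Omega>" using V S by (rule L2_vec_diff)
    have SW: "energy \<Omega> A S W = (\<Sum>k<K. coef v k * energy \<Omega> A (G k) W)" if "W \<in> L2_vec \<Omega>" for W
      unfolding S_def using elliptic GL that by (rule energy_lincomb_left)
    have SV: "energy \<Omega> A S V = (\<Sum>k<K. \<mu> k * (coef v k)\<^sup>2)"
      unfolding SW[OF V] e[OF v hV] by (simp add: power2_eq_square mult_ac)
    have "energy \<Omega> A (G k) S = \<mu> k * coef v k" if "k < K" for k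
      using that unfolding energy_commute[OF elliptic GL S] SW[OF GL] ee
      by (simp add: if_distrib sum.delta cong: if_cong)
    then have SS: "energy \<Omega> A S S = (\<Sum>k<K. \<mu> k * (coef v k)\<^sup>2)"
      unfolding SW[OF S] by (simp add: power2_eq_square mult_ac)
    have "0 \<le> \<alpha> * L2_vec_sq \<Omega> (\<lambda>x. V x - S x)"
      using B(1) by (simp add: L2_vec_sq_def sum_nonneg)
    also have "\<dots> \<le> energy \<Omega> A (\<lambda>x. V x - S x) (\<lambda>x. V x - S x)"
      by (rule B(3)[OF D])
    also have "\<dots> = energy \<Omega> A V V - energy \<Omega> A S V - (energy \<Omega> A V S - energy \<Omega> A S S)"
      using energy_diff_left[OF elliptic V S D] energy_commute[OF elliptic D V] energy_commute[OF elliptic D S]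
        energy_diff_left[OF elliptic V S V] energy_diff_left[OF elliptic V S S] by linarith
    also have "\<dots> = energy \<Omega> A V V - (\<Sum>k<K. \<mu> k * (coef v k)\<^sup>2)"
      using energy_commute[OF elliptic V S] SV SS by simp
    finally show "(\<Sum>k<K. \<mu> k * (coef v k)\<^sup>2) \<le> B * L2_vec_sq \<Omega> V"
      using B(4)[OF V] by simp
  qed
qed

text \<open>The counterpart of Bessel's inequality: finite spectral sums are reached by test
  functions whose gradients are controlled by the spectral norm of order 1. The constant is the
  reciprocal of the ellipticity constant.\<close>

lemma lincomb_approx:
  obtains C where "0 < C"
    "\<And>I c. finite I \<Longrightarrow> \<exists>\<psi> e. (\<forall>n. \<psi> n \<in> test_fun \<Omega>) \<and>
      (\<lambda>n. L2_norm \<Omega> (\<lambda>x. (\<Sum>k\<in>I. c k * \<phi> k x) - \<psi> n x)) \<longlonglongrightarrow> 0 \<and>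
      (\<lambda>n. L2_vec_sq \<Omega> (\<lambda>x. \<chi> i. partial_deriv i (\<psi> n) x)) \<longlonglongrightarrow> e \<and> e \<le> C * (\<Sum>k\<in>I. \<mu> k * (c k)\<^sup>2)"
proof -
  obtain G where G: "\<And>k. has_weak_gradient \<Omega> (\<phi> k) (G k)"
    and e: "\<And>k v V. v \<in> H10 \<Omega> \<Longrightarrow> has_weak_gradient \<Omega> v V \<Longrightarrow> energy \<Omega> A (G k) V = \<mu> k * coef v k"
    by (rule eigen_gradients) blast
  obtain \<alpha> B where \<alpha>: "0 < \<alpha>" "0 \<le> B"
    "\<And>V. V \<in> L2_vec \<Omega> \<Longrightarrow> \<alpha> * L2_vec_sq \<Omega> V \<le> energy \<Omega> A V V"
    "\<And>V. V \<in> L2_vec \<Omega> \<Longrightarrow> energy \<Omega> A V V \<le> B * L2_vec_sq \<Omega> V"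
    by (rule energy_bounds[OF elliptic]) blast
  have GL: "G k \<in> L2_vec \<Omega>" for k by (rule has_weak_gradient_L2_vec[OF G])
  have ee: "energy \<Omega> A (G k) (G j) = (if k = j then \<mu> k else 0)" for k j
    using e[OF phi_H10 G, of k j] by (simp add: coef_phi)
  show thesis
  proof (rule that[of "1 / \<alpha>"])
    show "0 < 1 / \<alpha>" using \<alpha>(1) by simp
    fix I :: "nat set" and c :: "nat \<Rightarrow> real" assume I: "finite I"
    define S where "S = (\<lambda>x. \<Sum>k\<in>I. c k *\<^sub>R G k x)"
    have S: "S \<in> L2_vec \<Omega>" unfolding S_def by (intro L2_vec_lincomb GL)
    have SW: "energy \<Omega> A S W = (\<Sum>k\<in>I. c k * energy \<Omega> A (G k) W)" if "W \<in> L2_vec \<Omega>" for W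
      unfolding S_def using elliptic GL that by (rule energy_lincomb_left)
    have "energy \<Omega> A (G k) S = \<mu> k * c k" if "k \<in> I" for k
      using that I unfolding energy_commute[OF elliptic GL S] SW[OF GL] ee
      by (simp add: if_distrib sum.delta cong: if_cong)
    then have SS: "energy \<Omega> A S S = (\<Sum>k\<in>I. \<mu> k * (c k)\<^sup>2)"
      unfolding SW[OF S] by (simp add: power2_eq_square mult_ac)
    have le: "L2_vec_sq \<Omega> S \<le> 1 / \<alpha> * (\<Sum>k\<in>I. \<mu> k * (c k)\<^sup>2)"
      using \<alpha>(3)[OF S] \<alpha>(1) SS by (simp add: field_simps)
    have wg: "has_weak_gradient \<Omega> (\<lambda>x. \<Sum>k\<in>I. c k * \<phi> k x) S"
      unfolding S_def by (rule has_weak_gradient_lincomb[OF open_dom G])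
    obtain \<psi> e where "\<And>n. \<psi> n \<in> test_fun \<Omega>"
      "(\<lambda>n. L2_norm \<Omega> (\<lambda>x. (\<Sum>k\<in>I. c k * \<phi> k x) - \<psi> n x)) \<longlonglongrightarrow> 0"
      "(\<lambda>n. L2_vec_sq \<Omega> (\<lambda>x. \<chi> i. partial_deriv i (\<psi> n) x)) \<longlonglongrightarrow> e" "e \<le> L2_vec_sq \<Omega> S"
      by (rule H10_lincomb_approx[OF open_dom I phi_H10 wg]) blast
    with le show "\<exists>\<psi> e. (\<forall>n. \<psi> n \<in> test_fun \<Omega>) \<and>
      (\<lambda>n. L2_norm \<Omega> (\<lambda>x. (\<Sum>k\<in>I. c k * \<phi> k x) - \<psi> n x)) \<longlonglongrightarrow> 0 \<and>
      (\<lambda>n. L2_vec_sq \<Omega> (\<lambda>x. \<chi> i. partial_deriv i (\<psi> n) x)) \<longlonglongrightarrow> e \<and> e \<le> 1 / \<alpha> * (\<Sum>k\<in>I. \<mu> k * (c k)\<^sup>2)"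
      by (intro exI[of _ \<psi>] exI[of _ e]) auto
  qed
qed

text \<open>Rayleigh quotient bound: the Poincare inequality passes from approximating test
  functions to the normalised eigenfunctions. The eigenvalues are not ordered, so a bound uniform in
  k is proved instead of a bound on a first one; it underlies the inclusions between spectral spaces
  and the continuity of the solution operator.\<close>

lemma eigenvalues_bounded_below: "\<exists>m>0. \<forall>k. m \<le> \<mu> k"
proof -
  obtain C where C: "0 < C" and ap: "\<And>I c. finite I \<Longrightarrow> \<exists>\<psi> e. (\<forall>n. \<psi> n \<in> test_fun \<Omega>) \<and>
      (\<lambda>n. L2_norm \<Omega> (\<lambda>x. (\<Sum>k\<in>I. c k * \<phi> k x) - \<psi> n x)) \<longlonglongrightarrow> 0 \<and>
      (\<lambda>n. L2_vec_sq \<Omega> (\<lambda>x. \<chi> i. partial_deriv i (\<psi> n) x)) \<longlonglongrightarrow> e \<and> e \<le> C * (\<Sum>k\<in>I. \<mu> k * (c k)\<^sup>2)"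
    by (rule lincomb_approx) blast
  obtain R where R: "0 < R" "\<And>x. x \<in> \<Omega> \<Longrightarrow> norm x \<le> R"
    using bounded_dom[unfolded bounded_pos] by auto
  \<comment> \<open>In the limit 1 = ||\<phi> k||^2 is at most (2 R)^2 e, and e is at most C \<mu>
    k.\<close>
  have "1 / (4 * R\<^sup>2 * C) \<le> \<mu> k" for k
  proof -
    from ap[of "{k}" "\<lambda>_. 1"] obtain \<psi> e where \<psi>: "\<And>n. \<psi> n \<in> test_fun \<Omega>"
      "(\<lambda>n. L2_norm \<Omega> (\<lambda>x. \<phi> k x - \<psi> n x)) \<longlonglongrightarrow> 0"
      "(\<lambda>n. L2_vec_sq \<Omega> (\<lambda>x. \<chi> i. partial_deriv i (\<psi> n) x)) \<longlonglongrightarrow> e" "e \<le> C * \<mu> k"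
      by auto
    have "(\<lambda>n. L2_norm \<Omega> (\<psi> n)) \<longlonglongrightarrow> L2_norm \<Omega> (\<phi> k)"
      using \<psi> phi_L2 test_fun_L2[OF open_dom] by (intro L2_norm_tendsto) auto
    then have "(\<lambda>n. (L2_norm \<Omega> (\<psi> n))\<^sup>2) \<longlonglongrightarrow> (L2_norm \<Omega> (\<phi> k))\<^sup>2"
      by (rule tendsto_power)
    then have lim: "(\<lambda>n. (L2_norm \<Omega> (\<psi> n))\<^sup>2) \<longlonglongrightarrow> 1"
      by (simp add: L2_norm_sq[of \<Omega> "\<phi> k"] coef_phi)
    have "(L2_norm \<Omega> (\<psi> n))\<^sup>2 \<le> (2 * R)\<^sup>2 * L2_vec_sq \<Omega> (\<lambda>x. \<chi> i. partial_deriv i (\<psi> n) x)" for n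
    proof -
      \<comment> \<open>The Poincare inequality holds with any single direction, so an arbitrary
        coordinate is taken.\<close>
      fix i :: 'n
      have "(L2_norm \<Omega> (\<psi> n))\<^sup>2 \<le> (2 * R * L2_norm \<Omega> (partial_deriv i (\<psi> n)))\<^sup>2"
        using R by (intro power_mono Poincare_inequality open_dom \<psi> L2_norm_nonneg) auto
      also have "\<dots> = (2 * R)\<^sup>2 * (L2_norm \<Omega> (partial_deriv i (\<psi> n)))\<^sup>2"
        by (simp add: power_mult_distrib)
      also have "\<dots> \<le> (2 * R)\<^sup>2 * L2_vec_sq \<Omega> (\<lambda>x. \<chi> i. partial_deriv i (\<psi> n) x)"
        unfolding L2_vec_sq_def
        using member_le_sum[of i UNIV "\<lambda>i. (L2_norm \<Omega> (partial_deriv i (\<psi> n)))\<^sup>2"]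
        by (intro mult_left_mono) auto
      finally show ?thesis .
    qed
    then have "1 \<le> (2 * R)\<^sup>2 * e"
      by (intro LIMSEQ_le[OF lim tendsto_mult_left[OF \<psi>(3)]]) auto
    also have "\<dots> \<le> (2 * R)\<^sup>2 * (C * \<mu> k)"
      using \<psi>(4) by (intro mult_left_mono) auto
    finally show ?thesis
      using R(1) C by (simp add: field_simps power_mult_distrib)
  qed
  moreover have "0 < 1 / (4 * R\<^sup>2 * C)" using R(1) C by simp
  ultimately show ?thesis by blast
qed

lemma eigenvalue_pos: "0 < \<mu> k"
  using eigenvalues_bounded_below by (meson less_le_trans)

section \<open>Truncation in the spectral spaces\<close>

lemma const_L2: "(\<lambda>x. c) \<in> L2_fun \<Omega>"
proof -
  have "\<Omega> \<in> lmeasurable"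
    using open_dom bounded_dom by (simp add: bounded_set_imp_lmeasurable)
  then interpret finite_measure "lebesgue_on \<Omega>"
    by (rule finite_measure_lebesgue_on)
  show ?thesis by (simp add: L2_fun_def)
qed

lemma L2_norm_le_const:
  assumes "f \<in> L2_fun \<Omega>" "\<And>x. \<bar>f x\<bar> \<le> \<epsilon>"
  shows "L2_norm \<Omega> f \<le> \<epsilon> * L2_norm \<Omega> (\<lambda>x. 1)"
proof -
  have "0 \<le> \<epsilon>" using assms(2)[of undefined] by linarith
  have "L2_norm \<Omega> f \<le> L2_norm \<Omega> (\<lambda>x. \<epsilon> * 1)"
    using assms by (intro L2_norm_mono L2_fun_measurable const_L2)
      (auto intro: order_trans[OF _ abs_ge_self])
  also have "\<dots> = \<epsilon> * L2_norm \<Omega> (\<lambda>x. 1)"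
    using \<open>0 \<le> \<epsilon>\<close> by (simp only: L2_norm_scale abs_of_nonneg)
  finally show ?thesis .
qed

text \<open>The endpoint of order 1. Bessel's inequality is applied to smoothed truncations of
  approximating test functions, with the smoothing parameter tending to 0 along the
  approximation.\<close>

lemma truncate_lincomb_energy:
  obtains C where "0 \<le> C" "\<And>a b I c K. a \<le> 0 \<Longrightarrow> 0 \<le> b \<Longrightarrow> finite I \<Longrightarrow>
    (\<Sum>k<K. \<mu> k * (coef (\<lambda>x. truncate a b (\<Sum>k\<in>I. c k * \<phi> k x)) k)\<^sup>2) \<le> C * (\<Sum>k\<in>I. \<mu> k * (c k)\<^sup>2)"
proof -
  obtain C where C: "0 < C" and ap: "\<And>I c. finite I \<Longrightarrow> \<exists>\<psi> e. (\<forall>n. \<psi> n \<in> test_fun \<Omega>) \<and>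
      (\<lambda>n. L2_norm \<Omega> (\<lambda>x. (\<Sum>k\<in>I. c k * \<phi> k x) - \<psi> n x)) \<longlonglongrightarrow> 0 \<and>
      (\<lambda>n. L2_vec_sq \<Omega> (\<lambda>x. \<chi> i. partial_deriv i (\<psi> n) x)) \<longlonglongrightarrow> e \<and> e \<le> C * (\<Sum>k\<in>I. \<mu> k * (c k)\<^sup>2)"
    by (rule lincomb_approx) blast
  obtain B where B: "0 \<le> B"
    "\<And>v V K. v \<in> H10 \<Omega> \<Longrightarrow> has_weak_gradient \<Omega> v V \<Longrightarrow> (\<Sum>k<K. \<mu> k * (coef v k)\<^sup>2) \<le> B * L2_vec_sq \<Omega> V"
    by (rule energy_Bessel) blast
  show thesis
  proof (rule that[of "B * C"])
    show "0 \<le> B * C" using B(1) C by simp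
    fix a b :: real and I :: "nat set" and c :: "nat \<Rightarrow> real" and K :: nat
    assume ab: "a \<le> 0" "0 \<le> b" and I: "finite I"
    let ?v = "\<lambda>x. \<Sum>k\<in>I. c k * \<phi> k x"
    let ?T = "\<lambda>x. truncate a b (?v x)"
    obtain \<psi> e where \<psi>: "\<And>n. \<psi> n \<in> test_fun \<Omega>" "(\<lambda>n. L2_norm \<Omega> (\<lambda>x. ?v x - \<psi> n x)) \<longlonglongrightarrow> 0"
      "(\<lambda>n. L2_vec_sq \<Omega> (\<lambda>x. \<chi> i. partial_deriv i (\<psi> n) x)) \<longlonglongrightarrow> e" "e \<le> C * (\<Sum>k\<in>I. \<mu> k * (c k)\<^sup>2)"
      using ap[OF I] by blast
    define h where "h = (\<lambda>n. inverse (real (Suc n)))"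
    have h: "0 < h n" for n by (simp add: h_def)
    have h0: "h \<longlonglongrightarrow> 0" unfolding h_def by (rule LIMSEQ_inverse_real_of_nat)
    define f where "f = (\<lambda>n x. smooth_truncate a b (h n) (\<psi> n x))"
    have ft: "f n \<in> test_fun \<Omega>" for n
      unfolding f_def using h \<psi>(1) by (rule smooth_truncate_test_fun)
    have L: "f n \<in> L2_fun \<Omega>" "\<psi> n \<in> L2_fun \<Omega>" "(\<lambda>x. truncate a b (\<psi> n x)) \<in> L2_fun \<Omega>"
      "?v \<in> L2_fun \<Omega>" "?T \<in> L2_fun \<Omega>" for n
      by (intro truncate_L2 ab lincomb_L2 test_fun_L2[OF open_dom ft] test_fun_L2[OF open_dom \<psi>(1)])+
    have "(\<lambda>n. L2_norm \<Omega> (\<lambda>x. ?T x - f n x)) \<longlonglongrightarrow> 0"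
    proof (rule Lim_null_comparison)
      have le: "L2_norm \<Omega> (\<lambda>x. ?T x - f n x) \<le> L2_norm \<Omega> (\<lambda>x. ?v x - \<psi> n x) + h n * L2_norm \<Omega> (\<lambda>x. 1)" for n
      proof -
        have "L2_norm \<Omega> (\<lambda>x. ?T x - f n x) \<le> L2_norm \<Omega> (\<lambda>x. ?T x - truncate a b (\<psi> n x)) +
            L2_norm \<Omega> (\<lambda>x. truncate a b (\<psi> n x) - f n x)"
          by (rule L2_norm_triangle_sub[OF L(5,3,1)])
        moreover have "L2_norm \<Omega> (\<lambda>x. ?T x - truncate a b (\<psi> n x)) \<le> L2_norm \<Omega> (\<lambda>x. ?v x - \<psi> n x)"
          by (rule truncate_L2_contraction[OF ab L(4,2)])
        moreover have "L2_norm \<Omega> (\<lambda>x. truncate a b (\<psi> n x) - f n x) \<le> h n * L2_norm \<Omega> (\<lambda>x. 1)"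
          using smooth_truncate_dist[OF h ab, of n] L2_fun_diff[OF L(3,1)]
          by (intro L2_norm_le_const) (auto simp: f_def abs_minus_commute)
        ultimately show ?thesis by linarith
      qed
      then show "\<forall>\<^sub>F n in sequentially. norm (L2_norm \<Omega> (\<lambda>x. ?T x - f n x)) \<le>
          L2_norm \<Omega> (\<lambda>x. ?v x - \<psi> n x) + h n * L2_norm \<Omega> (\<lambda>x. 1)"
        by (simp add: L2_norm_nonneg)
      show "(\<lambda>n. L2_norm \<Omega> (\<lambda>x. ?v x - \<psi> n x) + h n * L2_norm \<Omega> (\<lambda>x. 1)) \<longlonglongrightarrow> 0"
        using tendsto_add[OF \<psi>(2) tendsto_mult_right[OF h0]] by simp
    qed
    then have "(\<lambda>n. coef (f n) k) \<longlonglongrightarrow> coef ?T k" for k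
      using L by (intro coef_tendsto)
    \<comment> \<open>K is fixed, so convergence of each coefficient suffices; this takes the place
      of weak lower semicontinuity of the energy.\<close>
    then have lim: "(\<lambda>n. \<Sum>k<K. \<mu> k * (coef (f n) k)\<^sup>2) \<longlonglongrightarrow> (\<Sum>k<K. \<mu> k * (coef ?T k)\<^sup>2)"
      by (intro tendsto_intros)
    have "(\<Sum>k<K. \<mu> k * (coef (f n) k)\<^sup>2) \<le> B * L2_vec_sq \<Omega> (\<lambda>x. \<chi> i. partial_deriv i (\<psi> n) x)" for n
    proof -
      have "(\<Sum>k<K. \<mu> k * (coef (f n) k)\<^sup>2) \<le> B * L2_vec_sq \<Omega> (\<lambda>x. \<chi> i. partial_deriv i (f n) x)"
        by (intro B(2) test_fun_H10 test_fun_weak_gradient open_dom ft)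
      also have "\<dots> \<le> B * L2_vec_sq \<Omega> (\<lambda>x. \<chi> i. partial_deriv i (\<psi> n) x)"
        unfolding f_def by (intro mult_left_mono smooth_truncate_L2_vec_sq open_dom h \<psi> B(1))
      finally show ?thesis .
    qed
    then have "(\<Sum>k<K. \<mu> k * (coef ?T k)\<^sup>2) \<le> B * e"
      by (intro LIMSEQ_le[OF lim tendsto_mult_left[OF \<psi>(3)]]) auto
    also have "\<dots> \<le> B * (C * (\<Sum>k\<in>I. \<mu> k * (c k)\<^sup>2))"
      using \<psi>(4) B(1) by (intro mult_left_mono)
    finally show "(\<Sum>k<K. \<mu> k * (coef ?T k)\<^sup>2) \<le> B * C * (\<Sum>k\<in>I. \<mu> k * (c k)\<^sup>2)"
      by (simp add: mult.assoc)
  qed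
qed

text \<open>Splitting at the frequency \<open>\<Lambda>\<close>: the weight \<open>min (\<mu> k) \<Lambda>\<close> is \<open>\<mu> k\<close> on the low modes, handled by
  the energy estimate, and \<open>\<Lambda>\<close> on the high modes, handled by the contraction property in \<open>L\<^sup>2\<close>.\<close>

lemma truncate_lincomb_min:
  obtains C where "0 \<le> C" "\<And>a b \<Lambda> c N K. a \<le> 0 \<Longrightarrow> 0 \<le> b \<Longrightarrow> 0 \<le> \<Lambda> \<Longrightarrow>
    (\<Sum>k<K. min (\<mu> k) \<Lambda> * (coef (\<lambda>x. truncate a b (\<Sum>k<N. c k * \<phi> k x)) k)\<^sup>2)
      \<le> C * (\<Sum>k<N. min (\<mu> k) \<Lambda> * (c k)\<^sup>2)"
proof -
  obtain C where C: "0 \<le> C" and bd: "\<And>a b I c K. a \<le> 0 \<Longrightarrow> 0 \<le> b \<Longrightarrow> finite I \<Longrightarrow>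
    (\<Sum>k<K. \<mu> k * (coef (\<lambda>x. truncate a b (\<Sum>k\<in>I. c k * \<phi> k x)) k)\<^sup>2) \<le> C * (\<Sum>k\<in>I. \<mu> k * (c k)\<^sup>2)"
    by (rule truncate_lincomb_energy) blast
  show thesis
  proof (rule that[of "2 + 2 * C"])
    show "0 \<le> 2 + 2 * C" using C by simp
    fix a b \<Lambda> :: real and c :: "nat \<Rightarrow> real" and N K :: nat
    assume ab: "a \<le> 0" "0 \<le> b" and \<Lambda>: "0 \<le> \<Lambda>"
    \<comment> \<open>The modes are split by the size of \<mu> k and not by index, since the
      eigenvalues come in no particular order.\<close>
    define I J where "I = {k. k < N \<and> \<mu> k \<le> \<Lambda>}" and "J = {k. k < N \<and> \<Lambda> < \<mu> k}"
    have IJ: "{..<N} = I \<union> J" "I \<inter> J = {}" "finite I" "finite J" by (auto simp: I_def J_def)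
    define w v where "w = (\<lambda>x. \<Sum>k<N. c k * \<phi> k x)" and "v = (\<lambda>x. \<Sum>k\<in>I. c k * \<phi> k x)"
    have wv: "w x - v x = (\<Sum>k\<in>J. c k * \<phi> k x)" for x
      by (simp add: w_def v_def IJ sum.union_disjoint)
    define T where "T = (\<lambda>(f :: real ^ 'n \<Rightarrow> real) x. truncate a b (f x))"
    have L: "w \<in> L2_fun \<Omega>" "v \<in> L2_fun \<Omega>" "T w \<in> L2_fun \<Omega>" "T v \<in> L2_fun \<Omega>"
      by (auto simp: w_def v_def T_def intro!: lincomb_L2 truncate_L2 ab)
    have "(\<Sum>k<K. min (\<mu> k) \<Lambda> * (coef (T w) k)\<^sup>2)
        \<le> (\<Sum>k<K. 2 * \<Lambda> * (coef (\<lambda>x. T w x - T v x) k)\<^sup>2 + 2 * (\<mu> k * (coef (T v) k)\<^sup>2))"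
    proof (rule sum_mono)
      fix k
      let ?d = "coef (\<lambda>x. T w x - T v x) k" and ?t = "coef (T v) k"
      have "coef (T w) k = ?d + ?t" using L phi_L2 by (simp add: L2_inner_diff_left)
      then have "(coef (T w) k)\<^sup>2 \<le> 2 * ?d\<^sup>2 + 2 * ?t\<^sup>2"
        using sum_squares_bound[of ?d ?t] by (simp add: power2_sum)
      then have "min (\<mu> k) \<Lambda> * (coef (T w) k)\<^sup>2 \<le> min (\<mu> k) \<Lambda> * (2 * ?d\<^sup>2 + 2 * ?t\<^sup>2)"
        using eigenvalue_pos[of k] \<Lambda> by (intro mult_left_mono) auto
      also have "\<dots> = min (\<mu> k) \<Lambda> * (2 * ?d\<^sup>2) + min (\<mu> k) \<Lambda> * (2 * ?t\<^sup>2)"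
        by (simp add: algebra_simps)
      \<comment> \<open>The minimum is estimated by a different argument in each term: by \<Lambda>
        for the difference, measured in L2, and by \<mu> k for the truncated low modes, measured in
        energy.\<close>
      also have "\<dots> \<le> \<Lambda> * (2 * ?d\<^sup>2) + \<mu> k * (2 * ?t\<^sup>2)"
        by (intro add_mono mult_right_mono) auto
      finally show "min (\<mu> k) \<Lambda> * (coef (T w) k)\<^sup>2 \<le> 2 * \<Lambda> * ?d\<^sup>2 + 2 * (\<mu> k * ?t\<^sup>2)" by simp
    qed
    also have "\<dots> = 2 * \<Lambda> * (\<Sum>k<K. (coef (\<lambda>x. T w x - T v x) k)\<^sup>2) + 2 * (\<Sum>k<K. \<mu> k * (coef (T v) k)\<^sup>2)"
      by (simp add: sum.distrib sum_distrib_left)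
    also have "\<dots> \<le> 2 * \<Lambda> * (\<Sum>k\<in>J. (c k)\<^sup>2) + 2 * (C * (\<Sum>k\<in>I. \<mu> k * (c k)\<^sup>2))"
    proof (intro add_mono mult_left_mono)
      have "(\<Sum>k<K. (coef (\<lambda>x. T w x - T v x) k)\<^sup>2) \<le> (L2_norm \<Omega> (\<lambda>x. T w x - T v x))\<^sup>2"
        by (intro coef_sq_sum_le L2_fun_diff L)
      also have "\<dots> \<le> (L2_norm \<Omega> (\<lambda>x. w x - v x))\<^sup>2"
        unfolding T_def by (intro power_mono truncate_L2_contraction ab L L2_norm_nonneg)
      also have "\<dots> = (\<Sum>k\<in>J. (c k)\<^sup>2)"
        unfolding wv by (rule norm_lincomb[OF IJ(4)])
      finally show "(\<Sum>k<K. (coef (\<lambda>x. T w x - T v x) k)\<^sup>2) \<le> (\<Sum>k\<in>J. (c k)\<^sup>2)" .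
      show "(\<Sum>k<K. \<mu> k * (coef (T v) k)\<^sup>2) \<le> C * (\<Sum>k\<in>I. \<mu> k * (c k)\<^sup>2)"
        unfolding T_def v_def by (rule bd[OF ab IJ(3)])
    qed (use \<Lambda> in auto)
    also have "\<dots> = 2 * (\<Sum>k\<in>J. min (\<mu> k) \<Lambda> * (c k)\<^sup>2) + 2 * C * (\<Sum>k\<in>I. min (\<mu> k) \<Lambda> * (c k)\<^sup>2)"
      by (simp add: I_def J_def sum_distrib_left mult.assoc)
    also have "\<dots> \<le> (2 + 2 * C) * (\<Sum>k\<in>J. min (\<mu> k) \<Lambda> * (c k)\<^sup>2) + (2 + 2 * C) * (\<Sum>k\<in>I. min (\<mu> k) \<Lambda> * (c k)\<^sup>2)"
      using C \<Lambda> eigenvalue_pos by (intro add_mono mult_right_mono sum_nonneg mult_nonneg_nonneg) (auto intro: less_imp_le)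
    also have "\<dots> = (2 + 2 * C) * (\<Sum>k<N. min (\<mu> k) \<Lambda> * (c k)\<^sup>2)"
      using IJ by (simp add: sum.union_disjoint algebra_simps)
    finally show "(\<Sum>k<K. min (\<mu> k) \<Lambda> * (coef (\<lambda>x. truncate a b (\<Sum>k<N. c k * \<phi> k x)) k)\<^sup>2)
      \<le> (2 + 2 * C) * (\<Sum>k<N. min (\<mu> k) \<Lambda> * (c k)\<^sup>2)"
      by (simp only: T_def w_def)
  qed
qed

end

text \<open>The integrand is \<open>\<Lambda> powr (r - 1)\<close> below \<mu> and
  \<open>\<mu> * \<Lambda> powr (r - 2)\<close> above. Convergence at 0 uses r > 0 and gives 1 / r;
  convergence at infinity uses r < 1 and gives 1 / (1 - r).\<close>

lemma min_powr_has_integral: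
  fixes \<mu> r :: real
  assumes "0 < \<mu>" "0 < r" "r < 1"
  shows "((\<lambda>\<Lambda>. min \<mu> \<Lambda> * \<Lambda> powr (r - 2)) has_integral (1 / r + 1 / (1 - r)) * \<mu> powr r) {0..}"
proof -
  have "((\<lambda>\<Lambda>. \<Lambda> powr (r - 1)) has_integral (\<mu> powr r / r)) {0..\<mu>}"
    using has_integral_powr_from_0[of "r - 1" \<mu>] assms by simp
  then have 1: "((\<lambda>\<Lambda>. min \<mu> \<Lambda> * \<Lambda> powr (r - 2)) has_integral (\<mu> powr r / r)) {0..\<mu>}"
  proof (rule has_integral_eq[rotated])
    fix \<Lambda> assume "\<Lambda> \<in> {0..\<mu>}"
    then show "\<Lambda> powr (r - 1) = min \<mu> \<Lambda> * \<Lambda> powr (r - 2)"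
      using powr_mult_base[of \<Lambda> "r - 2"] by simp
  qed
  have "((\<lambda>\<Lambda>. \<mu> * \<Lambda> powr (r - 2)) has_integral \<mu> * (- (\<mu> powr (r - 1)) / (r - 1))) {\<mu>..}"
    using has_integral_powr_to_inf[of "r - 2" \<mu>] assms by (intro has_integral_mult_right) simp
  moreover have "\<mu> * (- (\<mu> powr (r - 1)) / (r - 1)) = \<mu> powr r / (1 - r)"
    using powr_mult_base[of \<mu> "r - 1"] assms by (simp add: field_simps)
  ultimately have "((\<lambda>\<Lambda>. \<mu> * \<Lambda> powr (r - 2)) has_integral \<mu> powr r / (1 - r)) {\<mu>..}" by simp
  then have 2: "((\<lambda>\<Lambda>. min \<mu> \<Lambda> * \<Lambda> powr (r - 2)) has_integral \<mu> powr r / (1 - r)) {\<mu>..}"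
    by (rule has_integral_eq[rotated]) auto
  have "negligible ({0..\<mu>} \<inter> {\<mu>..})"
    by (rule negligible_subset[of "{\<mu>}"]) auto
  moreover have "{0..\<mu>} \<union> {\<mu>..} = {0..}" using assms(1) by auto
  ultimately show ?thesis
    using has_integral_Un[OF 1 2] by (simp add: algebra_simps)
qed

context elliptic_eigenbasis
begin

text \<open>Integration of the estimate for the weights \<open>min (\<mu> k) \<Lambda>\<close> over
  all \<Lambda>. Its constant does not depend on \<Lambda>, and the factor D produced by the
  integral appears on both sides and cancels.\<close>

lemma truncate_lincomb_powr:
  assumes "0 < r" "r \<le> 1"
  obtains C where "0 \<le> C" "\<And>a b c N K. a \<le> 0 \<Longrightarrow> 0 \<le> b \<Longrightarrow>
    (\<Sum>k<K. \<mu> k powr r * (coef (\<lambda>x. truncate a b (\<Sum>k<N. c k * \<phi> k x)) k)\<^sup>2)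
      \<le> C * (\<Sum>k<N. \<mu> k powr r * (c k)\<^sup>2)"
proof (cases "r = 1")
  case True
  \<comment> \<open>At r = 1 the integral over \<Lambda> diverges, but the energy estimate is
    already the claim.\<close>
  show thesis
    by (rule truncate_lincomb_energy) (use that True eigenvalue_pos in \<open>simp add: less_imp_le\<close>)
next
  case False
  then have r: "0 < r" "r < 1" using assms by auto
  obtain C where C: "0 \<le> C" and bd: "\<And>a b \<Lambda> c N K. a \<le> 0 \<Longrightarrow> 0 \<le> b \<Longrightarrow> 0 \<le> \<Lambda> \<Longrightarrow>
    (\<Sum>k<K. min (\<mu> k) \<Lambda> * (coef (\<lambda>x. truncate a b (\<Sum>k<N. c k * \<phi> k x)) k)\<^sup>2)
      \<le> C * (\<Sum>k<N. min (\<mu> k) \<Lambda> * (c k)\<^sup>2)"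
    by (rule truncate_lincomb_min) blast
  define D where "D = 1 / r + 1 / (1 - r)"
  have D: "0 < D" using r by (simp add: D_def add_pos_pos)
  have int: "((\<lambda>\<Lambda>. (\<Sum>k<M. min (\<mu> k) \<Lambda> * (d k)\<^sup>2) * \<Lambda> powr (r - 2)) has_integral
      D * (\<Sum>k<M. \<mu> k powr r * (d k)\<^sup>2)) {0..}" for M and d :: "nat \<Rightarrow> real"
  proof -
    have "((\<lambda>\<Lambda>. \<Sum>k<M. (d k)\<^sup>2 * (min (\<mu> k) \<Lambda> * \<Lambda> powr (r - 2))) has_integral
      (\<Sum>k<M. (d k)\<^sup>2 * (D * \<mu> k powr r))) {0..}"
      unfolding D_def using r eigenvalue_pos
      by (intro has_integral_sum has_integral_mult_right min_powr_has_integral) auto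
    then show ?thesis by (simp add: sum_distrib_left sum_distrib_right mult_ac)
  qed
  show thesis
  proof (rule that[OF C])
    fix a b :: real and c :: "nat \<Rightarrow> real" and N K :: nat
    assume ab: "a \<le> 0" "0 \<le> b"
    let ?t = "\<lambda>k. coef (\<lambda>x. truncate a b (\<Sum>k<N. c k * \<phi> k x)) k"
    have "D * (\<Sum>k<K. \<mu> k powr r * (?t k)\<^sup>2) \<le> C * (D * (\<Sum>k<N. \<mu> k powr r * (c k)\<^sup>2))"
    proof (rule has_integral_le[OF int has_integral_mult_right[OF int]])
      fix \<Lambda> :: real assume "\<Lambda> \<in> {0..}"
      then have "(\<Sum>k<K. min (\<mu> k) \<Lambda> * (?t k)\<^sup>2) * \<Lambda> powr (r - 2)
          \<le> C * (\<Sum>k<N. min (\<mu> k) \<Lambda> * (c k)\<^sup>2) * \<Lambda> powr (r - 2)"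
        by (intro mult_right_mono bd ab) auto
      then show "(\<Sum>k<K. min (\<mu> k) \<Lambda> * (?t k)\<^sup>2) * \<Lambda> powr (r - 2)
          \<le> C * ((\<Sum>k<N. min (\<mu> k) \<Lambda> * (c k)\<^sup>2) * \<Lambda> powr (r - 2))"
        by (simp add: mult.assoc)
    qed
    then show "(\<Sum>k<K. \<mu> k powr r * (?t k)\<^sup>2) \<le> C * (\<Sum>k<N. \<mu> k powr r * (c k)\<^sup>2)"
      using D by (simp add: mult.left_commute[of C D])
  qed
qed

lemma spectral_space_L2: "w \<in> spectral_space \<Omega> \<mu> \<phi> r \<Longrightarrow> w \<in> L2_fun \<Omega>"
  by (simp add: spectral_space_def)

text \<open>The partial sums of w satisfy the finite estimate with one constant. For fixed K the
  coefficients of their truncations converge by the L2 contraction, and the bound obtained is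
  uniform in K.\<close>

lemma truncate_spectral_space:
  assumes "a \<le> 0" "0 \<le> b" "0 < r" "r \<le> 1" "w \<in> spectral_space \<Omega> \<mu> \<phi> r"
  shows "(\<lambda>x. truncate a b (w x)) \<in> spectral_space \<Omega> \<mu> \<phi> r"
proof -
  obtain C where C: "0 \<le> C" and bd: "\<And>a b c N K. a \<le> 0 \<Longrightarrow> 0 \<le> b \<Longrightarrow>
    (\<Sum>k<K. \<mu> k powr r * (coef (\<lambda>x. truncate a b (\<Sum>k<N. c k * \<phi> k x)) k)\<^sup>2)
      \<le> C * (\<Sum>k<N. \<mu> k powr r * (c k)\<^sup>2)"
    by (rule truncate_lincomb_powr[OF assms(3,4)]) blast
  have w: "w \<in> L2_fun \<Omega>" and sm: "summable (\<lambda>k. \<mu> k powr r * (coef w k)\<^sup>2)"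
    using assms(5) by (auto simp: spectral_space_def)
  let ?w = "\<lambda>N x. \<Sum>k<N. coef w k * \<phi> k x"
  let ?T = "\<lambda>f x. truncate a b (f x :: real)"
  have L: "?T w \<in> L2_fun \<Omega>" "?T (?w N) \<in> L2_fun \<Omega>" for N
    by (intro truncate_L2 assms(1,2) w lincomb_L2)+
  have "(\<lambda>N. L2_norm \<Omega> (\<lambda>x. ?T w x - ?T (?w N) x)) \<longlonglongrightarrow> 0"
    using truncate_L2_contraction[OF assms(1,2) w lincomb_L2]
    by (intro Lim_null_comparison[OF _ partial_sums_tendsto[OF w]]) (simp add: L2_norm_nonneg)
  then have lim: "(\<lambda>N. coef (?T (?w N)) k) \<longlonglongrightarrow> coef (?T w) k" for k
    using L by (intro coef_tendsto)
  have "(\<Sum>k<K. \<mu> k powr r * (coef (?T w) k)\<^sup>2) \<le> C * (\<Sum>k. \<mu> k powr r * (coef w k)\<^sup>2)" for K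
  proof (rule LIMSEQ_le_const2)
    show "(\<lambda>N. \<Sum>k<K. \<mu> k powr r * (coef (?T (?w N)) k)\<^sup>2) \<longlonglongrightarrow> (\<Sum>k<K. \<mu> k powr r * (coef (?T w) k)\<^sup>2)"
      using lim by (intro tendsto_intros)
    have "(\<Sum>k<K. \<mu> k powr r * (coef (?T (?w N)) k)\<^sup>2) \<le> C * (\<Sum>k. \<mu> k powr r * (coef w k)\<^sup>2)" for N
    proof -
      have "(\<Sum>k<K. \<mu> k powr r * (coef (?T (?w N)) k)\<^sup>2) \<le> C * (\<Sum>k<N. \<mu> k powr r * (coef w k)\<^sup>2)"
        by (rule bd[OF assms(1,2)])
      also have "\<dots> \<le> C * (\<Sum>k. \<mu> k powr r * (coef w k)\<^sup>2)"
        using C by (intro mult_left_mono sum_le_suminf sm) auto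
      finally show ?thesis .
    qed
    then show "\<exists>M. \<forall>N\<ge>M. (\<Sum>k<K. \<mu> k powr r * (coef (?T (?w N)) k)\<^sup>2) \<le> C * (\<Sum>k. \<mu> k powr r * (coef w k)\<^sup>2)"
      by blast
  qed
  then have "summable (\<lambda>k. \<mu> k powr r * (coef (?T w) k)\<^sup>2)"
    by (intro summableI_nonneg_bounded) auto
  with L(1) show ?thesis by (simp add: spectral_space_def)
qed

end

context elliptic_eigenbasis
begin

section \<open>The solution operator\<close>

text \<open>The eigenvalues may lie below 1, so the comparison of powers costs the factor
  \<open>m powr (r - r')\<close> with a positive lower bound m of all eigenvalues.\<close>

lemma spectral_space_mono:
  assumes w: "w \<in> spectral_space \<Omega> \<mu> \<phi> r'" and "r \<le> r'"
  shows "w \<in> spectral_space \<Omega> \<mu> \<phi> r"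
proof -
  obtain m where m: "0 < m" "\<And>k. m \<le> \<mu> k" using eigenvalues_bounded_below by blast
  have sm: "summable (\<lambda>k. m powr (r - r') * (\<mu> k powr r' * (coef w k)\<^sup>2))"
    using w by (intro summable_mult) (simp add: spectral_space_def)
  have le: "norm (\<mu> k powr r * (coef w k)\<^sup>2) \<le> m powr (r - r') * (\<mu> k powr r' * (coef w k)\<^sup>2)" for k
  proof -
    have "\<mu> k powr r = \<mu> k powr (r - r') * \<mu> k powr r'"
      by (simp add: powr_add[symmetric])
    also have "\<dots> \<le> m powr (r - r') * \<mu> k powr r'"
      using m assms by (intro mult_right_mono powr_mono2') auto
    finally have "\<mu> k powr r * (coef w k)\<^sup>2 \<le> m powr (r - r') * \<mu> k powr r' * (coef w k)\<^sup>2"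
      by (rule mult_right_mono) simp
    then show ?thesis by (simp add: mult.assoc)
  qed
  have "summable (\<lambda>k. \<mu> k powr r * (coef w k)\<^sup>2)"
    by (rule summable_comparison_test'[OF sm le])
  with w show ?thesis by (simp add: spectral_space_def)
qed

lemma spectral_space_0: "w \<in> L2_fun \<Omega> \<Longrightarrow> w \<in> spectral_space \<Omega> \<mu> \<phi> 0"
  using coef_sq_summable eigenvalue_pos by (simp add: spectral_space_def less_imp_neq[THEN not_sym])

lemma spectral_space_diff:
  assumes "v \<in> spectral_space \<Omega> \<mu> \<phi> r" "w \<in> spectral_space \<Omega> \<mu> \<phi> r"
  shows "(\<lambda>x. v x - w x) \<in> spectral_space \<Omega> \<mu> \<phi> r"
proof -
  have L: "v \<in> L2_fun \<Omega>" "w \<in> L2_fun \<Omega>" using assms spectral_space_L2 by auto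
  have le: "norm (\<mu> k powr r * (coef (\<lambda>x. v x - w x) k)\<^sup>2)
      \<le> 2 * (\<mu> k powr r * (coef v k)\<^sup>2) + 2 * (\<mu> k powr r * (coef w k)\<^sup>2)" for k
  proof -
    have "(coef v k - coef w k)\<^sup>2 \<le> 2 * (coef v k)\<^sup>2 + 2 * (coef w k)\<^sup>2"
      using sum_squares_bound[of "coef v k" "- coef w k"] by (simp add: power2_diff)
    then have "\<mu> k powr r * (coef v k - coef w k)\<^sup>2 \<le> \<mu> k powr r * (2 * (coef v k)\<^sup>2 + 2 * (coef w k)\<^sup>2)"
      by (rule mult_left_mono) simp
    then show ?thesis by (simp add: L2_inner_diff_left L phi_L2 algebra_simps)
  qed
  have sm: "summable (\<lambda>k. 2 * (\<mu> k powr r * (coef v k)\<^sup>2) + 2 * (\<mu> k powr r * (coef w k)\<^sup>2))"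
    using assms by (intro summable_add summable_mult) (auto simp: spectral_space_def)
  have "summable (\<lambda>k. \<mu> k powr r * (coef (\<lambda>x. v x - w x) k)\<^sup>2)"
    by (rule summable_comparison_test'[OF sm le])
  then show ?thesis using L by (auto simp: spectral_space_def)
qed

lemma spectral_space_scale:
  assumes "w \<in> spectral_space \<Omega> \<mu> \<phi> r"
  shows "(\<lambda>x. c * w x) \<in> spectral_space \<Omega> \<mu> \<phi> r"
proof -
  have "summable (\<lambda>k. c\<^sup>2 * (\<mu> k powr r * (coef w k)\<^sup>2))"
    using assms by (intro summable_mult) (simp add: spectral_space_def)
  then show ?thesis
    using assms by (auto simp: spectral_space_def power_mult_distrib mult.left_commute)
qed

lemma H10_subset_spectral_space: "H10 \<Omega> \<subseteq> spectral_space \<Omega> \<mu> \<phi> 1"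
proof
  fix w assume w: "w \<in> H10 \<Omega>"
  obtain B where B: "0 \<le> B"
    "\<And>v V K. v \<in> H10 \<Omega> \<Longrightarrow> has_weak_gradient \<Omega> v V \<Longrightarrow> (\<Sum>k<K. \<mu> k * (coef v k)\<^sup>2) \<le> B * L2_vec_sq \<Omega> V"
    by (rule energy_Bessel) blast
  obtain G where "has_weak_gradient \<Omega> w G" using w by (auto simp: H10_def)
  from B(2)[OF w this] have "summable (\<lambda>k. \<mu> k * (coef w k)\<^sup>2)"
    using eigenvalue_pos by (intro summableI_nonneg_bounded) (auto simp: less_imp_le)
  then show "w \<in> spectral_space \<Omega> \<mu> \<phi> 1"
    using H10_L2[OF w] eigenvalue_pos by (simp add: spectral_space_def less_imp_le)
qed

section \<open>Coefficients of solutions and solvability of the state equation\<close>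

lemma phi_spectral_space: "\<phi> k \<in> spectral_space \<Omega> \<mu> \<phi> r"
proof -
  have "summable (\<lambda>j. \<mu> j powr r * (coef (\<phi> k) j)\<^sup>2)"
    by (rule summable_finite[of "{k}"]) (auto simp: coef_phi)
  then show ?thesis by (simp add: spectral_space_def phi_L2)
qed

text \<open>Testing the weak equation with a single eigenfunction leaves one term of the series, so
  the solution operator is diagonal.\<close>

lemma frac_solution_coef:
  assumes "frac_solution \<Omega> \<mu> \<phi> s (L2_inner \<Omega> z) u"
  shows "coef u k = \<mu> k powr (- s) * coef z k"
proof -
  have "coef z k = frac_op \<Omega> \<mu> \<phi> s u (\<phi> k)"
    using assms phi_spectral_space by (simp add: frac_solution_def)
  also have "\<dots> = (\<Sum>j\<in>{k}. \<mu> j powr s * coef u j * coef (\<phi> k) j)"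
    unfolding frac_op_def by (rule suminf_finite) (auto simp: coef_phi)
  also have "\<dots> = \<mu> k powr s * coef u k" by (simp add: coef_phi)
  finally show ?thesis
    using eigenvalue_pos[of k] by (simp add: powr_minus field_simps)
qed

text \<open>Converse of the coefficient formula. Besides the equation, which is Parseval's identity,
  the functional must be bounded on the space of order s; this follows from a bound of the L2 norm
  by the spectral norm through the lowest eigenvalue bound.\<close>

lemma frac_solutionI:
  assumes "0 \<le> s" "z \<in> L2_fun \<Omega>" "u \<in> L2_fun \<Omega>" "\<And>k. coef u k = \<mu> k powr (- s) * coef z k"
  shows "frac_solution \<Omega> \<mu> \<phi> s (L2_inner \<Omega> z) u"
proof -
  have e: "\<mu> k powr s * coef u k = coef z k" for k
    using eigenvalue_pos[of k] by (simp add: assms(4) powr_minus)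
  obtain m where m: "0 < m" "\<And>k. m \<le> \<mu> k" using eigenvalues_bounded_below by blast
  have norm_le: "L2_norm \<Omega> v \<le> m powr (- s / 2) * spectral_norm \<Omega> \<mu> \<phi> s v"
    if v: "v \<in> spectral_space \<Omega> \<mu> \<phi> s" for v
  proof -
    have vL: "v \<in> L2_fun \<Omega>" and sm: "summable (\<lambda>k. \<mu> k powr s * (coef v k)\<^sup>2)"
      using v by (auto simp: spectral_space_def)
    have "(L2_norm \<Omega> v)\<^sup>2 = (\<Sum>k. (coef v k)\<^sup>2)"
      using Parseval[OF vL vL] by (simp add: L2_norm_sq sums_iff power2_eq_square[of "coef _ _"])
    also have "\<dots> \<le> (\<Sum>k. m powr (- s) * (\<mu> k powr s * (coef v k)\<^sup>2))"
    proof (rule suminf_le[OF _ coef_sq_summable[OF vL] summable_mult[OF sm]])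
      fix k
      have "1 = m powr (- s) * m powr s" using m(1) by (simp add: powr_add[symmetric])
      also have "\<dots> \<le> m powr (- s) * \<mu> k powr s"
        using m assms(1) by (intro mult_left_mono powr_mono2) auto
      finally have "1 * (coef v k)\<^sup>2 \<le> (m powr (- s) * \<mu> k powr s) * (coef v k)\<^sup>2"
        by (rule mult_right_mono) simp
      then show "(coef v k)\<^sup>2 \<le> m powr (- s) * (\<mu> k powr s * (coef v k)\<^sup>2)" by (simp add: mult.assoc)
    qed
    also have "\<dots> = (m powr (- s / 2))\<^sup>2 * (\<Sum>k. \<mu> k powr s * (coef v k)\<^sup>2)"
      using suminf_mult[OF sm] by (simp add: power2_eq_square powr_add[symmetric])
    also have "\<dots> = (m powr (- s / 2) * spectral_norm \<Omega> \<mu> \<phi> s v)\<^sup>2"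
      using suminf_nonneg[OF sm] by (simp add: spectral_norm_def power_mult_distrib)
    finally show ?thesis
      by (rule power2_le_imp_le) (simp add: spectral_norm_def suminf_nonneg[OF sm])
  qed
  have "L2_inner \<Omega> z \<in> spectral_dual \<Omega> \<mu> \<phi> s"
    unfolding spectral_dual_def
  proof (intro CollectI conjI ballI allI)
    fix v w assume "v \<in> spectral_space \<Omega> \<mu> \<phi> s" "w \<in> spectral_space \<Omega> \<mu> \<phi> s"
    then show "L2_inner \<Omega> z (\<lambda>x. v x + w x) = L2_inner \<Omega> z v + L2_inner \<Omega> z w"
      using assms(2) by (intro L2_inner_add_right) (auto simp: spectral_space_def)
  next
    have "\<bar>L2_inner \<Omega> z v\<bar> \<le> (L2_norm \<Omega> z * m powr (- s / 2)) * spectral_norm \<Omega> \<mu> \<phi> s v"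
      if v: "v \<in> spectral_space \<Omega> \<mu> \<phi> s" for v
    proof -
      have "\<bar>L2_inner \<Omega> z v\<bar> \<le> L2_norm \<Omega> z * L2_norm \<Omega> v"
        using assms(2) spectral_space_L2[OF v] by (rule L2_Cauchy_Schwarz)
      also have "\<dots> \<le> L2_norm \<Omega> z * (m powr (- s / 2) * spectral_norm \<Omega> \<mu> \<phi> s v)"
        by (intro mult_left_mono norm_le v L2_norm_nonneg)
      finally show ?thesis by (simp add: mult.assoc)
    qed
    then show "\<exists>C. \<forall>v\<in>spectral_space \<Omega> \<mu> \<phi> s. \<bar>L2_inner \<Omega> z v\<bar> \<le> C * spectral_norm \<Omega> \<mu> \<phi> s v" by blast
  qed simp
  moreover have "u \<in> spectral_space \<Omega> \<mu> \<phi> s"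
  proof -
    \<comment> \<open>One factor of the squared coefficient is absorbed into that of z, and Parseval
      gives summability of the product.\<close>
    have "\<mu> k powr s * (coef u k)\<^sup>2 = coef u k * coef z k" for k
      by (simp add: e[symmetric] power2_eq_square mult_ac)
    moreover have "summable (\<lambda>k. coef u k * coef z k)"
      using Parseval[OF assms(3,2)] by (simp add: sums_iff)
    ultimately show ?thesis using assms(3) by (simp add: spectral_space_def)
  qed
  moreover have "frac_op \<Omega> \<mu> \<phi> s u v = L2_inner \<Omega> z v" if "v \<in> spectral_space \<Omega> \<mu> \<phi> s" for v
    unfolding frac_op_def e using Parseval[OF assms(2) spectral_space_L2[OF that]] by (simp add: sums_iff)
  ultimately show ?thesis by (simp add: frac_solution_def)
qed

text \<open>The partial sums converge almost everywhere along a subsequence, and Fatou's lemma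
  bounds the distance of the partial sums to the pointwise limit.\<close>

lemma Riesz_Fischer:
  assumes "summable (\<lambda>k. (c k)\<^sup>2)"
  obtains w where "w \<in> L2_fun \<Omega>" "\<And>k. coef w k = c k"
proof -
  let ?M = "lebesgue_on \<Omega>"
  define S where "S = (\<lambda>N x. \<Sum>k<N. c k * \<phi> k x)"
  have SL: "S N \<in> L2_fun \<Omega>" for N unfolding S_def by (rule lincomb_L2)
  have one: "(\<lambda>x. 1) \<in> L2_fun \<Omega>" by (rule const_L2)
  \<comment> \<open>Tail of the coefficient series: by orthonormality it bounds the squared L2
    distance from S i to every later partial sum.\<close>
  define \<tau> where "\<tau> = (\<lambda>N. \<Sum>k. (c (k + N))\<^sup>2)"
  have tau0: "\<tau> \<longlonglongrightarrow> 0" unfolding \<tau>_def by (rule suminf_exist_split2[OF assms])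
  have diff_up: "(L2_norm \<Omega> (\<lambda>x. S j x - S i x))\<^sup>2 \<le> \<tau> i" if "i \<le> j" for i j
  proof -
    have "S j x - S i x = (\<Sum>k\<in>{i..<j}. c k * \<phi> k x)" for x
      unfolding S_def using that by (simp add: sum_diff_nat_ivl lessThan_atLeast0)
    then have "(L2_norm \<Omega> (\<lambda>x. S j x - S i x))\<^sup>2 = (\<Sum>k\<in>{i..<j}. (c k)\<^sup>2)"
      by (simp add: norm_lincomb)
    also have "\<dots> = (\<Sum>k<j - i. (c (k + i))\<^sup>2)"
      using sum.shift_bounds_nat_ivl[of "\<lambda>k. (c k)\<^sup>2" 0 i "j - i"] that by (simp add: lessThan_atLeast0)
    also have "\<dots> \<le> \<tau> i"
      unfolding \<tau>_def using summable_ignore_initial_segment[OF assms] by (intro sum_le_suminf) auto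
    finally show ?thesis .
  qed
  have int: "integrable ?M (S N)" for N
    using L2_fun_prod_integrable[OF SL one] by simp
  \<comment> \<open>Since \<Omega> has finite measure, Cauchy-Schwarz against the constant 1 turns
    the L2 Cauchy property into the L1 one, from which a subsequence converging almost everywhere is
    extracted.\<close>
  have cauchy: "\<exists>N. \<forall>i\<ge>N. \<forall>j\<ge>N. integral\<^sup>L ?M (\<lambda>x. norm (S i x - S j x)) < e" if "e > 0" for e
  proof -
    let ?n = "L2_norm \<Omega> (\<lambda>x. 1)"
    have "(\<lambda>N. sqrt (\<tau> N) * ?n) \<longlonglongrightarrow> 0"
      using tendsto_mult_left[OF tendsto_real_sqrt[OF tau0]] by (auto intro!: tendsto_eq_intros tau0)
    then have "\<forall>\<^sub>F N in sequentially. sqrt (\<tau> N) * ?n < e / 2"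
      using that by (intro order_tendstoD) auto
    then obtain N where N: "\<And>i. i \<ge> N \<Longrightarrow> sqrt (\<tau> i) * ?n < e / 2"
      by (auto simp: eventually_sequentially)
    have half: "integral\<^sup>L ?M (\<lambda>x. norm (S j x - S i x)) < e" if "i \<ge> N" "i \<le> j" for i j
    proof -
      have D: "(\<lambda>x. \<bar>S j x - S i x\<bar>) \<in> L2_fun \<Omega>"
        using L2_fun_diff[OF SL[of j] SL[of i]] by (auto simp: L2_fun_def)
      have "integral\<^sup>L ?M (\<lambda>x. norm (S j x - S i x)) = L2_inner \<Omega> (\<lambda>x. \<bar>S j x - S i x\<bar>) (\<lambda>x. 1)"
        by (simp add: L2_inner_def)
      also have "\<dots> \<le> L2_norm \<Omega> (\<lambda>x. \<bar>S j x - S i x\<bar>) * ?n"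
        using L2_Cauchy_Schwarz[OF D one] by simp
      also have "L2_norm \<Omega> (\<lambda>x. \<bar>S j x - S i x\<bar>) = L2_norm \<Omega> (\<lambda>x. S j x - S i x)"
        by (simp add: L2_norm_def L2_inner_def)
      also have "\<dots> * ?n \<le> sqrt (\<tau> i) * ?n"
        using diff_up[OF that(2)] by (intro mult_right_mono real_le_rsqrt L2_norm_nonneg)
      finally show ?thesis using N[OF that(1)] \<open>e > 0\<close> by simp
    qed
    show ?thesis
    proof (intro exI[of _ N] allI impI)
      fix i j assume "i \<ge> N" "j \<ge> N"
      then show "integral\<^sup>L ?M (\<lambda>x. norm (S i x - S j x)) < e"
        using half[of i j] half[of j i] by (cases "i \<le> j") (auto simp: abs_minus_commute)
    qed
  qed
  obtain \<rho> where \<rho>: "strict_mono \<rho>" "AE x in ?M. Cauchy (\<lambda>i. S (\<rho> i) x)"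
    by (rule cauchy_L1_AE_cauchy_subseq[OF int cauchy])
  define w where "w = (\<lambda>x. lim (\<lambda>i. S (\<rho> i) x))"
  have Sm: "S N \<in> borel_measurable ?M" for N using SL by (rule L2_fun_measurable)
  have wm: "w \<in> borel_measurable ?M"
    unfolding w_def by (rule borel_measurable_lim_metric) (rule Sm)
  have conv: "AE x in ?M. (\<lambda>i. S (\<rho> i) x) \<longlonglongrightarrow> w x"
    using \<rho>(2) by eventually_elim (simp add: w_def Cauchy_convergent_iff convergent_LIMSEQ_iff)
  have fatou: "(\<integral>\<^sup>+x. ennreal ((w x - S N x)\<^sup>2) \<partial>?M) \<le> ennreal (\<tau> N)" for N
  proof -
    have "(\<integral>\<^sup>+x. ennreal ((w x - S N x)\<^sup>2) \<partial>?M)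
        = (\<integral>\<^sup>+x. liminf (\<lambda>i. ennreal ((S (\<rho> i) x - S N x)\<^sup>2)) \<partial>?M)"
    proof (rule nn_integral_cong_AE)
      show "AE x in ?M. ennreal ((w x - S N x)\<^sup>2) = liminf (\<lambda>i. ennreal ((S (\<rho> i) x - S N x)\<^sup>2))"
        using conv
      proof eventually_elim
        case (elim x)
        then have "(\<lambda>i. ennreal ((S (\<rho> i) x - S N x)\<^sup>2)) \<longlonglongrightarrow> ennreal ((w x - S N x)\<^sup>2)"
          by (intro tendsto_ennrealI tendsto_intros)
        then show ?case by (intro lim_imp_Liminf[symmetric]) auto
      qed
    qed
    also have "\<dots> \<le> liminf (\<lambda>i. \<integral>\<^sup>+x. ennreal ((S (\<rho> i) x - S N x)\<^sup>2) \<partial>?M)"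
      using Sm by (intro nn_integral_liminf) auto
    also have "\<dots> \<le> liminf (\<lambda>i. ennreal (\<tau> N))"
    proof (rule Liminf_mono)
      have "(\<integral>\<^sup>+x. ennreal ((S (\<rho> i) x - S N x)\<^sup>2) \<partial>?M) \<le> ennreal (\<tau> N)" if "i \<ge> N" for i
      proof -
        have "(\<integral>\<^sup>+x. ennreal ((S (\<rho> i) x - S N x)\<^sup>2) \<partial>?M) = ennreal ((L2_norm \<Omega> (\<lambda>x. S (\<rho> i) x - S N x))\<^sup>2)"
          using L2_fun_sq_integrable[OF L2_fun_diff[OF SL[of "\<rho> i"] SL[of N]]]
          by (subst nn_integral_eq_integral) (auto simp: L2_norm_sq L2_inner_def power2_eq_square[symmetric])
        also have "\<dots> \<le> ennreal (\<tau> N)"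
          \<comment> \<open>A strictly increasing \<rho> satisfies \<open>i \<le> \<rho> i\<close>,
            so \<open>\<rho> i\<close> also lies beyond N.\<close>
          using that seq_suble[OF \<rho>(1), of i] by (intro ennreal_leI diff_up) linarith
        finally show ?thesis .
      qed
      then show "\<forall>\<^sub>F i in sequentially. (\<integral>\<^sup>+x. ennreal ((S (\<rho> i) x - S N x)\<^sup>2) \<partial>?M) \<le> ennreal (\<tau> N)"
        by (auto simp: eventually_sequentially)
    qed
    also have "\<dots> = ennreal (\<tau> N)" by (simp add: Liminf_const)
    finally show ?thesis .
  qed
  have tau_nonneg: "0 \<le> \<tau> N" for N
    unfolding \<tau>_def using summable_ignore_initial_segment[OF assms] by (intro suminf_nonneg) auto
  have DL: "(\<lambda>x. w x - S N x) \<in> L2_fun \<Omega>" for N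
  proof -
    have "integrable ?M (\<lambda>x. (w x - S N x)\<^sup>2)"
      using wm Sm[of N] le_less_trans[OF fatou[of N]] by (intro integrableI_nonneg) auto
    then show ?thesis using wm Sm[of N] by (simp add: L2_fun_def)
  qed
  \<comment> \<open>The empty partial sum is 0, so the case N = 0 is square integrability of w
    itself.\<close>
  have w: "w \<in> L2_fun \<Omega>" using DL[of 0] by (simp add: S_def)
  have "(L2_norm \<Omega> (\<lambda>x. w x - S N x))\<^sup>2 \<le> \<tau> N" for N
  proof -
    have "ennreal ((L2_norm \<Omega> (\<lambda>x. w x - S N x))\<^sup>2) = (\<integral>\<^sup>+x. ennreal ((w x - S N x)\<^sup>2) \<partial>?M)"
      using L2_fun_sq_integrable[OF DL[of N]]
      by (subst nn_integral_eq_integral) (auto simp: L2_norm_sq L2_inner_def power2_eq_square[symmetric])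
    with fatou[of N] have "ennreal ((L2_norm \<Omega> (\<lambda>x. w x - S N x))\<^sup>2) \<le> ennreal (\<tau> N)"
      by (simp only:)
    then show ?thesis by (simp only: ennreal_le_iff[OF tau_nonneg])
  qed
  then have ev: "\<forall>\<^sub>F N in sequentially. norm (L2_norm \<Omega> (\<lambda>x. w x - S N x)) \<le> sqrt (\<tau> N)"
    by (simp add: L2_norm_nonneg real_le_rsqrt)
  have "(\<lambda>N. sqrt (\<tau> N)) \<longlonglongrightarrow> 0" using tendsto_real_sqrt[OF tau0] by simp
  with ev have lim: "(\<lambda>N. L2_norm \<Omega> (\<lambda>x. w x - S N x)) \<longlonglongrightarrow> 0"
    by (rule Lim_null_comparison)
  have "coef w k = c k" for k
  proof (rule LIMSEQ_unique)
    show "(\<lambda>N. coef (S N) k) \<longlonglongrightarrow> coef w k" by (rule coef_tendsto[OF SL w lim])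
    show "(\<lambda>N. coef (S N) k) \<longlonglongrightarrow> c k"
      by (rule tendsto_eventually) (auto simp: S_def coef_lincomb eventually_sequentially intro!: exI[of _ "Suc k"])
  qed
  with w show thesis by (rule that)
qed

text \<open>Provides the state belonging to a perturbation of the control. Multiplication by
  \<open>\<mu> k powr (- s)\<close> keeps the coefficients square summable because the eigenvalues
  stay away from 0.\<close>

lemma frac_solution_exists:
  assumes "0 \<le> s" "z \<in> L2_fun \<Omega>"
  obtains u where "frac_solution \<Omega> \<mu> \<phi> s (L2_inner \<Omega> z) u" "u \<in> L2_fun \<Omega>"
proof -
  obtain m where m: "0 < m" "\<And>k. m \<le> \<mu> k" using eigenvalues_bounded_below by blast
  have "summable (\<lambda>k. (\<mu> k powr (- s) * coef z k)\<^sup>2)"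
  proof (rule summable_comparison_test'[where N = 0])
    show "summable (\<lambda>k. (m powr (- s))\<^sup>2 * (coef z k)\<^sup>2)"
      by (intro summable_mult coef_sq_summable assms(2))
    show "norm ((\<mu> k powr (- s) * coef z k)\<^sup>2) \<le> (m powr (- s))\<^sup>2 * (coef z k)\<^sup>2" for k
      using m assms(1) by (auto simp: power_mult_distrib intro!: mult_right_mono power_mono powr_mono2')
  qed
  from Riesz_Fischer[OF this] obtain u where "u \<in> L2_fun \<Omega>" "\<And>k. coef u k = \<mu> k powr (- s) * coef z k" by blast
  then show thesis using that frac_solutionI[OF assms] by blast
qed

lemma frac_solution_spectral_space:
  assumes "frac_solution \<Omega> \<mu> \<phi> s (L2_inner \<Omega> z) u" "z \<in> spectral_space \<Omega> \<mu> \<phi> r"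
  shows "u \<in> spectral_space \<Omega> \<mu> \<phi> (r + 2 * s)"
proof -
  have "\<mu> k powr (r + 2 * s) * (coef u k)\<^sup>2 = \<mu> k powr r * (coef z k)\<^sup>2" for k
    using eigenvalue_pos[of k]
    by (simp add: frac_solution_coef[OF assms(1)] power_mult_distrib power2_eq_square powr_add[symmetric] mult.assoc[symmetric])
  then show ?thesis
    using assms by (simp add: spectral_space_def frac_solution_def)
qed

section \<open>The optimality condition\<close>

text \<open>First-order condition of a convex problem: on the segment from z to z' the reduced cost
  is quadratic in t with minimum at t = 0, so its slope there is nonnegative. The adjoint state
  represents this slope.\<close>

lemma optimality_inequality:
  assumes "0 < s" "0 < \<theta>" "ud \<in> L2_fun \<Omega>"
    and opt: "optimal_pair \<Omega> \<mu> \<phi> s \<theta> ud a b u z"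
    and adj: "adjoint_state \<Omega> \<mu> \<phi> s ud u p"
    and z': "z' \<in> admissible \<Omega> a b"
  shows "0 \<le> L2_inner \<Omega> (\<lambda>x. p x + \<theta> * z x) (\<lambda>x. z' x - z x)"
proof -
  have zadm: "z \<in> admissible \<Omega> a b" and u: "frac_solution \<Omega> \<mu> \<phi> s (L2_inner \<Omega> z) u"
    using opt by (auto simp: optimal_pair_def)
  have p: "frac_solution \<Omega> \<mu> \<phi> s (L2_inner \<Omega> (\<lambda>x. u x - ud x)) p"
    using adj by (simp add: adjoint_state_def)
  have zL: "z \<in> L2_fun \<Omega>" "z' \<in> L2_fun \<Omega>" using zadm z' by (auto simp: admissible_def)
  have uL: "u \<in> L2_fun \<Omega>" "p \<in> L2_fun \<Omega>"
    using u p by (auto simp: frac_solution_def spectral_space_def)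
  define h where "h = (\<lambda>x. z' x - z x)"
  have hL: "h \<in> L2_fun \<Omega>" unfolding h_def using zL by blast
  obtain y where y: "frac_solution \<Omega> \<mu> \<phi> s (L2_inner \<Omega> h) y" "y \<in> L2_fun \<Omega>"
    by (rule frac_solution_exists[OF less_imp_le[OF assms(1)] hL])
  define e where "e = (\<lambda>x. u x - ud x)"
  have eL: "e \<in> L2_fun \<Omega>" unfolding e_def using uL assms(3) by blast
  \<comment> \<open>Self-adjointness of the solution operator: both inner products have the terms
    \<open>\<mu> k powr (- s) * coef e k * coef h k\<close>.\<close>
  have ey: "L2_inner \<Omega> e y = L2_inner \<Omega> p h"
  proof -
    have "(\<lambda>k. coef e k * coef y k) = (\<lambda>k. coef p k * coef h k)"
      using frac_solution_coef[OF p] frac_solution_coef[OF y(1)] by (auto simp: e_def)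
    then show ?thesis
      using sums_unique2[OF Parseval[OF eL y(2)]] Parseval[OF uL(2) hL] by simp
  qed
  \<comment> \<open>Q and P are the second and first order coefficients of the increment of the cost
    along z + t h.\<close>
  define Q where "Q = (L2_norm \<Omega> y)\<^sup>2 / 2 + \<theta> / 2 * (L2_norm \<Omega> h)\<^sup>2"
  define P where "P = L2_inner \<Omega> p h + \<theta> * L2_inner \<Omega> z h"
  have step: "0 \<le> t * P + t\<^sup>2 * Q" if t: "0 \<le> t" "t \<le> 1" for t
  proof -
    define zt ut where "zt = (\<lambda>x. z x + t * h x)" and "ut = (\<lambda>x. u x + t * y x)"
    have L: "zt \<in> L2_fun \<Omega>" "ut \<in> L2_fun \<Omega>"
      unfolding zt_def ut_def by (intro L2_fun_add L2_fun_scale zL uL hL y(2))+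
    have "AE x in lebesgue_on \<Omega>. a \<le> z x \<and> z x \<le> b" "AE x in lebesgue_on \<Omega>. a \<le> z' x \<and> z' x \<le> b"
      using zadm z' by (auto simp: admissible_def)
    then have "AE x in lebesgue_on \<Omega>. a \<le> zt x \<and> zt x \<le> b"
    proof eventually_elim
      case (elim x)
      have "zt x = (1 - t) * z x + t * z' x" by (simp add: zt_def h_def algebra_simps)
      then show ?case
        using elim t convex_bound_le[of "z x" b "z' x" "1 - t" t]
          convex_bound_le[of "- z x" "- a" "- z' x" "1 - t" t] by (simp add: algebra_simps)
    qed
    with L have adm: "zt \<in> admissible \<Omega> a b" by (simp add: admissible_def)
    have "frac_solution \<Omega> \<mu> \<phi> s (L2_inner \<Omega> zt) ut"
    proof (rule frac_solutionI)
      have "coef ut k = coef u k + t * coef y k" "coef zt k = coef z k + t * coef h k" for k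
        unfolding ut_def zt_def using zL uL hL y(2) phi_L2 by (simp_all add: L2_inner_add_left L2_fun_scale)
      then show "coef ut k = \<mu> k powr (- s) * coef zt k" for k
        by (simp add: frac_solution_coef[OF u] frac_solution_coef[OF y(1)] algebra_simps)
    qed (use assms(1) L in auto)
    then have le: "cost \<Omega> \<theta> ud u z \<le> cost \<Omega> \<theta> ud ut zt"
      using opt adm by (simp add: optimal_pair_def)
    have ut: "(\<lambda>x. ut x - ud x) = (\<lambda>x. e x + t * y x)" by (auto simp: ut_def e_def)
    have sq: "L2_inner \<Omega> (\<lambda>x. f x + t * g x) (\<lambda>x. f x + t * g x) =
        L2_inner \<Omega> f f + 2 * t * L2_inner \<Omega> f g + t\<^sup>2 * L2_inner \<Omega> g g"
      if "f \<in> L2_fun \<Omega>" "g \<in> L2_fun \<Omega>" for f g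
      using that L2_fun_add[OF that(1) L2_fun_scale[OF that(2)]] L2_fun_scale[OF that(2)]
      by (simp add: L2_inner_add_left L2_inner_add_right L2_inner_commute[of \<Omega> g f] power2_eq_square algebra_simps)
    have "cost \<Omega> \<theta> ud ut zt = cost \<Omega> \<theta> ud u z + t * P + t\<^sup>2 * Q"
      unfolding cost_def ut unfolding zt_def L2_norm_sq sq[OF eL y(2)] sq[OF zL(1) hL] P_def Q_def ey[symmetric]
      by (simp add: e_def[symmetric] algebra_simps)
    with le show ?thesis by simp
  qed
  \<comment> \<open>Division by t > 0 and t -> 0 from the right leave the sign of P.\<close>
  have nn: "0 \<le> P + t * Q" if t: "0 < t" "t \<le> 1" for t
    using step[of t] t by (simp add: power2_eq_square distrib_left[symmetric] mult.assoc zero_le_mult_iff)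
  have lim: "((\<lambda>t. P + t * Q) \<longlongrightarrow> P + 0 * Q) (at_right 0)"
    by (intro tendsto_intros)
  have "\<forall>\<^sub>F t in at_right (0::real). 0 \<le> P + t * Q"
    using eventually_at_right_real[OF zero_less_one] by (rule eventually_mono) (use nn in auto)
  with lim have "0 \<le> P + 0 * Q"
    by (rule tendsto_lowerbound) simp
  then show ?thesis
    using zL uL hL by (simp add: P_def h_def[symmetric] L2_inner_add_left L2_fun_scale)
qed

text \<open>The optimality inequality is tested with the truncation T of - p / \<theta>, which is
  admissible. Pointwise its integrand is at most - \<theta> (T - z)^2, so T and z are at L2 distance
  0 and share all coefficients.\<close>

lemma optimal_control_projection:
  assumes "0 < s" "0 < \<theta>" "ud \<in> L2_fun \<Omega>" "a \<le> 0" "0 \<le> b"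
    and opt: "optimal_pair \<Omega> \<mu> \<phi> s \<theta> ud a b u z"
    and adj: "adjoint_state \<Omega> \<mu> \<phi> s ud u p"
  shows "coef z k = coef (\<lambda>x. truncate a b (- 1 / \<theta> * p x)) k"
proof -
  have zadm: "z \<in> admissible \<Omega> a b" using opt by (simp add: optimal_pair_def)
  then have zL: "z \<in> L2_fun \<Omega>" by (simp add: admissible_def)
  have pL: "p \<in> L2_fun \<Omega>"
    using adj by (simp add: adjoint_state_def frac_solution_def spectral_space_def)
  define q where "q = (\<lambda>x. - 1 / \<theta> * p x)"
  have qL: "q \<in> L2_fun \<Omega>" unfolding q_def using pL by (rule L2_fun_scale)
  define T where "T = (\<lambda>x. truncate a b (q x))"
  have TL: "T \<in> L2_fun \<Omega>" unfolding T_def by (rule truncate_L2[OF assms(4,5) qL])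
  have "a \<le> b" using assms(4,5) by linarith
  then have Tadm: "T \<in> admissible \<Omega> a b"
    using TL by (auto simp: admissible_def T_def truncate_def)
  have DL: "(\<lambda>x. T x - z x) \<in> L2_fun \<Omega>" "(\<lambda>x. p x + \<theta> * z x) \<in> L2_fun \<Omega>"
    by (intro L2_fun_diff L2_fun_add L2_fun_scale TL zL pL)+
  have "0 \<le> L2_inner \<Omega> (\<lambda>x. p x + \<theta> * z x) (\<lambda>x. T x - z x)"
    by (rule optimality_inequality[OF assms(1-3) opt adj Tadm])
  also have "\<dots> \<le> - \<theta> * L2_inner \<Omega> (\<lambda>x. T x - z x) (\<lambda>x. T x - z x)"
  proof -
    have "L2_inner \<Omega> (\<lambda>x. p x + \<theta> * z x) (\<lambda>x. T x - z x)
        \<le> integral\<^sup>L (lebesgue_on \<Omega>) (\<lambda>x. - \<theta> * ((T x - z x) * (T x - z x)))"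
      unfolding L2_inner_def
    proof (rule integral_mono_AE)
      show "integrable (lebesgue_on \<Omega>) (\<lambda>x. (p x + \<theta> * z x) * (T x - z x))"
        by (rule L2_fun_prod_integrable[OF DL(2,1)])
      show "integrable (lebesgue_on \<Omega>) (\<lambda>x. - \<theta> * ((T x - z x) * (T x - z x)))"
        using L2_fun_prod_integrable[OF DL(1,1)] by simp
      have "AE x in lebesgue_on \<Omega>. a \<le> z x \<and> z x \<le> b"
        using zadm by (simp add: admissible_def)
      then show "AE x in lebesgue_on \<Omega>. (p x + \<theta> * z x) * (T x - z x) \<le> - \<theta> * ((T x - z x) * (T x - z x))"
      proof eventually_elim
        case (elim x)
        \<comment> \<open>Obtuse angle property of the projection onto an interval: q - T is nonzero
          only at an endpoint, from which z lies on the other side.\<close>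
        have "(q x - T x) * (z x - T x) \<le> 0"
          using elim by (auto simp: T_def truncate_def max_def min_def mult_le_0_iff)
        then have "\<theta> * ((q x - T x) * (z x - T x)) \<le> 0"
          using assms(2) by (simp add: mult_le_0_iff)
        moreover have "(p x + \<theta> * z x) * (T x - z x) =
            - \<theta> * ((T x - z x) * (T x - z x)) + \<theta> * ((q x - T x) * (z x - T x))"
          using assms(2) by (simp add: q_def field_simps)
        ultimately show ?case by linarith
      qed
    qed
    then show ?thesis by (simp add: L2_inner_def)
  qed
  finally have "L2_inner \<Omega> (\<lambda>x. T x - z x) (\<lambda>x. T x - z x) \<le> 0"
    using assms(2) by (simp add: mult_le_0_iff zero_le_mult_iff)
  then have "L2_norm \<Omega> (\<lambda>x. T x - z x) = 0"
    using L2_inner_self_nonneg[of \<Omega> "\<lambda>x. T x - z x"] by (simp add: L2_norm_def)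
  then have "coef (\<lambda>x. T x - z x) k = 0"
    using L2_Cauchy_Schwarz[OF DL(1) phi_L2[of k]] by simp
  then show ?thesis
    using TL zL phi_L2 by (simp add: L2_inner_diff_left T_def q_def)
qed

text \<open>Each pass through state equation, adjoint equation and projection formula gains \<open>4s\<close> derivatives,
  until the order \<open>1\<close> is reached.\<close>

lemma optimal_control_bootstrap:
  assumes "0 < s" "0 < \<theta>" "a \<le> 0" "0 \<le> b"
    and ud: "ud \<in> spectral_space \<Omega> \<mu> \<phi> (1 - s)"
    and opt: "optimal_pair \<Omega> \<mu> \<phi> s \<theta> ud a b u z"
    and adj: "adjoint_state \<Omega> \<mu> \<phi> s ud u p"
  shows "z \<in> spectral_space \<Omega> \<mu> \<phi> (min (4 * s * real n) 1)"
proof (induction n)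
  case 0
  show ?case
    using opt spectral_space_0[of z] by (simp add: optimal_pair_def admissible_def)
next
  case (Suc n)
  let ?r = "min (4 * s * real n) 1" and ?r' = "min (4 * s * real (Suc n)) 1"
  have u: "frac_solution \<Omega> \<mu> \<phi> s (L2_inner \<Omega> z) u" and zL: "z \<in> L2_fun \<Omega>"
    using opt by (auto simp: optimal_pair_def admissible_def)
  have p: "frac_solution \<Omega> \<mu> \<phi> s (L2_inner \<Omega> (\<lambda>x. u x - ud x)) p"
    using adj by (simp add: adjoint_state_def)
  have "u \<in> spectral_space \<Omega> \<mu> \<phi> (?r + 2 * s)"
    by (rule frac_solution_spectral_space[OF u Suc.IH])
  from spectral_space_mono[OF this] have "(\<lambda>x. u x - ud x) \<in> spectral_space \<Omega> \<mu> \<phi> (min (?r + 2 * s) (1 - s))"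
    by (intro spectral_space_diff spectral_space_mono[OF ud]) auto
  then have "p \<in> spectral_space \<Omega> \<mu> \<phi> (min (?r + 2 * s) (1 - s) + 2 * s)"
    by (rule frac_solution_spectral_space[OF p])
  \<comment> \<open>The right side is min (r + 4 s) (1 + s): the desired state, of order 1 - s,
    limits p to order 1 + s, which still exceeds 1.\<close>
  moreover have "?r' \<le> min (?r + 2 * s) (1 - s) + 2 * s"
    using assms(1) by (auto simp: min_def algebra_simps)
  ultimately have "p \<in> spectral_space \<Omega> \<mu> \<phi> ?r'"
    by (rule spectral_space_mono)
  \<comment> \<open>Truncation requires an order in (0, 1]: positivity holds since the step count is
    at least one, and the cap at 1 is built into \<open>?r'\<close>.\<close>
  then have "(\<lambda>x. truncate a b (- 1 / \<theta> * p x)) \<in> spectral_space \<Omega> \<mu> \<phi> ?r'"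
    using assms(1,3,4) by (intro truncate_spectral_space spectral_space_scale) auto
  moreover have "coef z k = coef (\<lambda>x. truncate a b (- 1 / \<theta> * p x)) k" for k
    using optimal_control_projection[OF assms(1,2) spectral_space_L2[OF ud] assms(3,4) opt adj] .
  ultimately show ?case using zL by (simp add: spectral_space_def)
qed

text \<open>About 1 / (4 s) passes suffice for z to reach order 1; the state equation then adds 2 s.
  For p the right side u - u_d must have order 1 too, which is where the desired state in
  \<open>H10\<close> enters.\<close>

lemma optimal_state_regularity:
  assumes "0 < s" "0 < \<theta>" "a \<le> 0" "0 \<le> b"
    and ud: "ud \<in> spectral_space \<Omega> \<mu> \<phi> (1 - s)"
    and opt: "optimal_pair \<Omega> \<mu> \<phi> s \<theta> ud a b u z"
    and adj: "adjoint_state \<Omega> \<mu> \<phi> s ud u p"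
  shows "u \<in> spectral_space \<Omega> \<mu> \<phi> (1 + 2 * s)"
    and "ud \<in> H10 \<Omega> \<Longrightarrow> p \<in> spectral_space \<Omega> \<mu> \<phi> (1 + 2 * s)"
proof -
  obtain n where "1 / (4 * s) \<le> real n" using real_arch_simple by blast
  then have "min (4 * s * real n) 1 = 1" using assms(1) by (simp add: field_simps)
  then have z: "z \<in> spectral_space \<Omega> \<mu> \<phi> 1"
    using optimal_control_bootstrap[OF assms, of n] by simp
  show u: "u \<in> spectral_space \<Omega> \<mu> \<phi> (1 + 2 * s)"
    using opt z by (intro frac_solution_spectral_space) (auto simp: optimal_pair_def)
  assume "ud \<in> H10 \<Omega>"
  then have "(\<lambda>x. u x - ud x) \<in> spectral_space \<Omega> \<mu> \<phi> 1"
    using spectral_space_mono[OF u, of 1] assms(1) H10_subset_spectral_space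
    by (intro spectral_space_diff) auto
  then show "p \<in> spectral_space \<Omega> \<mu> \<phi> (1 + 2 * s)"
    using adj by (intro frac_solution_spectral_space) (auto simp: adjoint_state_def)
qed

end

theorem lemma3p4:
  fixes \<Omega> :: "(real ^ 'n) set"
    and A :: "real ^ 'n \<Rightarrow> real ^ 'n ^ 'n"
    and \<mu> :: "nat \<Rightarrow> real"
    and \<phi> :: "nat \<Rightarrow> real ^ 'n \<Rightarrow> real"
    and s \<theta> a b :: real
    and ud ubar zbar pbar :: "real ^ 'n \<Rightarrow> real"
  assumes "lipschitz_domain \<Omega>"
    and "elliptic_coefficient \<Omega> A"
    and "eigenbasis \<Omega> A \<mu> \<phi>"
    and "0 < s" and "s < 1"
    and "0 < \<theta>" and "a < b"
    and "ud \<in> L2_fun \<Omega>"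
    and "optimal_pair \<Omega> \<mu> \<phi> s \<theta> ud a b ubar zbar"
    and "adjoint_state \<Omega> \<mu> \<phi> s ud ubar pbar"
    and "convex \<Omega>"
    and "\<exists>L. L-lipschitz_on (closure \<Omega>) A"
    and "a < 0" and "0 < b"
    and "ud \<in> spectral_space \<Omega> \<mu> \<phi> (1 - s)"
  shows "ubar \<in> spectral_space \<Omega> \<mu> \<phi> (min (1 + 2 * s) 2) \<and>
    (ud \<in> H10 \<Omega> \<longrightarrow> pbar \<in> spectral_space \<Omega> \<mu> \<phi> (min (1 + 2 * s) 2))"
proof -
  interpret elliptic_eigenbasis \<Omega> A \<mu> \<phi>
    using assms(1-3) by unfold_locales (auto simp: lipschitz_domain_def)
  have ab: "a \<le> 0" "0 \<le> b" using assms by auto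
  \<comment> \<open>Both functions have order \<open>1 + 2 * s\<close>, and the capped order follows
    by monotonicity of the scale.\<close>
  show ?thesis
    using optimal_state_regularity[OF assms(4,6) ab assms(15,9,10)]
      spectral_space_mono[where r' = "1 + 2 * s" and r = "min (1 + 2 * s) 2"] by auto
qed

end
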